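(* Let $L = L_{\overline{0}} \oplus L_{\overline{1}}$ be a finite-dimensional Lie superalgebra over an algebraically closed field $k$ of characteristic $2$, with quadratic operator $q : L_{\overline{1}} \to L_{\overline{0}}$. Then, as subsets of $L_{\overline{1}}$, $$\mathcal{X}_L(k)^{(-1)} = \mathcal{N}_{\mathrm{odd}}(L) := \{ x \in L_{\overline{1}} : q(x) = 0 \}.$$
   Context: Lie superalgebras. Over a field $k$ of characteristic $2$, a Lie superalgebra is a $\mathbb{Z}/2\mathbb{Z}$-graded vector space $L = L_{\overline{0}} \oplus L_{\overline{1}}$ with a degree-preserving bilinear bracket and a quadratic operator $q : L_{\overline{1}} \to L_{\overline{0}}$ (in particular $q(\alpha y)=\alpha^2 q(y)$) such that: $[x,y] = [y,x]$; $[x,[y,z]] = [[x,y],z] + [y,[x,z]]$; $[x,x]=0$ for $x \in L_{\overline{0}}$; $[y,[y,y]]=0$ for $y \in L_{\overline{1}}$; $[x,y] = q(x+y)-q(x)-q(y)$ for $x,y \in L_{\overline{1}}$; $[y,[y,z]] = [q(y),z]$ for $y \in L_{\overline{1}}$, $z \in L$. $U(L)$ is the quotient of $T(L)$ by the ideal generated by $x \otimes y - y \otimes x - [x,y]$ ($x,y\in L$) and $y \otimes y - q(y)$ ($y \in L_{\overline{1}}$); it is a Hopf algebra with the elements of $L$ primitive. Koszul complex. Let $\overline{Y}(L) = \Lambda(L_{\overline{0}}) \otimes \Gamma(L_{\overline{1}})$ (exterior algebra tensor divided power algebra), $\mathbb{N}$-graded with $\overline{Y}_1(L) \cong L$; write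 $\langle x\rangle$ and $\gamma_r(y)$ for the generators ($x \in L_{\overline{0}}$, $y \in L_{\overline{1}}$) and $s : L \to \overline{Y}_1(L)$ for the identification. $L$ acts on the right of $\overline{Y}(L)$ by derivations with $\langle x\rangle.u = s([x,u])$ and $\gamma_r(y).u = \gamma_{r-1}(y)\, s([y,u])$. Let $Y(L) = U(L) \# \overline{Y}(L)$ be the smash product (equal to $U(L)\otimes \overline{Y}(L)$ as a left $U(L)$-module, with $z u = u z + z.u$ for $z \in \overline{Y}(L)$, $u \in L$), a bialgebra via the coproducts of $U(L)$ and $\overline{Y}(L)$. It has a differential $d$ making it a differential graded bialgebra and a left $U(L)$-free resolution of $k$, with $d(u)=0$ for $u\in U(L)$, $d(\langle x \rangle) = x$, and $d(\gamma_r(y)) = y\gamma_{r-1}(y) - \langle q(y)\rangle \gamma_{r-2}(y)$. Then $C^\bullet(L,k) = \mathrm{Hom}_{U(L)}(Y_\bullet(L),k) \cong \Lambda(L_{\overline{0}}^* ) \otimes S(L_{\overline{1}}^* )$ as an algebra (with $L_{\overline 0}^*$ and $L_{\overline 1}^*$ in degree $1$), and its cohomology ring is $\mathrm{H}^\bullet(L,k) = \mathrm{Ext}^\bullet_{U(L)}(k,k)$, which is commutative. The map $\varphi$. For a vector space $V$, $V^{(1)} = k \otimes_{\lambda\mapsto\lambda^2} V$ is its Frobenius twist; $L_{\overline{1}}^*[2]$ is $L_{\overline{1}}^*$ placed in degree $2$. The map $\lambda \otimes z \mapsto \lambda z^2$ from $S(L_{\overline{1}}^*[2])^{(1)}$ to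 $S(L_{\overline{1}}^* ) \subseteq C^\bullet(L,k)$ has image consisting of cocycles and induces a graded algebra homomorphism $\varphi : S(L_{\overline{1}}^*[2])^{(1)} \to \mathrm{H}^\bullet(L,k)$. The variety. For a finite-dimensional $U(L)$-supermodule ($\mathbb{Z}/2\mathbb{Z}$-graded module) $M$, let $I(M)$ be the annihilator of $\mathrm{Ext}^\bullet_{U(L)}(M,M)$ under the cup product action of $\mathrm{H}^\bullet(L,k)$, let $J_L(M) = \varphi^{-1}(I(M))$, and $\mathcal{X}_L(M) = \mathrm{MaxSpec}\big(S(L_{\overline{1}}^*[2])^{(1)}/J_L(M)\big)$, a closed subvariety of $L_{\overline{1}}^{(1)}$. Here $X^{(1)}$ denotes the affine variety with coordinate algebra $k[X]^{(1)}$, and $Y^{(-1)} = X$ if $Y = X^{(1)}$. Concretely, $\mathcal{X}_L(M)^{(-1)} = \{x \in L_{\overline{1}} : f(x) = 0 \text{ for all } f \in S(L_{\overline{1}}^* ) \text{ with } \varphi(1 \otimes f) \in I(M)\}$, where $\varphi(1 \otimes f)$ is the class of the cocycle $f^2$. The case in the claim is $M = k$, the trivial module (in even degree). *)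

theory Defs
  imports
    "HOL-Library.Poly_Mapping"
    "HOL-Library.Product_Plus"
    "HOL-Computational_Algebra.Polynomial"
    "HOL-Algebra.QuotRing"
begin

section \<open>Lie superalgebras in characteristic 2\<close>

text \<open>
  The underlying super vector space is the direct sum of its even part, carried by the type
  \<open>'a\<close>, and its odd part, carried by the type \<open>'b\<close>.
  Hence \<open>L = 'a \<times> 'b\<close>, where \<open>(x, 0)\<close> is \<open>x\<close> viewed as an element of \<open>L\<close> for even \<open>x\<close>
  and \<open>(0, y)\<close> is \<open>y\<close> viewed as an element of \<open>L\<close> for odd \<open>y\<close>.
\<close>

record ('k, 'a, 'b) super_data =
  escale :: "'k \<Rightarrow> 'a \<Rightarrow> 'a"
  oscale :: "'k \<Rightarrow> 'b \<Rightarrow> 'b"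
  brk :: "'a \<times> 'b \<Rightarrow> 'a \<times> 'b \<Rightarrow> 'a \<times> 'b"
  sqr :: "'b \<Rightarrow> 'a"

definition lscale :: "('k, 'a, 'b) super_data \<Rightarrow> 'k \<Rightarrow> 'a \<times> 'b \<Rightarrow> 'a \<times> 'b" where
  "lscale L c v = (escale L c (fst v), oscale L c (snd v))"

locale lie_superalgebra_char2 =
  fixes L :: "('k :: field, 'a :: ab_group_add, 'b :: ab_group_add) super_data"
  assumes char2: "CHAR('k) = 2"
    and vector_space_even: "vector_space (escale L)"
    and vector_space_odd: "vector_space (oscale L)"
    and brk_add_left: "\<And>u v w. brk L (u + v) w = brk L u w + brk L v w"
    and brk_add_right: "\<And>u v w. brk L u (v + w) = brk L u v + brk L u w"
    and brk_scale_left: "\<And>c u v. brk L (lscale L c u) v = lscale L c (brk L u v)"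
    and brk_scale_right: "\<And>c u v. brk L u (lscale L c v) = lscale L c (brk L u v)"
    and brk_even_even: "\<And>x x'. snd (brk L (x, 0) (x', 0)) = 0"
    and brk_even_odd: "\<And>x y. fst (brk L (x, 0) (0, y)) = 0"
    and brk_odd_even: "\<And>x y. fst (brk L (0, y) (x, 0)) = 0"
    and brk_odd_odd: "\<And>y y'. snd (brk L (0, y) (0, y')) = 0"
    and sqr_scale: "\<And>c y. sqr L (oscale L c y) = escale L (c ^ 2) (sqr L y)"
    and brk_sym: "\<And>u v. brk L u v = brk L v u"
    and jacobi: "\<And>u v w. brk L u (brk L v w) = brk L (brk L u v) w + brk L v (brk L u w)"
    and brk_even_self: "\<And>x. brk L (x, 0) (x, 0) = 0"
    and brk_odd_triple: "\<And>y. brk L (0, y) (brk L (0, y) (0, y)) = 0"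
    and sqr_polar: "\<And>y y'. brk L (0, y) (0, y') = (sqr L (y + y') - sqr L y - sqr L y', 0)"
    and brk_sqr: "\<And>y v. brk L (0, y) (brk L (0, y) v) = brk L (sqr L y, 0) v"

definition finite_dim :: "('k :: field, 'a :: ab_group_add, 'b :: ab_group_add) super_data \<Rightarrow> bool"
  where
  "finite_dim L \<longleftrightarrow>
     (\<exists>B. finite B \<and> module.span (escale L) B = UNIV) \<and>
     (\<exists>B. finite B \<and> module.span (oscale L) B = UNIV)"

section \<open>Free associative algebras\<close>

text \<open>
  Words form a monoid under concatenation, so that the ring structure of
  \<open>'g list \<Rightarrow>\<^sub>0 'k\<close> provided by \<^theory>\<open>HOL-Library.Poly_Mapping\<close> is that of the free associative
  algebra on \<open>'g\<close>. Likewise \<open>('g list \<times> 'g list) \<Rightarrow>\<^sub>0 'k\<close> is the tensor product of that algebra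
  with itself.
\<close>

instantiation list :: (type) monoid_add
begin
definition zero_list :: "'a list" where "zero_list = []"
definition plus_list :: "'a list \<Rightarrow> 'a list \<Rightarrow> 'a list" where "plus_list = (@)"
instance by standard (simp_all add: zero_list_def plus_list_def)
end

abbreviation mon :: "'w \<Rightarrow> 'w \<Rightarrow>\<^sub>0 'k :: comm_ring_1" where
  "mon w \<equiv> Poly_Mapping.single w 1"

abbreviation gen :: "'g \<Rightarrow> 'g list \<Rightarrow>\<^sub>0 'k :: comm_ring_1" where
  "gen g \<equiv> mon [g]"

abbreviation scalar :: "'k :: comm_ring_1 \<Rightarrow> 'w :: monoid_add \<Rightarrow>\<^sub>0 'k" where
  "scalar c \<equiv> Poly_Mapping.single 0 c"

definition free_algebra :: "'g set \<Rightarrow> ('g list \<Rightarrow>\<^sub>0 'k :: comm_ring_1) ring" where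
  "free_algebra X =
     \<lparr>carrier = {P. \<forall>w \<in> Poly_Mapping.keys P. set w \<subseteq> X},
      monoid.mult = (*), one = 1, zero = 0, add = (+)\<rparr>"

text \<open>
  The algebra homomorphism out of the free algebra which sends a generator \<open>g\<close> to \<open>h g\<close>;
  \<open>\<iota>\<close> is the structure map of the target algebra.
\<close>

definition free_hom ::
  "('k \<Rightarrow> 'c) \<Rightarrow> ('g \<Rightarrow> 'c) \<Rightarrow> ('g list \<Rightarrow>\<^sub>0 'k :: comm_ring_1) \<Rightarrow> 'c :: ring_1" where
  "free_hom \<iota> h P =
     (\<Sum>w \<in> Poly_Mapping.keys P. \<iota> (Poly_Mapping.lookup P w) * prod_list (map h w))"

section \<open>The Koszul complex\<close>

text \<open>
  \<open>Y(L)\<close> is the quotient of the free algebra on the generators \<open>u \<in> L\<close> of \<open>U(L)\<close>,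
  \<open>\<langle>x\<rangle>\<close> for even \<open>x\<close>, and \<open>\<gamma>\<^sub>r(y)\<close> for odd \<open>y\<close>,
  by the relations of \<open>U(L)\<close>, those of the exterior algebra, those of the divided power algebra,
  the commutation of the two latter tensor factors, and the smash product rule \<open>z u = u z + z.u\<close>.
\<close>

datatype ('a, 'b) ygen = Env "'a \<times> 'b" | Ang 'a | Gam nat 'b

definition ysusp :: "'a \<times> 'b \<Rightarrow> ('a, 'b) ygen list \<Rightarrow>\<^sub>0 'k :: comm_ring_1" where
  "ysusp v = gen (Ang (fst v)) + gen (Gam 1 (snd v))"

definition env_rels ::
  "('k :: field, 'a :: ab_group_add, 'b :: ab_group_add) super_data \<Rightarrow>
   (('a, 'b) ygen list \<Rightarrow>\<^sub>0 'k) set" where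
  "env_rels L =
     {gen (Env (u + v)) - gen (Env u) - gen (Env v) | u v. True} \<union>
     {gen (Env (lscale L c u)) - scalar c * gen (Env u) | c u. True} \<union>
     {gen (Env u) * gen (Env v) - gen (Env v) * gen (Env u) - gen (Env (brk L u v)) | u v. True} \<union>
     {gen (Env (0, y)) * gen (Env (0, y)) - gen (Env (sqr L y, 0)) | y. True}"

definition ext_rels ::
  "('k :: field, 'a :: ab_group_add, 'b :: ab_group_add) super_data \<Rightarrow>
   (('a, 'b) ygen list \<Rightarrow>\<^sub>0 'k) set" where
  "ext_rels L =
     {gen (Ang (x + x')) - gen (Ang x) - gen (Ang x') | x x'. True} \<union>
     {gen (Ang (escale L c x)) - scalar c * gen (Ang x) | c x. True} \<union>
     {gen (Ang x) * gen (Ang x) | x. True}"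

definition dp_rels ::
  "('k :: field, 'a :: ab_group_add, 'b :: ab_group_add) super_data \<Rightarrow>
   (('a, 'b) ygen list \<Rightarrow>\<^sub>0 'k) set" where
  "dp_rels L =
     {gen (Gam 0 y) - 1 | y. True} \<union>
     {gen (Gam r (oscale L c y)) - scalar (c ^ r) * gen (Gam r y) | r c y. True} \<union>
     {gen (Gam r (y + y')) - (\<Sum>i\<le>r. gen (Gam i y) * gen (Gam (r - i) y')) | r y y'. True} \<union>
     {gen (Gam r y) * gen (Gam s y) - scalar (of_nat ((r + s) choose r)) * gen (Gam (r + s) y)
        | r s y. True} \<union>
     {gen (Gam r y) * gen (Gam s y') - gen (Gam s y') * gen (Gam r y) | r s y y'. True}"

definition smash_rels ::
  "('k :: field, 'a :: ab_group_add, 'b :: ab_group_add) super_data \<Rightarrow>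
   (('a, 'b) ygen list \<Rightarrow>\<^sub>0 'k) set" where
  "smash_rels L =
     {gen (Ang x) * gen (Gam r y) - gen (Gam r y) * gen (Ang x) | x r y. True} \<union>
     {gen (Ang x) * gen (Env u) - gen (Env u) * gen (Ang x) - ysusp (brk L (x, 0) u)
        | x u. True} \<union>
     {gen (Gam (Suc r) y) * gen (Env u) - gen (Env u) * gen (Gam (Suc r) y)
        - gen (Gam r y) * ysusp (brk L (0, y) u) | r y u. True}"

definition koszul_ideal ::
  "('k :: field, 'a :: ab_group_add, 'b :: ab_group_add) super_data \<Rightarrow>
   (('a, 'b) ygen list \<Rightarrow>\<^sub>0 'k) set" where
  "koszul_ideal L =
     genideal (free_algebra UNIV) (env_rels L \<union> ext_rels L \<union> dp_rels L \<union> smash_rels L)"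

text \<open>
  The differential is induced by the derivation of the free algebra with the prescribed values on
  the generators. The Koszul sign \<open>(-1)\<^sup>n\<close> of the Leibniz rule is 1 in characteristic 2.
\<close>

fun d_gen ::
  "('k :: field, 'a :: ab_group_add, 'b :: ab_group_add) super_data \<Rightarrow> ('a, 'b) ygen \<Rightarrow>
   ('a, 'b) ygen list \<Rightarrow>\<^sub>0 'k" where
  "d_gen L (Env u) = 0"
| "d_gen L (Ang x) = gen (Env (x, 0))"
| "d_gen L (Gam 0 y) = 0"
| "d_gen L (Gam (Suc 0) y) = gen (Env (0, y)) * gen (Gam 0 y)"
| "d_gen L (Gam (Suc (Suc r)) y) =
     gen (Env (0, y)) * gen (Gam (Suc r) y) - gen (Ang (sqr L y)) * gen (Gam r y)"

fun d_word ::
  "('k :: field, 'a :: ab_group_add, 'b :: ab_group_add) super_data \<Rightarrow> ('a, 'b) ygen list \<Rightarrow>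
   ('a, 'b) ygen list \<Rightarrow>\<^sub>0 'k" where
  "d_word L [] = 0"
| "d_word L (g # w) = d_gen L g * mon w + gen g * d_word L w"

definition koszul_d ::
  "('k :: field, 'a :: ab_group_add, 'b :: ab_group_add) super_data \<Rightarrow>
   (('a, 'b) ygen list \<Rightarrow>\<^sub>0 'k) \<Rightarrow> (('a, 'b) ygen list \<Rightarrow>\<^sub>0 'k)" where
  "koszul_d L P = (\<Sum>w \<in> Poly_Mapping.keys P. scalar (Poly_Mapping.lookup P w) * d_word L w)"

fun coprod_gen :: "('a, 'b) ygen \<Rightarrow> (('a, 'b) ygen list \<times> ('a, 'b) ygen list) \<Rightarrow>\<^sub>0 'k :: field" where
  "coprod_gen (Env u) = mon ([Env u], []) + mon ([], [Env u])"
| "coprod_gen (Ang x) = mon ([Ang x], []) + mon ([], [Ang x])"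
| "coprod_gen (Gam r y) = (\<Sum>i\<le>r. mon ([Gam i y], [Gam (r - i) y]))"

definition coprod ::
  "(('a, 'b) ygen list \<Rightarrow>\<^sub>0 'k) \<Rightarrow> (('a, 'b) ygen list \<times> ('a, 'b) ygen list) \<Rightarrow>\<^sub>0 'k :: field" where
  "coprod = free_hom scalar coprod_gen"

fun counit_gen :: "('a, 'b) ygen \<Rightarrow> 'k :: field" where
  "counit_gen (Env u) = 0"
| "counit_gen (Ang x) = 0"
| "counit_gen (Gam r y) = (if r = 0 then 1 else 0)"

definition counit :: "(('a, 'b) ygen list \<Rightarrow>\<^sub>0 'k :: field) \<Rightarrow> 'k" where
  "counit = free_hom (\<lambda>c. c) counit_gen"

fun ydeg_gen :: "('a, 'b) ygen \<Rightarrow> nat" where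
  "ydeg_gen (Env u) = 0"
| "ydeg_gen (Ang x) = 1"
| "ydeg_gen (Gam r y) = r"

definition ydeg :: "('a, 'b) ygen list \<Rightarrow> nat" where
  "ydeg w = sum_list (map ydeg_gen w)"

section \<open>Cochains and the cohomology ring\<close>

text \<open>
  A linear form on \<open>Y(L)\<close> is a linear form on the free algebra that vanishes on the ideal of
  relations. The algebra \<open>U(L)\<close> acts on the left of \<open>Y(L)\<close> by multiplication, and its elements are
  represented by the elements \<open>a\<close> of the free algebra that involve only generators in \<open>L\<close>; it acts
  on \<open>k\<close> through the counit.
\<close>

definition cochain ::
  "('k :: field, 'a :: ab_group_add, 'b :: ab_group_add) super_data \<Rightarrow>
   ((('a, 'b) ygen list \<Rightarrow>\<^sub>0 'k) \<Rightarrow> 'k) \<Rightarrow> bool" where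
  "cochain L f \<longleftrightarrow>
     Vector_Spaces.linear (\<lambda>c P. scalar c * P) (*) f \<and>
     (\<forall>P \<in> koszul_ideal L. f P = 0) \<and>
     (\<forall>a \<in> carrier (free_algebra (range Env)). \<forall>P. f (a * P) = counit a * f P)"

definition homogeneous_cochain ::
  "('k :: field, 'a :: ab_group_add, 'b :: ab_group_add) super_data \<Rightarrow> nat \<Rightarrow>
   ((('a, 'b) ygen list \<Rightarrow>\<^sub>0 'k) \<Rightarrow> 'k) \<Rightarrow> bool" where
  "homogeneous_cochain L n f \<longleftrightarrow> cochain L f \<and> (\<forall>w. ydeg w \<noteq> n \<longrightarrow> f (mon w) = 0)"

text \<open>\<open>(f \<otimes> g) \<circ> \<Delta>\<close>\<close>

definition cochain_mult ::
  "((('a, 'b) ygen list \<Rightarrow>\<^sub>0 'k) \<Rightarrow> 'k) \<Rightarrow> ((('a, 'b) ygen list \<Rightarrow>\<^sub>0 'k) \<Rightarrow> 'k) \<Rightarrow>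
   (('a, 'b) ygen list \<Rightarrow>\<^sub>0 'k :: field) \<Rightarrow> 'k" where
  "cochain_mult f g P =
     (\<Sum>t \<in> Poly_Mapping.keys (coprod P).
        Poly_Mapping.lookup (coprod P) t * (f (mon (fst t)) * g (mon (snd t))))"

text \<open>
  The complex of cochains is the direct sum, not the direct product, of its homogeneous
  components; hence the bound on the degrees.
\<close>

definition cochain_ring ::
  "('k :: field, 'a :: ab_group_add, 'b :: ab_group_add) super_data \<Rightarrow>
   ((('a, 'b) ygen list \<Rightarrow>\<^sub>0 'k) \<Rightarrow> 'k) ring" where
  "cochain_ring L =
     \<lparr>carrier = {f. cochain L f \<and> (\<exists>n. \<forall>w. n < ydeg w \<longrightarrow> f (mon w) = 0)},
      monoid.mult = cochain_mult, one = counit, zero = (\<lambda>P. 0), add = (\<lambda>f g P. f P + g P)\<rparr>"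

definition cocycle_ring ::
  "('k :: field, 'a :: ab_group_add, 'b :: ab_group_add) super_data \<Rightarrow>
   ((('a, 'b) ygen list \<Rightarrow>\<^sub>0 'k) \<Rightarrow> 'k) ring" where
  "cocycle_ring L =
     (cochain_ring L)\<lparr>carrier := {f \<in> carrier (cochain_ring L). f \<circ> koszul_d L = (\<lambda>P. 0)}\<rparr>"

definition coboundaries ::
  "('k :: field, 'a :: ab_group_add, 'b :: ab_group_add) super_data \<Rightarrow>
   ((('a, 'b) ygen list \<Rightarrow>\<^sub>0 'k) \<Rightarrow> 'k) set" where
  "coboundaries L = (\<lambda>f. f \<circ> koszul_d L) ` carrier (cochain_ring L)"

definition cohomology_ring ::
  "('k :: field, 'a :: ab_group_add, 'b :: ab_group_add) super_data \<Rightarrow>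
   ((('a, 'b) ygen list \<Rightarrow>\<^sub>0 'k) \<Rightarrow> 'k) set ring" where
  "cohomology_ring L = cocycle_ring L Quot coboundaries L"

text \<open>
  The annihilator of the trivial module: \<open>Ext(k, k)\<close> is the cohomology ring itself,
  on which the ring acts by its multiplication.
\<close>

definition trivial_annihilator ::
  "('k :: field, 'a :: ab_group_add, 'b :: ab_group_add) super_data \<Rightarrow>
   ((('a, 'b) ygen list \<Rightarrow>\<^sub>0 'k) \<Rightarrow> 'k) set set" where
  "trivial_annihilator L =
     {h \<in> carrier (cohomology_ring L).
        \<forall>e \<in> carrier (cohomology_ring L).
          h \<otimes>\<^bsub>cohomology_ring L\<^esub> e = \<zero>\<^bsub>cohomology_ring L\<^esub>}"

section \<open>The symmetric algebra of the dual of the odd part\<close>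

definition odd_dual ::
  "('k :: field, 'a :: ab_group_add, 'b :: ab_group_add) super_data \<Rightarrow> ('b \<Rightarrow> 'k) set" where
  "odd_dual L = {\<mu>. Vector_Spaces.linear (oscale L) (*) \<mu>}"

definition sym_rels ::
  "('k :: field, 'a :: ab_group_add, 'b :: ab_group_add) super_data \<Rightarrow>
   (('b \<Rightarrow> 'k) list \<Rightarrow>\<^sub>0 'k) set" where
  "sym_rels L =
     {gen (\<lambda>y. \<mu> y + \<nu> y) - gen \<mu> - gen \<nu> | \<mu> \<nu>. \<mu> \<in> odd_dual L \<and> \<nu> \<in> odd_dual L} \<union>
     {gen (\<lambda>y. c * \<mu> y) - scalar c * gen \<mu> | c \<mu>. \<mu> \<in> odd_dual L} \<union>
     {gen \<mu> * gen \<nu> - gen \<nu> * gen \<mu> | \<mu> \<nu>. \<mu> \<in> odd_dual L \<and> \<nu> \<in> odd_dual L}"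

definition sym_odd_dual ::
  "('k :: field, 'a :: ab_group_add, 'b :: ab_group_add) super_data \<Rightarrow>
   (('b \<Rightarrow> 'k) list \<Rightarrow>\<^sub>0 'k) set ring" where
  "sym_odd_dual L =
     free_algebra (odd_dual L) Quot genideal (free_algebra (odd_dual L)) (sym_rels L)"

text \<open>
  Elements of the symmetric algebra are cosets; the following maps are those induced on cosets by
  maps defined on representatives.
\<close>

definition sym_eval :: "(('b \<Rightarrow> 'k) list \<Rightarrow>\<^sub>0 'k :: field) set \<Rightarrow> 'b \<Rightarrow> 'k" where
  "sym_eval X y = the_elem (free_hom (\<lambda>c. c) (\<lambda>\<mu>. \<mu> y) ` X)"

text \<open>
  The identification of the dual of the odd part with a space of cochains of degree 1.
  A homogeneous cochain of degree 1 is determined by its values on \<open>Y\<^sub>1(L) = U(L) \<otimes> L\<close>.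
\<close>

definition odd_cochain ::
  "('k :: field, 'a :: ab_group_add, 'b :: ab_group_add) super_data \<Rightarrow> ('b \<Rightarrow> 'k) \<Rightarrow>
   (('a, 'b) ygen list \<Rightarrow>\<^sub>0 'k) \<Rightarrow> 'k" where
  "odd_cochain L \<mu> = (THE f. homogeneous_cochain L 1 f \<and> (\<forall>v. f (ysusp v) = \<mu> (snd v)))"

text \<open>
  The embedding of the symmetric algebra into the cochain algebra is the algebra homomorphism which
  extends \<open>odd_cochain\<close>.
\<close>

definition free_to_cochain ::
  "('k :: field, 'a :: ab_group_add, 'b :: ab_group_add) super_data \<Rightarrow>
   (('b \<Rightarrow> 'k) list \<Rightarrow>\<^sub>0 'k) \<Rightarrow> (('a, 'b) ygen list \<Rightarrow>\<^sub>0 'k) \<Rightarrow> 'k" where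
  "free_to_cochain L P Z =
     (\<Sum>w \<in> Poly_Mapping.keys P.
        Poly_Mapping.lookup P w * foldr cochain_mult (map (odd_cochain L) w) counit Z)"

definition sym_to_cochain ::
  "('k :: field, 'a :: ab_group_add, 'b :: ab_group_add) super_data \<Rightarrow>
   (('b \<Rightarrow> 'k) list \<Rightarrow>\<^sub>0 'k) set \<Rightarrow> (('a, 'b) ygen list \<Rightarrow>\<^sub>0 'k) \<Rightarrow> 'k" where
  "sym_to_cochain L X = the_elem (free_to_cochain L ` X)"

section \<open>Support varieties\<close>

text \<open>
  \<open>phi L f\<close> is \<open>\<phi>(1 \<otimes> f)\<close>, the class of the cocycle \<open>f\<^sup>2\<close>.
\<close>

definition phi ::
  "('k :: field, 'a :: ab_group_add, 'b :: ab_group_add) super_data \<Rightarrow>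
   (('b \<Rightarrow> 'k) list \<Rightarrow>\<^sub>0 'k) set \<Rightarrow> ((('a, 'b) ygen list \<Rightarrow>\<^sub>0 'k) \<Rightarrow> 'k) set" where
  "phi L f =
     coboundaries L +>\<^bsub>cocycle_ring L\<^esub>
       (sym_to_cochain L f \<otimes>\<^bsub>cocycle_ring L\<^esub> sym_to_cochain L f)"

text \<open>
  The untwisted support variety of the trivial module, \<open>\<X>\<^sub>L(k)\<close> with the Frobenius twist removed.
\<close>

definition support_variety_trivial ::
  "('k :: field, 'a :: ab_group_add, 'b :: ab_group_add) super_data \<Rightarrow> 'b set" where
  "support_variety_trivial L =
     {y. \<forall>f \<in> carrier (sym_odd_dual L). phi L f \<in> trivial_annihilator L \<longrightarrow> sym_eval f y = 0}"

definition N_odd ::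
  "('k :: field, 'a :: ab_group_add, 'b :: ab_group_add) super_data \<Rightarrow> 'b set" where
  "N_odd L = {y. sqr L y = 0}"

end

theory Submission
  imports Defs
begin

text \<open>
  The cohomology ring has a unit, so a class annihilates it only if it is zero. The claim is
  therefore that an odd element \<open>y\<close> satisfies \<open>q(y) = 0\<close> exactly when every polynomial \<open>f\<close> on the odd
  part whose square \<open>f\<^sup>2\<close> is a coboundary vanishes at \<open>y\<close>.

  A linear form on \<open>Y(L)\<close> is treated as a function on words in the generators. The product of two
  such functions is the convolution \<open>conv\<close> along the coproduct, and the differential of \<open>Y(L)\<close>
  becomes a derivation \<open>codiff\<close> of it; both facts hold already on the free algebra, before any
  relation is imposed (\<open>conv_comm\<close>, \<open>conv_assoc\<close>, \<open>codiff_conv\<close>). Characteristic 2 enters in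
  two ways. It makes the functions that vanish on the relations stable under both operations
  (\<open>annihilates_conv\<close>, \<open>annihilates_codiff\<close>), with \<open>codiff\<close> of square zero on them
  (\<open>codiff_codiff\<close>). And it makes squares very degenerate: the coproduct is cocommutative, so the
  terms of \<open>f * f\<close> cancel in pairs, except for those that are fixed by the swap. What is left only
  sees the values of \<open>f\<close> on words in the divided powers (\<open>conv_square_cong\<close>), and
  \<open>f\<^sup>2(\<gamma>\<^sub>2\<^sub>n(y)) = f(\<gamma>\<^sub>n(y))\<^sup>2\<close> (\<open>conv_square_Gam\<close>).

  If \<open>q(y) = 0\<close>, then \<open>d \<gamma>\<^sub>r(y) = y \<gamma>\<^sub>r\<^sub>-\<^sub>1(y)\<close>, on which every cochain vanishes, so coboundaries vanish
  at \<open>\<gamma>\<^sub>r(y)\<close>. For a polynomial \<open>f\<close> whose square is a coboundary this gives \<open>f(\<gamma>\<^sub>n(y)) = 0\<close> for all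
  \<open>n\<close>. These are the values at \<open>y\<close> of the homogeneous components of \<open>f\<close>, hence \<open>f(y) = 0\<close>
  (\<open>N_odd_subset\<close>).

  Conversely, let \<open>\<xi>\<close> be a linear form on the even part, seen as a cochain of degree 1. Its coboundary
  \<open>d\<xi>\<close> is the quadratic form \<open>\<xi> \<circ> q\<close> on the odd part plus an element of the second exterior power of
  the dual of the even part. The second summand has square zero, as \<open>d\<xi>\<close> and \<open>\<xi> \<circ> q\<close> agree on words
  in the divided powers. Hence \<open>(\<xi> \<circ> q)\<^sup>2 = (d\<xi>)\<^sup>2 = d(\<xi> d\<xi>)\<close> is a coboundary, and \<open>\<xi>(q(y)) = 0\<close> for every
  \<open>y\<close> in the support variety. Linear forms separate points, so \<open>q(y) = 0\<close> (\<open>support_subset\<close>).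
\<close>

section \<open>Linear forms on monoid algebras\<close>

definition lin_ext :: "('w \<Rightarrow> 'k) \<Rightarrow> ('w \<Rightarrow>\<^sub>0 'k) \<Rightarrow> 'k :: comm_ring_1" where
  "lin_ext \<phi> P = (\<Sum>w\<in>Poly_Mapping.keys P. Poly_Mapping.lookup P w * \<phi> w)"

lemma lin_ext_superset:
  assumes "finite S" "Poly_Mapping.keys P \<subseteq> S"
  shows "lin_ext \<phi> P = (\<Sum>w\<in>S. Poly_Mapping.lookup P w * \<phi> w)"
  unfolding lin_ext_def using assms by (intro sum.mono_neutral_left) (auto simp: in_keys_iff)

lemma lin_ext_zero [simp]: "lin_ext \<phi> 0 = 0"
  by (simp add: lin_ext_def)

lemma lin_ext_add [simp]: "lin_ext \<phi> (P + Q) = lin_ext \<phi> P + lin_ext \<phi> Q"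
proof -
  let ?S = "Poly_Mapping.keys P \<union> Poly_Mapping.keys Q"
  have "lin_ext \<phi> (P + Q) = (\<Sum>w\<in>?S. Poly_Mapping.lookup (P + Q) w * \<phi> w)"
    by (rule lin_ext_superset) (auto dest: keys_add[THEN subsetD])
  then show ?thesis
    by (simp add: lin_ext_superset[of ?S P] lin_ext_superset[of ?S Q] lookup_add algebra_simps sum.distrib)
qed

lemma lin_ext_uminus [simp]: "lin_ext \<phi> (- P) = - lin_ext \<phi> P"
  using lin_ext_add[of \<phi> P "- P"] by (simp add: eq_neg_iff_add_eq_0 add.commute del: lin_ext_add)

lemma lin_ext_diff [simp]: "lin_ext \<phi> (P - Q) = lin_ext \<phi> P - lin_ext \<phi> Q"
  using lin_ext_add[of \<phi> P "- Q"] by simp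

lemma lin_ext_sum [simp]: "lin_ext \<phi> (\<Sum>i\<in>A. P i) = (\<Sum>i\<in>A. lin_ext \<phi> (P i))"
  by (induction A rule: infinite_finite_induct) simp_all

lemma lin_ext_single [simp]: "lin_ext \<phi> (Poly_Mapping.single w c) = c * \<phi> w"
  by (subst lin_ext_superset[of "{w}"]) (auto split: if_splits)

lemma lin_ext_one [simp]: "lin_ext \<phi> 1 = \<phi> 0"
  by (simp flip: single_one)

lemma poly_mapping_sum_single:
  "P = (\<Sum>w\<in>Poly_Mapping.keys P. Poly_Mapping.single w (Poly_Mapping.lookup P w))"
  by (rule poly_mapping_eqI)
    (auto simp: lookup_sum lookup_single when_def in_keys_iff if_distrib cong: if_cong)

lemma lin_ext_single_mult [simp]:
  "lin_ext \<phi> (Poly_Mapping.single a c * P) = c * lin_ext (\<lambda>w. \<phi> (a + w)) P"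
proof -
  have "lin_ext \<phi> (Poly_Mapping.single a c * P) = lin_ext \<phi> (\<Sum>w\<in>Poly_Mapping.keys P.
      Poly_Mapping.single a c * Poly_Mapping.single w (Poly_Mapping.lookup P w))"
    by (subst (1) poly_mapping_sum_single[of P]) (simp only: sum_distrib_left)
  then show ?thesis by (simp add: mult_single lin_ext_def[of _ P] sum_distrib_left mult.assoc)
qed

lemma lin_ext_mult_single [simp]:
  "lin_ext \<phi> (P * Poly_Mapping.single a c) = c * lin_ext (\<lambda>w. \<phi> (w + a)) P"
proof -
  have "lin_ext \<phi> (P * Poly_Mapping.single a c) = lin_ext \<phi> (\<Sum>w\<in>Poly_Mapping.keys P.
      Poly_Mapping.single w (Poly_Mapping.lookup P w) * Poly_Mapping.single a c)"
    by (subst (1) poly_mapping_sum_single[of P]) (simp only: sum_distrib_right)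
  then show ?thesis by (simp add: mult_single lin_ext_def[of _ P] sum_distrib_left mult_ac)
qed

lemma lin_ext_mult: "lin_ext \<phi> (P * Q) =
  (\<Sum>w\<in>Poly_Mapping.keys P. Poly_Mapping.lookup P w * lin_ext (\<lambda>v. \<phi> (w + v)) Q)"
proof -
  have "lin_ext \<phi> (P * Q) = lin_ext \<phi> (\<Sum>w\<in>Poly_Mapping.keys P.
      Poly_Mapping.single w (Poly_Mapping.lookup P w) * Q)"
    by (subst (1) poly_mapping_sum_single[of P]) (simp only: sum_distrib_right)
  then show ?thesis by simp
qed

lemma lin_ext_add_fun: "lin_ext (\<lambda>w. \<phi> w + \<psi> w) P = lin_ext \<phi> P + lin_ext \<psi> P"
  by (simp add: lin_ext_def algebra_simps sum.distrib)

lemma lin_ext_zero_fun [simp]: "lin_ext (\<lambda>w. 0) P = 0"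
  by (simp add: lin_ext_def)

lemma lin_ext_mon [simp]: "(\<lambda>w. lin_ext \<phi> (mon w)) = \<phi>"
  by simp

lemma vector_space_free_algebra:
  "vector_space (\<lambda>(c :: 'k :: field) (P :: 'g list \<Rightarrow>\<^sub>0 'k). scalar c * P)"
  by unfold_locales (simp_all add: algebra_simps mult_single single_add flip: mult.assoc)

text \<open>
  The monomials are a basis of the free algebra. This is what allows the linear forms of the
  cochain complex to be replaced by functions on words.
\<close>

lemma linear_iff_lin_ext:
  fixes f :: "('g list \<Rightarrow>\<^sub>0 'k :: field) \<Rightarrow> 'k"
  shows "Vector_Spaces.linear (\<lambda>c P. scalar c * P) (*) f \<longleftrightarrow> f = lin_ext (\<lambda>w. f (mon w))"
proof
  assume "Vector_Spaces.linear (\<lambda>c P. scalar c * P) (*) f"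
  then interpret Vector_Spaces.linear "\<lambda>c P. scalar c * P" "(*)" f .
  show "f = lin_ext (\<lambda>w. f (mon w))"
  proof
    fix P
    have "f P = f (\<Sum>w\<in>Poly_Mapping.keys P. scalar (Poly_Mapping.lookup P w) * mon w)"
      by (subst (1) poly_mapping_sum_single[of P]) (simp add: mult_single)
    then show "f P = lin_ext (\<lambda>w. f (mon w)) P" by (simp add: sum scale lin_ext_def)
  qed
next
  assume f: "f = lin_ext (\<lambda>w. f (mon w))"
  interpret vs1: vector_space "\<lambda>(c :: 'k) (P :: 'g list \<Rightarrow>\<^sub>0 'k). scalar c * P"
    by (rule vector_space_free_algebra)
  interpret vs2: vector_space "(*) :: 'k \<Rightarrow> 'k \<Rightarrow> 'k"
    by unfold_locales (simp_all add: algebra_simps)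
  show "Vector_Spaces.linear (\<lambda>c P. scalar c * P) (*) f"
    unfolding Vector_Spaces.linear_iff
    by (subst (1 2 3 4 5) f) (simp add: vs1.vector_space_axioms vs2.vector_space_axioms)
qed

section \<open>Ideals of the free algebra\<close>

lemma free_algebra_simps [simp]:
  "carrier (free_algebra X) = {P. \<forall>w\<in>Poly_Mapping.keys P. set w \<subseteq> X}"
  "mult (free_algebra X) = (*)" "one (free_algebra X) = 1"
  "zero (free_algebra X) = 0" "add (free_algebra X) = (+)"
  by (simp_all add: free_algebra_def)

lemma mon_in_free_algebra [simp]:
  "set w \<subseteq> X \<Longrightarrow> Poly_Mapping.single w c \<in> carrier (free_algebra X)"
  by simp

lemma mult_in_free_algebra:
  assumes "P \<in> carrier (free_algebra X)" "Q \<in> carrier (free_algebra X)"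
  shows "P * Q \<in> carrier (free_algebra X)"
  using assms keys_mult[of P Q] by (fastforce simp: plus_list_def)

lemma add_in_free_algebra:
  assumes "P \<in> carrier (free_algebra X)" "Q \<in> carrier (free_algebra X)"
  shows "P + Q \<in> carrier (free_algebra X)"
  using assms keys_add[of P Q] by auto

lemma one_in_free_algebra: "1 \<in> carrier (free_algebra X)"
  using mon_in_free_algebra[of "[]" X 1] by (simp add: zero_list_def flip: single_one)

lemma ring_free_algebra: "ring (free_algebra X)"
proof (rule ringI)
  show "abelian_group (free_algebra X)"
  proof (rule abelian_groupI)
    fix P assume "P \<in> carrier (free_algebra X)"
    then show "\<exists>Q\<in>carrier (free_algebra X). Q \<oplus>\<^bsub>free_algebra X\<^esub> P = \<zero>\<^bsub>free_algebra X\<^esub>"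
      by (intro bexI[of _ "- P"]) auto
  qed (auto simp: add_ac dest: keys_add[THEN subsetD])
  show "Group.monoid (free_algebra X)"
    by (rule monoidI) (simp_all only: free_algebra_simps(2,3) mult_in_free_algebra
        one_in_free_algebra mult.assoc mult_1_left mult_1_right)
qed (auto simp: algebra_simps)

text \<open>
  The generated ideal is spanned by the products of a relation with a word on either side. The
  forms that vanish on all these products vanish on an ideal, which gives the harder direction.
\<close>

lemma lin_ext_genideal_iff:
  fixes \<phi> :: "'g list \<Rightarrow> 'k :: comm_ring_1"
  assumes R: "R \<subseteq> carrier (free_algebra X)"
  shows "(\<forall>P\<in>genideal (free_algebra X) R. lin_ext \<phi> P = 0) \<longleftrightarrow>
    (\<forall>r\<in>R. \<forall>a b. set a \<subseteq> X \<longrightarrow> set b \<subseteq> X \<longrightarrow> lin_ext (\<lambda>w. \<phi> (a @ w @ b)) r = 0)"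
    (is "?lhs \<longleftrightarrow> ?rhs")
proof
  interpret ring "free_algebra X :: ('g list \<Rightarrow>\<^sub>0 'k) ring" by (rule ring_free_algebra)
  interpret I: ideal "genideal (free_algebra X) R" "free_algebra X" by (rule genideal_ideal[OF R])
  assume lhs: ?lhs
  show ?rhs
  proof (intro ballI allI impI)
    fix r a b assume "r \<in> R" "set a \<subseteq> X" "set b \<subseteq> X"
    then have "mon a * r * mon b \<in> genideal (free_algebra X) R"
      using I.I_l_closed[of r "mon a"] I.I_r_closed[of "mon a * r" "mon b"] genideal_self[OF R] by auto
    then have "lin_ext \<phi> (mon a * r * mon b) = 0" using lhs by blast
    then show "lin_ext (\<lambda>w. \<phi> (a @ w @ b)) r = 0"
      by (simp add: mult.assoc) (simp add: plus_list_def)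
  qed
next
  interpret ring "free_algebra X :: ('g list \<Rightarrow>\<^sub>0 'k) ring" by (rule ring_free_algebra)
  assume rhs: ?rhs
  define K where "K = {P \<in> carrier (free_algebra X).
    \<forall>a b. set a \<subseteq> X \<longrightarrow> set b \<subseteq> X \<longrightarrow> lin_ext (\<lambda>w. \<phi> (a @ w @ b)) P = 0}"
  have "ideal K (free_algebra X)"
  proof (rule idealI)
    show "ring (free_algebra X)" by (rule ring_free_algebra)
    show "subgroup K (add_monoid (free_algebra X))"
    proof (rule add.subgroupI)
      show "K \<subseteq> carrier (free_algebra X)" by (auto simp: K_def)
      show "K \<noteq> {}" by (auto simp: K_def intro: exI[of _ 0])
      fix P assume P: "P \<in> K"
      then have "\<ominus>\<^bsub>free_algebra X\<^esub> P = - P"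
        by (intro minus_equality) (auto simp: K_def)
      then show "\<ominus>\<^bsub>free_algebra X\<^esub> P \<in> K" using P by (simp add: K_def)
      fix Q assume Q: "Q \<in> K"
      then show "P \<oplus>\<^bsub>free_algebra X\<^esub> Q \<in> K"
        using P add_in_free_algebra[of P X Q] by (simp add: K_def)
    qed
  next
    fix P Q :: "'g list \<Rightarrow>\<^sub>0 'k" assume P: "P \<in> K" and Q: "Q \<in> carrier (free_algebra X)"
    have P0: "lin_ext (\<lambda>w. \<phi> (a @ w @ b)) P = 0" if "set a \<subseteq> X" "set b \<subseteq> X" for a b
      using P that by (simp add: K_def)
    have QX: "set w \<subseteq> X" if "w \<in> Poly_Mapping.keys Q" for w using Q that by simp
    have PX: "P \<in> carrier (free_algebra X)" using P by (simp add: K_def)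
    have "lin_ext (\<lambda>w. \<phi> (a @ w @ b)) (Q * P) = 0" if "set a \<subseteq> X" "set b \<subseteq> X" for a b
    proof -
      have "lin_ext (\<lambda>v. \<phi> ((a @ w) @ v @ b)) P = 0" if "w \<in> Poly_Mapping.keys Q" for w
        by (rule P0) (use QX[OF that] \<open>set a \<subseteq> X\<close> \<open>set b \<subseteq> X\<close> in auto)
      then show ?thesis by (simp add: lin_ext_mult plus_list_def)
    qed
    then show "Q \<otimes>\<^bsub>free_algebra X\<^esub> P \<in> K"
      using mult_in_free_algebra[OF Q PX] by (simp add: K_def)
    have "lin_ext (\<lambda>w. \<phi> (a @ w @ b)) (P * Q) = 0" if "set a \<subseteq> X" "set b \<subseteq> X" for a b
    proof -
      have "lin_ext (\<lambda>v. \<phi> (a @ v @ (w @ b))) P = 0" if "w \<in> Poly_Mapping.keys Q" for w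
        by (rule P0) (use QX[OF that] \<open>set a \<subseteq> X\<close> \<open>set b \<subseteq> X\<close> in auto)
      moreover have "lin_ext (\<lambda>w. \<phi> (a @ w @ b)) (P * Q) = (\<Sum>w\<in>Poly_Mapping.keys Q.
        Poly_Mapping.lookup Q w * lin_ext (\<lambda>v. \<phi> (a @ v @ (w @ b))) P)"
        by (subst (1) poly_mapping_sum_single[of Q])
          (simp add: sum_distrib_left[of P] plus_list_def)
      ultimately show ?thesis by simp
    qed
    then show "P \<otimes>\<^bsub>free_algebra X\<^esub> Q \<in> K"
      using mult_in_free_algebra[OF PX Q] by (simp add: K_def)
  qed
  moreover have "R \<subseteq> K" using R rhs by (auto simp: K_def)
  ultimately have "genideal (free_algebra X) R \<subseteq> K" by (rule genideal_minimal)
  moreover have "lin_ext \<phi> P = 0" if "P \<in> K" for P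
    using that by (auto simp: K_def dest!: spec[of _ "[]"])
  ultimately show ?lhs by blast
qed

section \<open>The convolution product\<close>

text \<open>
  The form \<open>(\<phi> \<otimes> \<psi>) \<circ> \<Delta>\<close>, with the coproduct of a word expanded letter by letter: each summand
  of the coproduct of the first letter hands one factor to \<open>\<phi>\<close> and the other to \<open>\<psi>\<close>.
\<close>

fun conv :: "(('a, 'b) ygen list \<Rightarrow> 'k) \<Rightarrow> (('a, 'b) ygen list \<Rightarrow> 'k) \<Rightarrow>
    ('a, 'b) ygen list \<Rightarrow> 'k :: field" where
  "conv \<phi> \<psi> [] = \<phi> [] * \<psi> []"
| "conv \<phi> \<psi> (Env u # w) =
     conv (\<lambda>v. \<phi> (Env u # v)) \<psi> w + conv \<phi> (\<lambda>v. \<psi> (Env u # v)) w"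
| "conv \<phi> \<psi> (Ang x # w) =
     conv (\<lambda>v. \<phi> (Ang x # v)) \<psi> w + conv \<phi> (\<lambda>v. \<psi> (Ang x # v)) w"
| "conv \<phi> \<psi> (Gam r y # w) =
     (\<Sum>i\<le>r. conv (\<lambda>v. \<phi> (Gam i y # v)) (\<lambda>v. \<psi> (Gam (r - i) y # v)) w)"

lemma conv_comm: "conv \<phi> \<psi> w = conv \<psi> \<phi> w"
proof (induction w arbitrary: \<phi> \<psi>)
  case (Cons g w)
  show ?case
  proof (cases g)
    case (Gam r y)
    have "(\<Sum>i\<le>r. conv (\<lambda>v. \<phi> (Gam i y # v)) (\<lambda>v. \<psi> (Gam (r - i) y # v)) w) =
      (\<Sum>i\<le>r. conv (\<lambda>v. \<phi> (Gam (r - i) y # v)) (\<lambda>v. \<psi> (Gam (r - (r - i)) y # v)) w)"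
      by (rule sum.reindex_bij_witness[where i = "\<lambda>i. r - i" and j = "\<lambda>i. r - i"]) auto
    also have "\<dots> = (\<Sum>i\<le>r. conv (\<lambda>v. \<psi> (Gam i y # v)) (\<lambda>v. \<phi> (Gam (r - i) y # v)) w)"
      by (rule sum.cong) (auto simp: Cons.IH)
    finally show ?thesis using Gam by simp
  qed (use Cons.IH in \<open>simp_all add: add.commute\<close>)
qed simp

lemma conv_add_left: "conv (\<lambda>v. \<phi> v + \<phi>' v) \<psi> w = conv \<phi> \<psi> w + conv \<phi>' \<psi> w"
proof (induction w arbitrary: \<phi> \<phi>' \<psi>)
  case (Cons g w)
  then show ?case by (cases g) (simp_all add: algebra_simps sum.distrib)
qed (simp add: algebra_simps)

lemma conv_scale_left: "conv (\<lambda>v. c * \<phi> v) \<psi> w = c * conv \<phi> \<psi> w"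
proof (induction w arbitrary: \<phi> \<psi>)
  case (Cons g w)
  then show ?case by (cases g) (simp_all add: algebra_simps sum_distrib_left)
qed (simp add: algebra_simps)

lemma conv_zero_left [simp]: "conv (\<lambda>v. 0) \<psi> w = 0"
  using conv_scale_left[of 0 "\<lambda>v. 0"] by simp

lemma conv_diff_left: "conv (\<lambda>v. \<phi> v - \<phi>' v) \<psi> w = conv \<phi> \<psi> w - conv \<phi>' \<psi> w"
  using conv_add_left[of \<phi> "\<lambda>v. - \<phi>' v"] conv_scale_left[of "-1" \<phi>'] by simp

lemma conv_sum_left: "conv (\<lambda>v. \<Sum>i\<in>A. \<phi> i v) \<psi> w = (\<Sum>i\<in>A. conv (\<phi> i) \<psi> w)"
  by (induction A rule: infinite_finite_induct) (simp_all add: conv_add_left)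

lemma conv_add_right: "conv \<psi> (\<lambda>v. \<phi> v + \<phi>' v) w = conv \<psi> \<phi> w + conv \<psi> \<phi>' w"
  by (simp add: conv_comm[of \<psi>] conv_add_left)

lemma conv_diff_right: "conv \<psi> (\<lambda>v. \<phi> v - \<phi>' v) w = conv \<psi> \<phi> w - conv \<psi> \<phi>' w"
  by (simp add: conv_comm[of \<psi>] conv_diff_left)

lemma conv_scale_right: "conv \<psi> (\<lambda>v. c * \<phi> v) w = c * conv \<psi> \<phi> w"
  by (simp add: conv_comm[of \<psi>] conv_scale_left)

lemma conv_zero_right [simp]: "conv \<psi> (\<lambda>v. 0) w = 0"
  by (simp add: conv_comm[of \<psi>])

lemma conv_sum_right: "conv \<psi> (\<lambda>v. \<Sum>i\<in>A. \<phi> i v) w = (\<Sum>i\<in>A. conv \<psi> (\<phi> i) w)"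
  by (simp add: conv_comm[of \<psi>] conv_sum_left)

lemmas conv_bilinear =
  conv_add_left conv_add_right conv_diff_left conv_diff_right conv_scale_left conv_scale_right
  conv_sum_left conv_sum_right

lemma sum_triangle_assoc:
  fixes F :: "nat \<Rightarrow> nat \<Rightarrow> nat \<Rightarrow> 'c :: comm_monoid_add"
  shows "(\<Sum>i\<le>r. \<Sum>j\<le>i. F j (i - j) (r - i)) = (\<Sum>i\<le>r. \<Sum>j\<le>r - i. F i j (r - i - j))"
  by (simp add: sum.Sigma, rule sum.reindex_bij_witness
      [where i = "\<lambda>(i, j). (i + j, i)" and j = "\<lambda>(i, j). (j, i - j)"]) (auto simp: algebra_simps)

lemma conv_assoc: "conv (conv \<phi> \<psi>) \<chi> w = conv \<phi> (conv \<psi> \<chi>) w"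
proof (induction w arbitrary: \<phi> \<psi> \<chi>)
  case (Cons g w)
  show ?case
  proof (cases g)
    case (Gam r y)
    let ?F = "\<lambda>i j l. conv (conv (\<lambda>v. \<phi> (Gam i y # v)) (\<lambda>v. \<psi> (Gam j y # v)))
      (\<lambda>v. \<chi> (Gam l y # v)) w"
    have "conv (conv \<phi> \<psi>) \<chi> (g # w) = (\<Sum>i\<le>r. \<Sum>j\<le>i. ?F j (i - j) (r - i))"
      by (simp add: Gam conv_sum_left)
    also have "\<dots> = (\<Sum>i\<le>r. \<Sum>j\<le>r - i. ?F i j (r - i - j))"
      by (rule sum_triangle_assoc)
    also have "\<dots> = conv \<phi> (conv \<psi> \<chi>) (g # w)"
      by (simp add: Gam conv_sum_right Cons.IH)
    finally show ?thesis .
  qed (simp_all add: conv_add_left conv_add_right Cons.IH algebra_simps)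
qed (simp add: algebra_simps)

lemma conv_left_commute: "conv \<phi> (conv \<psi> \<chi>) = conv \<psi> (conv \<phi> \<chi>)"
proof -
  have "conv \<phi> \<psi> = conv \<psi> \<phi>" by (rule ext, rule conv_comm)
  then show ?thesis by (intro ext) (metis conv_assoc)
qed

text \<open>
  The coproduct preserves the degree; this bounds the degree of a product.
\<close>

lemma conv_nonzeroD:
  "conv \<phi> \<psi> w \<noteq> 0 \<Longrightarrow> \<exists>a b. \<phi> a \<noteq> 0 \<and> \<psi> b \<noteq> 0 \<and> ydeg w = ydeg a + ydeg b"
proof (induction w arbitrary: \<phi> \<psi>)
  case Nil
  then show ?case by (intro exI[of _ "[]"]) (auto simp: ydeg_def)
next
  case (Cons g w)
  have glue: "\<exists>a b. \<phi> a \<noteq> 0 \<and> \<psi> b \<noteq> 0 \<and> ydeg (g # w) = ydeg a + ydeg b"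
    if "conv (\<lambda>v. \<phi> (p @ v)) (\<lambda>v. \<psi> (q @ v)) w \<noteq> 0" "ydeg p + ydeg q = ydeg_gen g" for p q
  proof -
    from Cons.IH[OF that(1)] obtain a b
      where "\<phi> (p @ a) \<noteq> 0" "\<psi> (q @ b) \<noteq> 0" "ydeg w = ydeg a + ydeg b" by blast
    with that(2) show ?thesis
      by (intro exI[of _ "p @ a"] exI[of _ "q @ b"]) (auto simp: ydeg_def)
  qed
  show ?case
  proof (cases g)
    case (Env u)
    with Cons.prems have "conv (\<lambda>v. \<phi> ([g] @ v)) (\<lambda>v. \<psi> ([] @ v)) w \<noteq> 0 \<or>
      conv (\<lambda>v. \<phi> ([] @ v)) (\<lambda>v. \<psi> ([g] @ v)) w \<noteq> 0" by auto
    then show ?thesis using glue[of "[g]" "[]"] glue[of "[]" "[g]"] by (auto simp: ydeg_def)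
  next
    case (Ang x)
    with Cons.prems have "conv (\<lambda>v. \<phi> ([g] @ v)) (\<lambda>v. \<psi> ([] @ v)) w \<noteq> 0 \<or>
      conv (\<lambda>v. \<phi> ([] @ v)) (\<lambda>v. \<psi> ([g] @ v)) w \<noteq> 0" by auto
    then show ?thesis using glue[of "[g]" "[]"] glue[of "[]" "[g]"] by (auto simp: ydeg_def)
  next
    case (Gam r y)
    with Cons.prems obtain i where "i \<le> r"
      "conv (\<lambda>v. \<phi> ([Gam i y] @ v)) (\<lambda>v. \<psi> ([Gam (r - i) y] @ v)) w \<noteq> 0"
      by (auto elim: sum.not_neutral_contains_not_neutral)
    then show ?thesis using glue[of "[Gam i y]" "[Gam (r - i) y]"] Gam by (auto simp: ydeg_def)
  qed
qed

section \<open>The codifferential\<close>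

text \<open>
  The part of \<open>\<phi> (d (g # w))\<close> in which the derivation \<open>d\<close> hits the first letter \<open>g\<close>.
\<close>

fun codiff_letter :: "('k :: field, 'a :: ab_group_add, 'b :: ab_group_add) super_data \<Rightarrow> ('a, 'b) ygen \<Rightarrow>
    (('a, 'b) ygen list \<Rightarrow> 'k) \<Rightarrow> ('a, 'b) ygen list \<Rightarrow> 'k" where
  "codiff_letter L (Env u) \<phi> w = 0"
| "codiff_letter L (Ang x) \<phi> w = \<phi> (Env (x, 0) # w)"
| "codiff_letter L (Gam 0 y) \<phi> w = 0"
| "codiff_letter L (Gam (Suc 0) y) \<phi> w = \<phi> (Env (0, y) # Gam 0 y # w)"
| "codiff_letter L (Gam (Suc (Suc r)) y) \<phi> w =
     \<phi> (Env (0, y) # Gam (Suc r) y # w) - \<phi> (Ang (sqr L y) # Gam r y # w)"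

fun codiff :: "('k :: field, 'a :: ab_group_add, 'b :: ab_group_add) super_data \<Rightarrow>
    (('a, 'b) ygen list \<Rightarrow> 'k) \<Rightarrow> ('a, 'b) ygen list \<Rightarrow> 'k" where
  "codiff L \<phi> [] = 0"
| "codiff L \<phi> (g # w) = codiff_letter L g \<phi> w + codiff L (\<lambda>v. \<phi> (g # v)) w"

lemma codiff_letter_add: "codiff_letter L g (\<lambda>v. \<phi> v + \<psi> v) w = codiff_letter L g \<phi> w + codiff_letter L g \<psi> w"
  by (cases "(L, g, \<phi>, w)" rule: codiff_letter.cases) (auto simp: algebra_simps)

lemma codiff_letter_scale: "codiff_letter L g (\<lambda>v. c * \<phi> v) w = c * codiff_letter L g \<phi> w"
  by (cases "(L, g, \<phi>, w)" rule: codiff_letter.cases) (auto simp: algebra_simps)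

lemma codiff_add: "codiff L (\<lambda>v. \<phi> v + \<psi> v) w = codiff L \<phi> w + codiff L \<psi> w"
  by (induction w arbitrary: \<phi> \<psi>) (simp_all add: codiff_letter_add algebra_simps)

lemma codiff_scale: "codiff L (\<lambda>v. c * \<phi> v) w = c * codiff L \<phi> w"
  by (induction w arbitrary: \<phi>) (simp_all add: codiff_letter_scale algebra_simps)

lemma codiff_zero [simp]: "codiff L (\<lambda>v. 0) w = 0"
  using codiff_scale[of L 0 "\<lambda>v. 0"] by simp

lemma codiff_diff: "codiff L (\<lambda>v. \<phi> v - \<psi> v) w = codiff L \<phi> w - codiff L \<psi> w"
  using codiff_add[of L \<phi> "\<lambda>v. - \<psi> v"] codiff_scale[of L "-1" \<psi>] by simp

lemma codiff_sum: "codiff L (\<lambda>v. \<Sum>i\<in>A. \<phi> i v) w = (\<Sum>i\<in>A. codiff L (\<phi> i) w)"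
  by (induction A rule: infinite_finite_induct) (simp_all add: codiff_add)

lemma codiff_letter_nonzeroD:
  assumes "codiff_letter L g \<phi> w \<noteq> 0"
  shows "\<exists>a. \<phi> a \<noteq> 0 \<and> ydeg (g # w) = Suc (ydeg a)"
proof (cases "(L, g, \<phi>, w)" rule: codiff_letter.cases)
  case (5 L' r y \<phi>' w')
  have "\<phi> (Env (0, y) # Gam (Suc r) y # w) \<noteq> 0 \<or> \<phi> (Ang (sqr L y) # Gam r y # w) \<noteq> 0"
    using assms 5 by auto
  then show ?thesis
  proof
    assume "\<phi> (Env (0, y) # Gam (Suc r) y # w) \<noteq> 0"
    then show ?thesis using 5 by (intro exI conjI) (auto simp: ydeg_def)
  next
    assume "\<phi> (Ang (sqr L y) # Gam r y # w) \<noteq> 0"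
    then show ?thesis using 5 by (intro exI conjI) (auto simp: ydeg_def)
  qed
qed (use assms in \<open>auto simp: ydeg_def intro!: exI\<close>)

lemma codiff_nonzeroD:
  "codiff L \<phi> w \<noteq> 0 \<Longrightarrow> \<exists>a. \<phi> a \<noteq> 0 \<and> ydeg w = Suc (ydeg a)"
proof (induction w arbitrary: \<phi>)
  case (Cons g w)
  show ?case
  proof (cases "codiff_letter L g \<phi> w = 0")
    case True
    with Cons.prems have "codiff L (\<lambda>v. \<phi> (g # v)) w \<noteq> 0" by simp
    from Cons.IH[OF this] obtain a where "\<phi> (g # a) \<noteq> 0" "ydeg w = Suc (ydeg a)" by blast
    then show ?thesis by (intro exI[of _ "g # a"]) (simp add: ydeg_def)
  qed (rule codiff_letter_nonzeroD)
qed simp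

lemma sum_shift_left:
  fixes A :: "nat \<Rightarrow> nat \<Rightarrow> 'c :: comm_monoid_add"
  shows "(\<Sum>i\<le>r. if i < k then 0 else A (i - k) (r - i)) =
    (if r < k then 0 else \<Sum>i\<le>r - k. A i (r - k - i))"
proof (cases "r < k")
  case False
  have "(\<Sum>i\<le>r. if i < k then 0 else A (i - k) (r - i)) = (\<Sum>i\<in>{k..r}. A (i - k) (r - i))"
    by (rule sum.mono_neutral_cong_right) auto
  also have "\<dots> = (\<Sum>i\<le>r - k. A i (r - k - i))"
    using False
    by (intro sum.reindex_bij_witness[where i = "\<lambda>i. i + k" and j = "\<lambda>i. i - k"]) auto
  finally show ?thesis using False by simp
qed (auto intro!: sum.neutral)

lemma sum_shift_right:
  fixes A :: "nat \<Rightarrow> nat \<Rightarrow> 'c :: comm_monoid_add"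
  shows "(\<Sum>i\<le>r. if r - i < k then 0 else A i (r - i - k)) =
    (if r < k then 0 else \<Sum>i\<le>r - k. A i (r - k - i))"
proof (cases "r < k")
  case False
  have "(\<Sum>i\<le>r. if r - i < k then 0 else A i (r - i - k)) = (\<Sum>i\<le>r - k. A i (r - i - k))"
    using False by (intro sum.mono_neutral_cong_right) auto
  then show ?thesis using False by (simp add: add.commute)
qed (auto intro!: sum.neutral)

text \<open>
  A form that treats small and large indices alike, for use inside sums over the index.
\<close>

lemma codiff_letter_Gam:
  "codiff_letter L (Gam r y) \<phi> w = (if r < 1 then 0 else \<phi> (Env (0, y) # Gam (r - 1) y # w))
     - (if r < 2 then 0 else \<phi> (Ang (sqr L y) # Gam (r - 2) y # w))"
  by (cases r; cases "r - 1") auto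

lemma codiff_letter_Gam_conv:
  "codiff_letter L (Gam r y) (conv \<phi> \<psi>) w =
     (\<Sum>i\<le>r. conv (codiff_letter L (Gam i y) \<phi>) (\<lambda>v. \<psi> (Gam (r - i) y # v)) w)
     + (\<Sum>i\<le>r. conv (\<lambda>v. \<phi> (Gam i y # v)) (codiff_letter L (Gam (r - i) y) \<psi>) w)"
proof -
  let ?E = "Env (0, y)" and ?Q = "Ang (sqr L y)"
  have if_left: "conv (\<lambda>v. if b then 0 else \<chi> v) \<chi>' w = (if b then 0 else conv \<chi> \<chi>' w)"
    and if_right: "conv \<chi>' (\<lambda>v. if b then 0 else \<chi> v) w = (if b then 0 else conv \<chi>' \<chi> w)"
    for b \<chi> \<chi>' by auto
  have del: "codiff_letter L (Gam i y) \<chi> = (\<lambda>v. (if i < 1 then 0 else \<chi> (?E # Gam (i - 1) y # v))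
     - (if i < 2 then 0 else \<chi> (?Q # Gam (i - 2) y # v)))" for i \<chi>
    by (rule ext, rule codiff_letter_Gam)
  show ?thesis
    unfolding del conv_diff_left conv_diff_right sum_subtractf if_left if_right
    unfolding sum_shift_left[where A = "\<lambda>i j. conv (\<lambda>v. \<phi> (?E # Gam i y # v)) (\<lambda>v. \<psi> (Gam j y # v)) w"]
      sum_shift_left[where A = "\<lambda>i j. conv (\<lambda>v. \<phi> (?Q # Gam i y # v)) (\<lambda>v. \<psi> (Gam j y # v)) w"]
      sum_shift_right[where A = "\<lambda>i j. conv (\<lambda>v. \<phi> (Gam i y # v)) (\<lambda>v. \<psi> (?E # Gam j y # v)) w"]
      sum_shift_right[where A = "\<lambda>i j. conv (\<lambda>v. \<phi> (Gam i y # v)) (\<lambda>v. \<psi> (?Q # Gam j y # v)) w"]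
    by (simp add: sum.distrib)
qed

text \<open>
  \<open>d\<close> is a coderivation already on the free algebra: \<open>\<Delta> d\<close> and \<open>(d \<otimes> 1 + 1 \<otimes> d) \<Delta>\<close> are derivations
  along \<open>\<Delta>\<close>, and they agree on generators.
\<close>

lemma codiff_conv:
  "codiff L (conv \<phi> \<psi>) w = conv (codiff L \<phi>) \<psi> w + conv \<phi> (codiff L \<psi>) w"
proof (induction w arbitrary: \<phi> \<psi>)
  case (Cons g w)
  show ?case
  proof (cases g)
    case (Gam r y)
    show ?thesis
      by (simp add: Gam codiff_letter_Gam_conv codiff_sum Cons.IH conv_bilinear sum.distrib)
  qed (simp_all add: codiff_add Cons.IH conv_bilinear algebra_simps)
qed simp

section \<open>Linear forms that respect the relations\<close>

text \<open>
  The relations of \<open>Y(L)\<close>, evaluated by the form \<open>\<phi>\<close> in front of an arbitrary tail \<open>w\<close>.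
\<close>

locale head_rels =
  fixes L :: "('k :: field, 'a :: ab_group_add, 'b :: ab_group_add) super_data"
    and \<phi> :: "('a, 'b) ygen list \<Rightarrow> 'k"
  assumes Env_add: "\<phi> (Env (u + v) # w) = \<phi> (Env u # w) + \<phi> (Env v # w)"
    and Env_scale: "\<phi> (Env (lscale L c u) # w) = c * \<phi> (Env u # w)"
    and Env_Env: "\<phi> (Env u # Env v # w) = \<phi> (Env v # Env u # w) + \<phi> (Env (brk L u v) # w)"
    and Env_sqr: "\<phi> (Env (0, y) # Env (0, y) # w) = \<phi> (Env (sqr L y, 0) # w)"
    and Ang_add: "\<phi> (Ang (x + x') # w) = \<phi> (Ang x # w) + \<phi> (Ang x' # w)"
    and Ang_scale: "\<phi> (Ang (escale L c x) # w) = c * \<phi> (Ang x # w)"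
    and Ang_Ang: "\<phi> (Ang x # Ang x # w) = 0"
    and Gam_zero: "\<phi> (Gam 0 y # w) = \<phi> w"
    and Gam_scale: "\<phi> (Gam r (oscale L c y) # w) = c ^ r * \<phi> (Gam r y # w)"
    and Gam_add: "\<phi> (Gam r (y + y') # w) = (\<Sum>i\<le>r. \<phi> (Gam i y # Gam (r - i) y' # w))"
    and Gam_Gam: "\<phi> (Gam r y # Gam s y # w) = of_nat ((r + s) choose r) * \<phi> (Gam (r + s) y # w)"
    and Gam_commute: "\<phi> (Gam r y # Gam s y' # w) = \<phi> (Gam s y' # Gam r y # w)"
    and Ang_Gam: "\<phi> (Ang x # Gam r y # w) = \<phi> (Gam r y # Ang x # w)"
    and Ang_Env: "\<phi> (Ang x # Env u # w) = \<phi> (Env u # Ang x # w)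
      + \<phi> (Ang (fst (brk L (x, 0) u)) # w) + \<phi> (Gam 1 (snd (brk L (x, 0) u)) # w)"
    and Gam_Env: "\<phi> (Gam (Suc r) y # Env u # w) = \<phi> (Env u # Gam (Suc r) y # w)
      + \<phi> (Gam r y # Ang (fst (brk L (0, y) u)) # w)
      + \<phi> (Gam r y # Gam 1 (snd (brk L (0, y) u)) # w)"

text \<open>
  Prefixing a word \<open>a\<close> to the relations and their tails covers the whole two-sided ideal. The
  condition passes from \<open>\<phi>\<close> to \<open>\<lambda>w. \<phi> (g # w)\<close>, so that closure properties follow by induction
  on the prefix from the case of the empty prefix.
\<close>

definition annihilates :: "('k :: field, 'a :: ab_group_add, 'b :: ab_group_add) super_data \<Rightarrow>
    (('a, 'b) ygen list \<Rightarrow> 'k) \<Rightarrow> bool" where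
  "annihilates L \<phi> \<longleftrightarrow> (\<forall>a. head_rels L (\<lambda>w. \<phi> (a @ w)))"

lemma annihilates_head: "annihilates L \<phi> \<Longrightarrow> head_rels L \<phi>"
  unfolding annihilates_def by (metis (no_types, lifting) append_Nil ext)

lemma annihilates_Cons: "annihilates L \<phi> \<Longrightarrow> annihilates L (\<lambda>w. \<phi> (g # w))"
  unfolding annihilates_def
proof
  fix a assume "\<forall>a. head_rels L (\<lambda>w. \<phi> (a @ w))"
  from this[rule_format, of "g # a"] show "head_rels L (\<lambda>w. \<phi> (g # a @ w))" by simp
qed

lemma head_rels_add:
  assumes "head_rels L \<phi>" "head_rels L \<psi>"
  shows "head_rels L (\<lambda>w. \<phi> w + \<psi> w)"
proof -
  interpret \<phi>: head_rels L \<phi> by fact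
  interpret \<psi>: head_rels L \<psi> by fact
  show ?thesis
  proof
    fix x u w
    show "\<phi> (Ang x # Env u # w) + \<psi> (Ang x # Env u # w) =
       \<phi> (Env u # Ang x # w) + \<psi> (Env u # Ang x # w) +
       (\<phi> (Ang (fst (brk L (x, 0) u)) # w) + \<psi> (Ang (fst (brk L (x, 0) u)) # w)) +
       (\<phi> (Gam 1 (snd (brk L (x, 0) u)) # w) + \<psi> (Gam 1 (snd (brk L (x, 0) u)) # w))"
      unfolding \<phi>.Ang_Env \<psi>.Ang_Env by simp
  next
    fix r y u w
    show "\<phi> (Gam (Suc r) y # Env u # w) + \<psi> (Gam (Suc r) y # Env u # w) =
       \<phi> (Env u # Gam (Suc r) y # w) + \<psi> (Env u # Gam (Suc r) y # w) +
       (\<phi> (Gam r y # Ang (fst (brk L (0, y) u)) # w) + \<psi> (Gam r y # Ang (fst (brk L (0, y) u)) # w)) +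
       (\<phi> (Gam r y # Gam 1 (snd (brk L (0, y) u)) # w) + \<psi> (Gam r y # Gam 1 (snd (brk L (0, y) u)) # w))"
      unfolding \<phi>.Gam_Env \<psi>.Gam_Env by simp
  next
    fix r y s y' w
    show "\<phi> (Gam r y # Gam s y' # w) + \<psi> (Gam r y # Gam s y' # w) =
      \<phi> (Gam s y' # Gam r y # w) + \<psi> (Gam s y' # Gam r y # w)"
      by (simp only: \<phi>.Gam_commute[of r y] \<psi>.Gam_commute[of r y])
  next
    fix u v w
    show "\<phi> (Env u # Env v # w) + \<psi> (Env u # Env v # w) =
      \<phi> (Env v # Env u # w) + \<psi> (Env v # Env u # w) + (\<phi> (Env (brk L u v) # w) + \<psi> (Env (brk L u v) # w))"
      unfolding \<phi>.Env_Env[of u v] \<psi>.Env_Env[of u v] by simp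
  qed (simp_all add: \<phi>.Env_add \<psi>.Env_add \<phi>.Env_scale \<psi>.Env_scale \<phi>.Env_sqr \<psi>.Env_sqr
      \<phi>.Ang_add \<psi>.Ang_add \<phi>.Ang_scale \<psi>.Ang_scale \<phi>.Ang_Ang \<psi>.Ang_Ang \<phi>.Gam_zero \<psi>.Gam_zero
      \<phi>.Gam_scale \<psi>.Gam_scale \<phi>.Gam_add \<psi>.Gam_add \<phi>.Gam_Gam \<psi>.Gam_Gam \<phi>.Ang_Gam \<psi>.Ang_Gam
      algebra_simps sum.distrib)
qed

lemma head_rels_scale:
  assumes "head_rels L \<phi>"
  shows "head_rels L (\<lambda>w. c * \<phi> w)"
proof -
  interpret \<phi>: head_rels L \<phi> by fact
  show ?thesis
  proof
    fix r y s y' w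
    show "c * \<phi> (Gam r y # Gam s y' # w) = c * \<phi> (Gam s y' # Gam r y # w)"
      by (simp only: \<phi>.Gam_commute[of r y])
  next
    fix u v w
    show "c * \<phi> (Env u # Env v # w) = c * \<phi> (Env v # Env u # w) + c * \<phi> (Env (brk L u v) # w)"
      unfolding \<phi>.Env_Env[of u v] by (simp add: algebra_simps)
  next
    fix x u w
    show "c * \<phi> (Ang x # Env u # w) = c * \<phi> (Env u # Ang x # w) +
       c * \<phi> (Ang (fst (brk L (x, 0) u)) # w) + c * \<phi> (Gam 1 (snd (brk L (x, 0) u)) # w)"
      unfolding \<phi>.Ang_Env by (simp add: algebra_simps)
  next
    fix r y u w
    show "c * \<phi> (Gam (Suc r) y # Env u # w) = c * \<phi> (Env u # Gam (Suc r) y # w) +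
       c * \<phi> (Gam r y # Ang (fst (brk L (0, y) u)) # w) +
       c * \<phi> (Gam r y # Gam 1 (snd (brk L (0, y) u)) # w)"
      unfolding \<phi>.Gam_Env by (simp add: algebra_simps)
  qed (simp_all add: \<phi>.Env_add \<phi>.Env_scale \<phi>.Env_sqr
      \<phi>.Ang_add \<phi>.Ang_scale \<phi>.Ang_Ang \<phi>.Gam_zero
      \<phi>.Gam_scale \<phi>.Gam_add \<phi>.Gam_Gam \<phi>.Ang_Gam algebra_simps sum_distrib_left)
qed

lemma head_rels_zero: "head_rels L (\<lambda>w. 0)"
  by standard simp_all

lemma head_rels_sum: "(\<And>i. i \<in> A \<Longrightarrow> head_rels L (\<phi> i)) \<Longrightarrow> head_rels L (\<lambda>w. \<Sum>i\<in>A. \<phi> i w)"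
  by (induction A rule: infinite_finite_induct) (auto intro: head_rels_zero head_rels_add)

lemma annihilates_add:
  "annihilates L \<phi> \<Longrightarrow> annihilates L \<psi> \<Longrightarrow> annihilates L (\<lambda>w. \<phi> w + \<psi> w)"
  by (simp add: annihilates_def head_rels_add)

lemma annihilates_scale: "annihilates L \<phi> \<Longrightarrow> annihilates L (\<lambda>w. c * \<phi> w)"
  by (simp add: annihilates_def head_rels_scale)

lemma annihilates_zero: "annihilates L (\<lambda>w. 0)"
  by (simp add: annihilates_def head_rels_zero)

lemma annihilates_diff: "annihilates L \<phi> \<Longrightarrow> annihilates L \<psi> \<Longrightarrow> annihilates L (\<lambda>w. \<phi> w - \<psi> w)"
  using annihilates_add[of L \<phi> "\<lambda>w. (-1) * \<psi> w"] annihilates_scale[of L \<psi> "-1"] by simp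

text \<open>
  The compatibility of the coproduct with the addition formula for divided powers: both sides sum
  over all ways to write \<open>r\<close> as an ordered sum of four numbers.
\<close>

lemma sum_four_way:
  fixes F :: "nat \<Rightarrow> nat \<Rightarrow> nat \<Rightarrow> nat \<Rightarrow> 'c :: comm_monoid_add"
  shows "(\<Sum>i\<le>r. \<Sum>j\<le>i. \<Sum>k\<le>r - i. F j (i - j) k (r - i - k)) =
    (\<Sum>i\<le>r. \<Sum>j\<le>i. \<Sum>k\<le>r - i. F j k (i - j) (r - i - k))"
  by (simp add: sum.Sigma split_beta, rule sum.reindex_bij_witness
      [where i = "\<lambda>p. (fst (snd p) + snd (snd p), fst (snd p), fst p - fst (snd p))"
        and j = "\<lambda>p. (fst (snd p) + snd (snd p), fst (snd p), fst p - fst (snd p))"])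
    (auto simp: algebra_simps)

text \<open>
  The compatibility of the coproduct with the multiplication formula for divided powers. Collecting
  the terms with \<open>i + j = m\<close> leaves a Vandermonde convolution, whose value does not depend on \<open>m\<close>.
\<close>

lemma sum_binomial_regroup:
  fixes T :: "nat \<Rightarrow> 'c :: comm_ring_1"
  shows "(\<Sum>i\<le>r. \<Sum>j\<le>s. of_nat ((i + j) choose i) * (of_nat ((r + s - (i + j)) choose (r - i))
      * T (i + j))) = of_nat ((r + s) choose r) * (\<Sum>m\<le>r + s. T m)"
proof -
  define F where "F i m = of_nat ((m choose i) * ((r + s - m) choose (r - i))) * T m" for i m
  have "(\<Sum>i\<le>r. \<Sum>j\<le>s. of_nat ((i + j) choose i) * (of_nat ((r + s - (i + j)) choose (r - i))
      * T (i + j))) = (\<Sum>i\<le>r. \<Sum>j\<le>s. F i (i + j))"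
    by (intro sum.cong refl) (simp add: F_def algebra_simps)
  also have "\<dots> = (\<Sum>i\<le>r. \<Sum>m\<le>r + s. F i m)"
  proof (rule sum.cong[OF refl])
    fix i assume i: "i \<in> {..r}"
    have "(\<Sum>j\<le>s. F i (i + j)) = (\<Sum>m\<in>{i..i + s}. F i m)"
      by (rule sum.reindex_bij_witness[where i = "\<lambda>m. m - i" and j = "\<lambda>j. i + j"]) auto
    also have "\<dots> = (\<Sum>m\<le>r + s. F i m)"
      using i by (intro sum.mono_neutral_left) (auto simp: F_def binomial_eq_0)
    finally show "(\<Sum>j\<le>s. F i (i + j)) = (\<Sum>m\<le>r + s. F i m)" .
  qed
  also have "\<dots> = (\<Sum>m\<le>r + s. \<Sum>i\<le>r. F i m)" by (rule sum.swap)
  also have "\<dots> = (\<Sum>m\<le>r + s. of_nat ((r + s) choose r) * T m)"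
  proof (rule sum.cong[OF refl])
    fix m assume m: "m \<in> {..r + s}"
    have "(\<Sum>i\<le>r. F i m) = of_nat (\<Sum>i\<le>r. (m choose i) * ((r + s - m) choose (r - i))) * T m"
      by (simp add: F_def sum_distrib_right)
    also have "\<dots> = of_nat ((r + s) choose r) * T m" using m by (simp only: vandermonde) simp
    finally show "(\<Sum>i\<le>r. F i m) = of_nat ((r + s) choose r) * T m" .
  qed
  finally show ?thesis by (simp add: sum_distrib_left)
qed

lemma char2_double:
  assumes "CHAR('k :: field) = 2" shows "(x :: 'k) + x = 0"
proof -
  have "of_nat CHAR('k) * x = 0" by (simp only: of_nat_CHAR) simp
  then show ?thesis by (simp add: assms)
qed

lemma (in head_rels) Gam_past_Env:
  assumes "\<And>g. head_rels L (\<lambda>w. \<phi> (g # w))"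
  shows "\<phi> (Gam r y # Env u # w) = \<phi> (Env u # Gam r y # w) + (if r < 1 then 0 else
     \<phi> (Gam (r - 1) y # Ang (fst (brk L (0, y) u)) # w)
     + \<phi> (Gam (r - 1) y # Gam 1 (snd (brk L (0, y) u)) # w))"
  by (cases r) (simp_all add: Gam_zero head_rels.Gam_zero[OF assms] Gam_Env)

text \<open>
  The relations generate a coideal: the coproduct of each of them lies in the sum of the two
  ideals generated by the relations in one tensor factor. Characteristic 2 cancels the cross terms of
  the two relations that involve the square of a primitive element.
\<close>

lemma head_rels_conv:
  assumes char2: "CHAR('k) = 2"
    and resp: "annihilates L \<phi>" "annihilates L (\<psi> :: ('a :: ab_group_add, 'b :: ab_group_add) ygen list \<Rightarrow> 'k :: field)"
  shows "head_rels L (conv \<phi> \<psi>)"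
proof -
  interpret \<phi>: head_rels L \<phi> using resp by (intro annihilates_head)
  interpret \<psi>: head_rels L \<psi> using resp by (intro annihilates_head)
  interpret \<phi>': head_rels L "\<lambda>w. \<phi> (g # w)" for g using resp by (intro annihilates_head annihilates_Cons)
  interpret \<psi>': head_rels L "\<lambda>w. \<psi> (g # w)" for g using resp by (intro annihilates_head annihilates_Cons)
  note double = char2_double[OF char2]
  show ?thesis
  proof
    fix u v w
    show "conv \<phi> \<psi> (Env u # Env v # w) =
       conv \<phi> \<psi> (Env v # Env u # w) + conv \<phi> \<psi> (Env (brk L u v) # w)"
      by (simp add: \<phi>.Env_Env[of u v] \<psi>.Env_Env[of u v] conv_bilinear algebra_simps)
  next
    fix y w
    \<comment> \<open>The two cross terms of the coproduct coincide.\<close>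
    have "conv \<phi> \<psi> (Env (0, y) # Env (0, y) # w) = conv \<phi> \<psi> (Env (sqr L y, 0) # w)
       + (conv (\<lambda>v. \<phi> (Env (0, y) # v)) (\<lambda>v. \<psi> (Env (0, y) # v)) w
         + conv (\<lambda>v. \<phi> (Env (0, y) # v)) (\<lambda>v. \<psi> (Env (0, y) # v)) w)"
      by (simp add: \<phi>.Env_sqr \<psi>.Env_sqr algebra_simps)
    then show "conv \<phi> \<psi> (Env (0, y) # Env (0, y) # w) = conv \<phi> \<psi> (Env (sqr L y, 0) # w)"
      unfolding double by simp
  next
    fix x w
    show "conv \<phi> \<psi> (Ang x # Ang x # w) = 0"
      by (simp add: \<phi>.Ang_Ang \<psi>.Ang_Ang double)
  next
    fix r c y w
    have "c ^ i * (c ^ (r - i) * t) = c ^ r * t" if "i \<le> r" for i and t :: 'k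
      using that by (simp add: mult.assoc[symmetric] flip: power_add)
    then show "conv \<phi> \<psi> (Gam r (oscale L c y) # w) = c ^ r * conv \<phi> \<psi> (Gam r y # w)"
      by (auto simp: \<phi>.Gam_scale \<psi>.Gam_scale conv_bilinear sum_distrib_left intro!: sum.cong)
  next
    fix r y y' w
    show "conv \<phi> \<psi> (Gam r (y + y') # w) = (\<Sum>i\<le>r. conv \<phi> \<psi> (Gam i y # Gam (r - i) y' # w))"
      using sum_four_way[of "\<lambda>j i k l. conv (\<lambda>v. \<phi> (Gam j y # Gam i y' # v))
        (\<lambda>v. \<psi> (Gam k y # Gam l y' # v)) w"]
      by (simp add: \<phi>.Gam_add \<psi>.Gam_add conv_bilinear)
  next
    fix r y s w
    let ?T = "\<lambda>m. conv (\<lambda>v. \<phi> (Gam m y # v)) (\<lambda>v. \<psi> (Gam (r + s - m) y # v)) w"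
    have "conv \<phi> \<psi> (Gam r y # Gam s y # w) =
      (\<Sum>i\<le>r. \<Sum>j\<le>s. of_nat ((i + j) choose i) * (of_nat ((r + s - (i + j)) choose (r - i))
      * ?T (i + j)))"
    proof -
      have "r - i + (s - j) = r + s - (i + j)" if "i \<le> r" "j \<le> s" for i j using that by simp
      then show ?thesis
        by (auto simp: \<phi>.Gam_Gam \<psi>.Gam_Gam conv_bilinear intro!: sum.cong)
    qed
    also have "\<dots> = of_nat ((r + s) choose r) * conv \<phi> \<psi> (Gam (r + s) y # w)"
      unfolding sum_binomial_regroup[where T = ?T] by simp
    finally show "conv \<phi> \<psi> (Gam r y # Gam s y # w) =
      of_nat ((r + s) choose r) * conv \<phi> \<psi> (Gam (r + s) y # w)" .
  next
    fix r y s y' w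
    have "conv \<phi> \<psi> (Gam r y # Gam s y' # w) = (\<Sum>i\<le>r. \<Sum>j\<le>s.
        conv (\<lambda>v. \<phi> (Gam j y' # Gam i y # v)) (\<lambda>v. \<psi> (Gam (s - j) y' # Gam (r - i) y # v)) w)"
      by (simp add: \<phi>.Gam_commute[of _ y _ y'] \<psi>.Gam_commute[of _ y _ y'])
    also have "\<dots> = conv \<phi> \<psi> (Gam s y' # Gam r y # w)"
      by (subst sum.swap) simp
    finally show "conv \<phi> \<psi> (Gam r y # Gam s y' # w) = conv \<phi> \<psi> (Gam s y' # Gam r y # w)" .
  next
    fix r y u and w :: "('a, 'b) ygen list"
    let ?x = "fst (brk L (0, y) u)" and ?z = "snd (brk L (0, y) u)"
    have if_left: "conv (\<lambda>v. if b then 0 else \<chi> v) \<chi>' w = (if b then 0 else conv \<chi> \<chi>' w)"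
      and if_right: "conv \<chi>' (\<lambda>v. if b then 0 else \<chi> v) w = (if b then 0 else conv \<chi>' \<chi> w)"
      for b \<chi> \<chi>' by auto
    have "conv \<phi> \<psi> (Gam (Suc r) y # Env u # w) = conv \<phi> \<psi> (Env u # Gam (Suc r) y # w)
      + (\<Sum>i\<le>Suc r. if i < 1 then 0 else
          conv (\<lambda>v. \<phi> (Gam (i - 1) y # Ang ?x # v) + \<phi> (Gam (i - 1) y # Gam 1 ?z # v))
            (\<lambda>v. \<psi> (Gam (Suc r - i) y # v)) w)
      + (\<Sum>i\<le>Suc r. if Suc r - i < 1 then 0 else
          conv (\<lambda>v. \<phi> (Gam i y # v))
            (\<lambda>v. \<psi> (Gam (Suc r - i - 1) y # Ang ?x # v) + \<psi> (Gam (Suc r - i - 1) y # Gam 1 ?z # v)) w)"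
      by (simp only: conv.simps \<phi>.Gam_past_Env[OF \<phi>'.head_rels_axioms]
          \<psi>.Gam_past_Env[OF \<psi>'.head_rels_axioms] conv_add_left[of _ "\<lambda>v. if _ then _ else _ v"]
          conv_add_right[of _ _ "\<lambda>v. if _ then _ else _ v"] if_left if_right sum.distrib add_ac)
    also have "\<dots> = conv \<phi> \<psi> (Env u # Gam (Suc r) y # w)
      + (\<Sum>i\<le>r. conv (\<lambda>v. \<phi> (Gam i y # Ang ?x # v) + \<phi> (Gam i y # Gam 1 ?z # v))
            (\<lambda>v. \<psi> (Gam (r - i) y # v)) w)
      + (\<Sum>i\<le>r. conv (\<lambda>v. \<phi> (Gam i y # v))
            (\<lambda>v. \<psi> (Gam (r - i) y # Ang ?x # v) + \<psi> (Gam (r - i) y # Gam 1 ?z # v)) w)"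
      unfolding sum_shift_left[where A = "\<lambda>i j. conv (\<lambda>v. \<phi> (Gam i y # Ang ?x # v) + \<phi> (Gam i y # Gam 1 ?z # v))
            (\<lambda>v. \<psi> (Gam j y # v)) w"]
        sum_shift_right[where A = "\<lambda>i j. conv (\<lambda>v. \<phi> (Gam i y # v))
            (\<lambda>v. \<psi> (Gam j y # Ang ?x # v) + \<psi> (Gam j y # Gam 1 ?z # v)) w"] by simp
    also have "\<dots> = conv \<phi> \<psi> (Env u # Gam (Suc r) y # w) + conv \<phi> \<psi> (Gam r y # Ang ?x # w)
      + conv \<phi> \<psi> (Gam r y # Gam 1 ?z # w)"
      by (simp add: \<phi>'.Gam_zero \<psi>'.Gam_zero conv_bilinear sum.distrib algebra_simps)
    finally show "conv \<phi> \<psi> (Gam (Suc r) y # Env u # w) = conv \<phi> \<psi> (Env u # Gam (Suc r) y # w)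
      + conv \<phi> \<psi> (Gam r y # Ang ?x # w) + conv \<phi> \<psi> (Gam r y # Gam 1 ?z # w)" .
  next
    fix x u w
    let ?x = "fst (brk L (x, 0) u)" and ?z = "snd (brk L (x, 0) u)"
    show "conv \<phi> \<psi> (Ang x # Env u # w) = conv \<phi> \<psi> (Env u # Ang x # w)
      + conv \<phi> \<psi> (Ang ?x # w) + conv \<phi> \<psi> (Gam 1 ?z # w)"
      by (simp add: \<phi>.Ang_Env \<psi>.Ang_Env \<phi>.Gam_zero \<psi>.Gam_zero conv_bilinear algebra_simps)
  qed (simp_all add: \<phi>.Env_add \<psi>.Env_add \<phi>.Env_scale \<psi>.Env_scale \<phi>.Ang_add \<psi>.Ang_add
      \<phi>.Ang_scale \<psi>.Ang_scale \<phi>.Gam_zero \<psi>.Gam_zero \<phi>.Ang_Gam \<psi>.Ang_Gam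
      conv_bilinear algebra_simps sum.distrib sum_distrib_left)
qed

lemma annihilates_conv:
  assumes "CHAR('k) = 2"
    and "annihilates L \<phi>" "annihilates L (\<psi> :: ('a :: ab_group_add, 'b :: ab_group_add) ygen list \<Rightarrow> 'k :: field)"
  shows "annihilates L (conv \<phi> \<psi>)"
  unfolding annihilates_def
proof
  fix a
  show "head_rels L (\<lambda>w. conv \<phi> \<psi> (a @ w))"
    using assms(2,3)
  proof (induction a arbitrary: \<phi> \<psi>)
    case Nil
    then show ?case using head_rels_conv[OF assms(1)] by simp
  next
    case (Cons g a)
    then show ?case
      by (cases g) (auto intro!: head_rels_add head_rels_sum Cons.IH annihilates_Cons)
  qed
qed

section \<open>The codifferential respects the relations\<close>

lemma binomial_shift_one:
  assumes "1 \<le> r + s"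
  shows "(if r < 1 then 0 else (r + s - 1) choose (r - 1)) + (if s < 1 then 0 else (r + s - 1) choose r)
    = (r + s) choose r"
  using assms by (cases r; cases s) auto

text \<open>
  Pascal's rule applied twice. The middle binomial coefficient occurs twice and so drops out in
  characteristic 2.
\<close>

lemma binomial_shift_two:
  assumes "2 \<le> r + s"
  shows "\<exists>m. (r + s) choose r = (if r < 2 then 0 else (r + s - 2) choose (r - 2))
    + (if s < 2 then 0 else (r + s - 2) choose r) + 2 * m"
proof -
  consider "r = 0" | "r = 1" | "s = 0" | "s = 1" | r' s' where "r = Suc (Suc r')" "s = Suc (Suc s')"
    by (cases r; cases "r - 1"; cases s; cases "s - 1") auto
  then show ?thesis
  proof cases
    case 2
    then show ?thesis using assms by (intro exI[of _ 1]) auto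
  next
    case 4
    then obtain r' where "r = Suc r'" using assms by (cases r) auto
    then show ?thesis using 4 by (intro exI[of _ 1]) (cases r', auto)
  next
    case (5 r' s')
    then show ?thesis by (intro exI[of _ "(r' + s' + 2) choose (r' + 1)"]) simp
  qed (use assms in auto)
qed

context lie_superalgebra_char2
begin

interpretation even: vector_space "escale L" by (rule vector_space_even)
interpretation odd: vector_space "oscale L" by (rule vector_space_odd)

lemma double_scalar: "(c :: 'k) + c = 0"
  by (rule char2_double[OF char2])

lemma minus_scalar: "(b :: 'k) - c = b + c"
  using double_scalar[of c] by (simp add: diff_eq_eq add.assoc)

lemma double_scalar': "(c :: 'k) + (c + b) = b"
  using double_scalar[of c] by (simp flip: add.assoc)

lemma double_even: "(x :: 'a) + x = 0"
proof -
  have "escale L (1 + 1) x = x + x" by (simp only: even.scale_left_distrib even.scale_one)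
  then show ?thesis by (simp add: double_scalar)
qed

lemma minus_even: "(x :: 'a) - x' = x + x'"
  using double_even[of x'] by (simp add: diff_eq_eq add.assoc)

lemma double_odd: "(y :: 'b) + y = 0"
proof -
  have "oscale L (1 + 1) y = y + y" by (simp only: odd.scale_left_distrib odd.scale_one)
  then show ?thesis by (simp add: double_scalar)
qed

lemma sqr_zero [simp]: "sqr L 0 = 0"
  using sqr_scale[of 0 0] by simp

lemma brk_odd_self: "brk L (0, y) (0, y) = 0"
  unfolding sqr_polar double_odd by (simp add: minus_even double_even zero_prod_def)

lemma sqr_add: "sqr L (y + y') = sqr L y + sqr L y' + fst (brk L (0, y) (0, y'))"
  unfolding sqr_polar by simp

lemma Ang_null: "head_rels L \<phi> \<Longrightarrow> \<phi> (Ang 0 # w) = 0"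
  using head_rels.Ang_scale[of L \<phi> 0 0 w] by simp

lemma Gam_null: "head_rels L \<phi> \<Longrightarrow> \<phi> (Gam (Suc r) 0 # w) = 0"
  using head_rels.Gam_scale[of L \<phi> "Suc r" 0 0 w] by simp

text \<open>
  The form in which \<open>d s(v) = v\<close> is used.
\<close>

lemma Env_split:
  assumes "head_rels L \<phi>"
  shows "\<phi> (Env (fst v, 0) # w) + \<phi> (Env (0, snd v) # w) = \<phi> (Env v # w)"
  using head_rels.Env_add[OF assms, of "(fst v, 0)" "(0, snd v)" w] by simp

text \<open>
  The differential maps each relation into the ideal of relations. Whenever \<open>d \<gamma>\<^sub>r(y)\<close> occurs
  inside a product, the factor \<open>y\<close> from \<open>U(L)\<close> has to be moved to the left past other generators, and
  the smash product rule then produces brackets with \<open>y\<close>. In the addition formula for divided powers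
  the bracket accounts for the failure of \<open>q\<close> to be additive; in the other relations the brackets are
  zero or cancel.
\<close>

lemma head_rels_codiff:
  assumes resp: "annihilates L \<phi>"
  shows "head_rels L (codiff L \<phi>)"
proof -
  interpret H: head_rels L \<phi> using resp by (intro annihilates_head)
  interpret H1: head_rels L "\<lambda>w. \<phi> (g # w)" for g
    using resp by (intro annihilates_head annihilates_Cons)
  have H2: "head_rels L (\<lambda>w. \<phi> (g # g' # w))" for g g'
    using annihilates_head[OF annihilates_Cons[OF annihilates_Cons[OF resp]]] .
  note null = Ang_null[OF H.head_rels_axioms] Ang_null[OF H1.head_rels_axioms]
    Gam_null[OF H.head_rels_axioms] Gam_null[OF H1.head_rels_axioms]
  note past = H.Gam_past_Env[OF H1.head_rels_axioms]
  have Ang_Ang: "\<phi> (Ang x # Ang x' # w) = \<phi> (Ang x' # Ang x # w)" for x x' w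
  proof -
    have "\<phi> (Ang (x + x') # Ang (x + x') # w) = \<phi> (Ang x # Ang x' # w) + \<phi> (Ang x' # Ang x # w)"
      by (simp only: H.Ang_add H1.Ang_add H.Ang_Ang) simp
    then show ?thesis unfolding H.Ang_Ang by (metis minus_scalar eq_iff_diff_eq_0)
  qed
  note char2_simps = minus_scalar double_scalar double_scalar'
  have even_scale: "(escale L c x, 0) = lscale L c (x, 0)" for c x by (simp add: lscale_def)
  have odd_scale: "(0, oscale L c y) = lscale L c (0, y)" for c y by (simp add: lscale_def)
  show ?thesis
  proof
    fix u v w
    show "codiff L \<phi> (Env u # Env v # w) =
       codiff L \<phi> (Env v # Env u # w) + codiff L \<phi> (Env (brk L u v) # w)"
      by (simp add: H.Env_Env[of u v] codiff_add)
  next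
    fix u v w
    show "codiff L \<phi> (Env (u + v) # w) = codiff L \<phi> (Env u # w) + codiff L \<phi> (Env v # w)"
      by (simp add: H.Env_add codiff_add)
  next
    fix c u w
    show "codiff L \<phi> (Env (lscale L c u) # w) = c * codiff L \<phi> (Env u # w)"
      by (simp add: H.Env_scale codiff_scale)
  next
    fix y w
    show "codiff L \<phi> (Env (0, y) # Env (0, y) # w) = codiff L \<phi> (Env (sqr L y, 0) # w)"
      by (simp add: H.Env_sqr)
  next
    fix x x' w
    show "codiff L \<phi> (Ang (x + x') # w) = codiff L \<phi> (Ang x # w) + codiff L \<phi> (Ang x' # w)"
      using H.Env_add[of "(x, 0)" "(x', 0)"] by (simp add: H.Ang_add codiff_add algebra_simps)
  next
    fix c x w
    show "codiff L \<phi> (Ang (escale L c x) # w) = c * codiff L \<phi> (Ang x # w)"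
      by (simp add: even_scale H.Env_scale H.Ang_scale codiff_scale algebra_simps)
  next
    fix x w
    show "codiff L \<phi> (Ang x # Ang x # w) = 0"
      by (simp add: H.Ang_Ang H.Ang_Env brk_even_self null char2_simps)
  next
    fix y w
    show "codiff L \<phi> (Gam 0 y # w) = codiff L \<phi> w"
      by (simp add: H.Gam_zero)
  next
    fix r c y w
    have "codiff_letter L (Gam r (oscale L c y)) \<phi> w = c ^ r * codiff_letter L (Gam r y) \<phi> w"
      by (cases r; cases "r - 1")
        (auto simp: odd_scale H.Env_scale H1.Gam_scale H.Ang_scale sqr_scale power2_eq_square algebra_simps)
    then show "codiff L \<phi> (Gam r (oscale L c y) # w) = c ^ r * codiff L \<phi> (Gam r y # w)"
      by (simp add: H.Gam_scale codiff_scale algebra_simps)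
  next
    fix r y y' w
    let ?b = "fst (brk L (0, y) (0, y'))"
    define A where "A g i j = \<phi> (g # Gam i y # Gam j y' # w)" for g i j
    have Q: "A (Ang (sqr L (y + y'))) i j = A (Ang (sqr L y)) i j + A (Ang (sqr L y')) i j + A (Ang ?b) i j"
      for i j by (simp add: A_def sqr_add H.Ang_add)
    have E: "A (Env (0, y + y')) i j = A (Env (0, y)) i j + A (Env (0, y')) i j" for i j
      using H.Env_add[of "(0, y)" "(0, y')"] by (simp add: A_def)
    have G: "\<phi> (Gam i y # Env (0, y') # Gam j y' # w) =
      A (Env (0, y')) i j + (if i < 1 then 0 else A (Ang ?b) (i - 1) j)" for i j
      by (simp add: past brk_odd_odd null A_def H.Ang_Gam)
    have "codiff_letter L (Gam r (y + y')) \<phi> w =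
      (if r < 1 then 0 else \<Sum>i\<le>r - 1. A (Env (0, y + y')) i (r - 1 - i))
      - (if r < 2 then 0 else \<Sum>i\<le>r - 2. A (Ang (sqr L (y + y'))) i (r - 2 - i))"
      by (simp add: codiff_letter_Gam H1.Gam_add A_def)
    \<comment> \<open>The polarization \<open>b\<close> of \<open>q\<close>, which here comes from \<open>q(y + y')\<close>, comes on the other side from
      moving \<open>y'\<close> past the divided powers of \<open>y\<close>.\<close>
    also have "\<dots> = (if r < 1 then 0 else \<Sum>i\<le>r - 1. A (Env (0, y)) i (r - 1 - i))
      - (if r < 2 then 0 else \<Sum>i\<le>r - 2. A (Ang (sqr L y)) i (r - 2 - i))
      + (if r < 1 then 0 else \<Sum>i\<le>r - 1. A (Env (0, y')) i (r - 1 - i)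
            + (if i < 1 then 0 else A (Ang ?b) (i - 1) (r - 1 - i)))
      - (if r < 2 then 0 else \<Sum>i\<le>r - 2. A (Ang (sqr L y')) i (r - 2 - i))"
    proof -
      have "(\<Sum>i\<le>r - 1. if i < 1 then 0 else A (Ang ?b) (i - 1) (r - 1 - i)) =
        (if r - 1 < 1 then 0 else \<Sum>i\<le>r - 1 - 1. A (Ang ?b) i (r - 1 - 1 - i))"
        by (rule sum_shift_left)
      then show ?thesis
        unfolding Q E sum.distrib by (cases r; cases "r - 1") (simp_all add: char2_simps add_ac)
    qed
    also have "\<dots> = (\<Sum>i\<le>r. codiff_letter L (Gam i y) \<phi> (Gam (r - i) y' # w))
      + (\<Sum>i\<le>r. codiff_letter L (Gam (r - i) y') (\<lambda>v. \<phi> (Gam i y # v)) w)"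
    proof -
      have Q': "\<phi> (Gam i y # Ang (sqr L y') # Gam j y' # w) = A (Ang (sqr L y')) i j" for i j
        by (simp add: A_def H.Ang_Gam)
      show ?thesis
        unfolding codiff_letter_Gam sum_subtractf G Q' A_def[symmetric]
          sum_shift_left[where A = "A g" for g]
          sum_shift_right[where A = "A (Ang (sqr L y'))"]
          sum_shift_right[where A = "\<lambda>i j. A (Env (0, y')) i j + (if i < 1 then 0 else A (Ang ?b) (i - 1) j)"]
        by simp
    qed
    finally show "codiff L \<phi> (Gam r (y + y') # w) =
      (\<Sum>i\<le>r. codiff L \<phi> (Gam i y # Gam (r - i) y' # w))"
      by (simp add: H.Gam_add codiff_sum sum.distrib)
  next
    fix r y s w
    let ?E = "Env (0, y)" and ?Q = "Ang (sqr L y)"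
    define e q where "e = (\<lambda>i. \<phi> (?E # Gam i y # w))" and "q = (\<lambda>i. \<phi> (?Q # Gam i y # w))"
    have "codiff_letter L (Gam r y) \<phi> (Gam s y # w) + codiff_letter L (Gam s y) (\<lambda>v. \<phi> (Gam r y # v)) w =
      (if r < 1 then 0 else of_nat ((r + s - 1) choose (r - 1)) * e (r + s - 1))
      + (if s < 1 then 0 else of_nat ((r + s - 1) choose r) * e (r + s - 1))
      - ((if r < 2 then 0 else of_nat ((r + s - 2) choose (r - 2)) * q (r + s - 2))
      + (if s < 2 then 0 else of_nat ((r + s - 2) choose r) * q (r + s - 2)))"
    proof -
      have "\<phi> (?E # Gam (r - 1) y # Gam s y # w) =
          of_nat ((r + s - 1) choose (r - 1)) * e (r + s - 1)" if "\<not> r < 1"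
        using that by (cases r) (simp_all add: H1.Gam_Gam e_def)
      moreover have "\<phi> (?E # Gam r y # Gam (s - 1) y # w) =
          of_nat ((r + s - 1) choose r) * e (r + s - 1)" if "\<not> s < 1"
        using that by (cases s) (simp_all add: H1.Gam_Gam e_def)
      moreover have "\<phi> (?Q # Gam (r - 2) y # Gam s y # w) =
          of_nat ((r + s - 2) choose (r - 2)) * q (r + s - 2)" if "\<not> r < 2"
        using that by (cases r; cases "r - 1") (simp_all add: H1.Gam_Gam q_def)
      moreover have "\<phi> (?Q # Gam r y # Gam (s - 2) y # w) =
          of_nat ((r + s - 2) choose r) * q (r + s - 2)" if "\<not> s < 2"
        using that by (cases s; cases "s - 1") (simp_all add: H1.Gam_Gam q_def)
      ultimately show ?thesis
        by (cases r; cases "r - 1"; cases s; cases "s - 1")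
          (simp_all add: codiff_letter_Gam past brk_odd_self null H.Ang_Gam[symmetric] binomial_eq_0)
    qed
    also have "\<dots> = of_nat ((if r < 1 then 0 else (r + s - 1) choose (r - 1))
        + (if s < 1 then 0 else (r + s - 1) choose r)) * e (r + s - 1)
      - of_nat ((if r < 2 then 0 else (r + s - 2) choose (r - 2))
        + (if s < 2 then 0 else (r + s - 2) choose r)) * q (r + s - 2)"
      by (simp add: algebra_simps)
    also have "\<dots> = of_nat ((r + s) choose r) * codiff_letter L (Gam (r + s) y) \<phi> w"
    proof -
      have two: "of_nat (2 * m) = (0 :: 'k)" for m
        using double_scalar[of 1] by (simp add: numeral_2_eq_2)
      consider "r + s = 0" | "r + s = 1" | "2 \<le> r + s" by linarith
      then show ?thesis
      proof cases
        case 3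
        then obtain m where m: "(r + s) choose r = (if r < 2 then 0 else (r + s - 2) choose (r - 2))
           + (if s < 2 then 0 else (r + s - 2) choose r) + 2 * m"
          using binomial_shift_two by blast
        have "of_nat ((r + s) choose r) = (of_nat ((if r < 2 then 0 else (r + s - 2) choose (r - 2))
           + (if s < 2 then 0 else (r + s - 2) choose r)) :: 'k)"
          unfolding m of_nat_add[of _ "2 * m"] two by simp
        moreover have "(if r < 1 then 0 else (r + s - 1) choose (r - 1))
          + (if s < 1 then 0 else (r + s - 1) choose r) = (r + s) choose r"
          using 3 by (intro binomial_shift_one) simp
        moreover have "codiff_letter L (Gam (r + s) y) \<phi> w = e (r + s - 1) - q (r + s - 2)"
          using 3 by (auto simp: codiff_letter_Gam e_def q_def)
        ultimately show ?thesis by (simp only: right_diff_distrib)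
      next
        case 2
        then have "r = 0 \<and> s = 1 \<or> r = 1 \<and> s = 0" by linarith
        then show ?thesis by (auto simp: codiff_letter_Gam e_def)
      qed (simp add: codiff_letter_Gam)
    qed
    finally show "codiff L \<phi> (Gam r y # Gam s y # w) =
      of_nat ((r + s) choose r) * codiff L \<phi> (Gam (r + s) y # w)"
      by (simp add: H.Gam_Gam codiff_scale algebra_simps)
  next
    fix r y s y' w
    let ?b = "fst (brk L (0, y) (0, y'))"
    have b: "fst (brk L (0, y') (0, y)) = ?b" by (simp add: brk_sym)
    have move: "\<phi> (Gam i y # Ang x # Gam j y' # w) = \<phi> (Gam j y' # Ang x # Gam i y # w)" for i j x
      by (simp add: H.Ang_Gam[symmetric] H1.Gam_commute[of _ i y])
    have "codiff_letter L (Gam r y) \<phi> (Gam s y' # w) + codiff_letter L (Gam s y') (\<lambda>v. \<phi> (Gam r y # v)) w =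
      codiff_letter L (Gam s y') \<phi> (Gam r y # w) + codiff_letter L (Gam r y) (\<lambda>v. \<phi> (Gam s y' # v)) w"
      by (simp add: codiff_letter_Gam past brk_odd_odd null b H.Ang_Gam[symmetric] H1.Gam_commute[of _ _ y _ y']
          move char2_simps add_ac)
    then show "codiff L \<phi> (Gam r y # Gam s y' # w) = codiff L \<phi> (Gam s y' # Gam r y # w)"
      by (simp add: H.Gam_commute[of r y s y'] flip: add.assoc)
  next
    fix x r y w
    have b: "brk L (x, 0) (0, y) = brk L (0, y) (x, 0)" by (rule brk_sym)
    have swap: "\<phi> (Ang x # Gam i y # Ang x' # w) = \<phi> (Ang x' # Gam i y # Ang x # w)" for i x'
      by (simp add: H1.Ang_Gam[symmetric] Ang_Ang[of x])
    have "codiff_letter L (Ang x) \<phi> (Gam r y # w) + codiff_letter L (Gam r y) (\<lambda>v. \<phi> (Ang x # v)) w =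
      codiff_letter L (Gam r y) \<phi> (Ang x # w) + codiff_letter L (Ang x) (\<lambda>v. \<phi> (Gam r y # v)) w"
      by (simp add: codiff_letter_Gam past brk_odd_even null b H.Ang_Env H1.Ang_Gam swap[of _ "sqr L y"]
          H.Gam_commute[of _ y "Suc 0"] char2_simps add_ac)
    then show "codiff L \<phi> (Ang x # Gam r y # w) = codiff L \<phi> (Gam r y # Ang x # w)"
      by (simp add: H.Ang_Gam flip: add.assoc)
  next
    fix x u w
    let ?b = "brk L (x, 0) u"
    have "\<phi> (Env (fst ?b, 0) # w) + \<phi> (Env (0, snd ?b) # Gam 0 (snd ?b) # w) = \<phi> (Env ?b # w)"
      using Env_split[OF H.head_rels_axioms] by (simp add: H1.Gam_zero)
    then show "codiff L \<phi> (Ang x # Env u # w) = codiff L \<phi> (Env u # Ang x # w)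
      + codiff L \<phi> (Ang (fst ?b) # w) + codiff L \<phi> (Gam 1 (snd ?b) # w)"
      by (simp add: H.Ang_Env H.Env_Env[of "(x, 0)" u] codiff_add algebra_simps)
  next
    fix r y u w
    let ?b = "brk L (0, y) u"
    let ?c = "brk L (0, y) ?b"
    \<comment> \<open>The bracket \<open>c\<close> arises twice, from moving \<open>[y, u]\<close> past a divided power of \<open>y\<close> and from moving \<open>u\<close>
      past \<open>\<langle>q(y)\<rangle>\<close>, and so cancels.\<close>
    have c: "brk L (sqr L y, 0) u = ?c" by (simp add: brk_sqr)
    have "\<phi> (Gam r y # Env (fst ?b, 0) # w) + \<phi> (Gam r y # Env (0, snd ?b) # Gam 0 (snd ?b) # w)
      = \<phi> (Env ?b # Gam r y # w) + (if r < 1 then 0 else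
          \<phi> (Gam (r - 1) y # Ang (fst ?c) # w) + \<phi> (Gam (r - 1) y # Gam 1 (snd ?c) # w))"
    proof -
      have "\<phi> (Gam r y # Env (0, snd ?b) # Gam 0 (snd ?b) # w) = \<phi> (Gam r y # Env (0, snd ?b) # w)"
        using head_rels.Gam_zero[OF H2] .
      then have "\<phi> (Gam r y # Env (fst ?b, 0) # w) + \<phi> (Gam r y # Env (0, snd ?b) # Gam 0 (snd ?b) # w)
        = \<phi> (Gam r y # Env ?b # w)"
        using Env_split[OF H1.head_rels_axioms] by simp
      then show ?thesis unfolding past .
    qed
    moreover have "\<phi> (Env (0, y) # Gam r y # Env u # w) = \<phi> (Env u # Env (0, y) # Gam r y # w)
        + \<phi> (Env ?b # Gam r y # w)
        + (if r < 1 then 0 else \<phi> (Env (0, y) # Gam (r - 1) y # Ang (fst ?b) # w)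
            + \<phi> (Env (0, y) # Gam (r - 1) y # Gam 1 (snd ?b) # w))"
      by (simp add: H1.Gam_past_Env[OF H2] H.Env_Env[of "(0, y)" u])
    moreover have "\<phi> (Ang (sqr L y) # Gam i y # Env u # w) = \<phi> (Env u # Ang (sqr L y) # Gam i y # w)
        + \<phi> (Gam i y # Ang (fst ?c) # w) + \<phi> (Gam i y # Gam 1 (snd ?c) # w)
        + (if i < 1 then 0 else \<phi> (Ang (sqr L y) # Gam (i - 1) y # Ang (fst ?b) # w)
            + \<phi> (Ang (sqr L y) # Gam (i - 1) y # Gam 1 (snd ?b) # w))" for i
      by (simp add: H1.Gam_past_Env[OF H2] H.Ang_Env c H.Ang_Gam H.Gam_commute[of 1 "snd ?c"] del: One_nat_def)
    ultimately have "codiff_letter L (Gam (Suc r) y) \<phi> (Env u # w) = codiff_letter L (Gam (Suc r) y) (\<lambda>v. \<phi> (Env u # v)) w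
      + (codiff_letter L (Gam r y) \<phi> (Ang (fst ?b) # w) + codiff_letter L (Ang (fst ?b)) (\<lambda>v. \<phi> (Gam r y # v)) w)
      + (codiff_letter L (Gam r y) \<phi> (Gam 1 (snd ?b) # w) + codiff_letter L (Gam 1 (snd ?b)) (\<lambda>v. \<phi> (Gam r y # v)) w)"
      by (cases r; cases "r - 1") (simp_all add: codiff_letter_Gam char2_simps add_ac)
    then show "codiff L \<phi> (Gam (Suc r) y # Env u # w) = codiff L \<phi> (Env u # Gam (Suc r) y # w)
      + codiff L \<phi> (Gam r y # Ang (fst ?b) # w) + codiff L \<phi> (Gam r y # Gam 1 (snd ?b) # w)"
      by (simp add: H.Gam_Env codiff_add algebra_simps)
  qed
qed

lemma codiff_letter_fun:
  "codiff_letter L (Env u) \<phi> = (\<lambda>v. 0)"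
  "codiff_letter L (Ang x) \<phi> = (\<lambda>v. \<phi> (Env (x, 0) # v))"
  "codiff_letter L (Gam 0 y) \<phi> = (\<lambda>v. 0)"
  "codiff_letter L (Gam (Suc 0) y) \<phi> = (\<lambda>v. \<phi> (Env (0, y) # Gam 0 y # v))"
  "codiff_letter L (Gam (Suc (Suc r)) y) \<phi> =
     (\<lambda>v. \<phi> (Env (0, y) # Gam (Suc r) y # v) - \<phi> (Ang (sqr L y) # Gam r y # v))"
  by (simp_all add: fun_eq_iff)

lemma annihilates_codiff_letter: "annihilates L \<phi> \<Longrightarrow> annihilates L (codiff_letter L g \<phi>)"
  by (cases "(L, g, \<phi>, [] :: ('a, 'b) ygen list)" rule: codiff_letter.cases)
    (simp_all add: codiff_letter_fun annihilates_zero annihilates_diff annihilates_Cons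
      annihilates_Cons[OF annihilates_Cons])

lemma annihilates_codiff:
  assumes "annihilates L \<phi>"
  shows "annihilates L (codiff L \<phi>)"
  unfolding annihilates_def
proof
  fix a
  show "head_rels L (\<lambda>w. codiff L \<phi> (a @ w))"
    using assms
  proof (induction a arbitrary: \<phi>)
    case (Cons g a)
    have "head_rels L (\<lambda>w. codiff_letter L g \<phi> (a @ w))"
      using annihilates_codiff_letter[OF Cons.prems, of g] by (simp add: annihilates_def)
    then show ?case
      using Cons by (auto intro!: head_rels_add annihilates_Cons)
  qed (simp add: head_rels_codiff)
qed

text \<open>
  In characteristic 2 the square of the derivation \<open>d\<close> is again a derivation, so only generators
  matter. On \<open>\<gamma>\<^sub>r(y)\<close> it vanishes by \<open>y y = q(y)\<close>, \<open>\<langle>q(y)\<rangle>\<^sup>2 = 0\<close> and \<open>[q(y), y] = 0\<close>.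
\<close>

lemma codiff_codiff:
  assumes "annihilates L \<phi>"
  shows "codiff L (codiff L \<phi>) w = 0"
  using assms
proof (induction w arbitrary: \<phi>)
  case (Cons g w)
  interpret head_rels L \<phi> using Cons.prems by (rule annihilates_head)
  have "codiff L (codiff L (\<lambda>v. \<phi> (g # v))) w = 0"
    by (intro Cons.IH annihilates_Cons Cons.prems)
  moreover have "codiff_letter L g (codiff L \<phi>) w + codiff L (codiff_letter L g \<phi>) w = 0"
  proof (cases g)
    case (Gam r y)
    consider "r = 0" | "r = 1" | s where "r = Suc (Suc s)" by (cases r; cases "r - 1") auto
    then show ?thesis
    proof cases
      case (3 s)
      have c: "brk L (sqr L y, 0) (0, y) = 0" by (simp flip: brk_sqr add: brk_odd_triple)
      have Q_E: "\<phi> (Ang (sqr L y) # Env (0, y) # v) = \<phi> (Env (0, y) # Ang (sqr L y) # v)" for v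
        by (simp add: Ang_Env c Ang_null[OF head_rels_axioms] Gam_null[OF head_rels_axioms])
      show ?thesis
        by (simp add: Gam 3 codiff_letter_fun codiff_add codiff_diff codiff_letter_Gam Env_sqr Ang_Ang Q_E minus_scalar double_scalar
            double_scalar' add_ac)
    qed (simp_all add: Gam codiff_letter_fun double_scalar)
  qed (simp_all add: codiff_letter_fun double_scalar)
  ultimately show ?case by (simp add: codiff_add)
qed simp

end

section \<open>Cochains as functions on words\<close>

text \<open>
  The second condition says that \<open>U(L)\<close> acts through the counit: it is generated by \<open>L\<close>, on
  which the counit is zero.
\<close>

definition word_cochain :: "('k :: field, 'a :: ab_group_add, 'b :: ab_group_add) super_data \<Rightarrow>
    (('a, 'b) ygen list \<Rightarrow> 'k) \<Rightarrow> bool" where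
  "word_cochain L \<phi> \<longleftrightarrow> annihilates L \<phi> \<and> (\<forall>u w. \<phi> (Env u # w) = 0)"

lemma word_cochain_add:
  "word_cochain L \<phi> \<Longrightarrow> word_cochain L \<psi> \<Longrightarrow> word_cochain L (\<lambda>w. \<phi> w + \<psi> w)"
  by (simp add: word_cochain_def annihilates_add)

lemma word_cochain_scale: "word_cochain L \<phi> \<Longrightarrow> word_cochain L (\<lambda>w. c * \<phi> w)"
  by (simp add: word_cochain_def annihilates_scale)

lemma word_cochain_zero: "word_cochain L (\<lambda>w. 0)"
  by (simp add: word_cochain_def annihilates_zero)

lemma word_cochain_sum:
  "(\<And>i. i \<in> A \<Longrightarrow> word_cochain L (\<phi> i)) \<Longrightarrow> word_cochain L (\<lambda>w. \<Sum>i\<in>A. \<phi> i w)"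
  by (induction A rule: infinite_finite_induct) (auto intro: word_cochain_zero word_cochain_add)

definition counit_word :: "('a, 'b) ygen list \<Rightarrow> 'k :: field" where
  "counit_word w = prod_list (map counit_gen w)"

lemma counit_word_simps [simp]:
  "counit_word [] = 1" "counit_word (g # w) = counit_gen g * counit_word w"
  by (simp_all add: counit_word_def)

lemma counit_word_append: "counit_word (a @ w) = counit_word a * counit_word w"
  by (simp add: counit_word_def)

lemma word_cochain_counit: "word_cochain L counit_word"
proof -
  have "head_rels L counit_word"
  proof
    fix r y y' w
    show "counit_word (Gam r (y + y') # w) = (\<Sum>i\<le>r. counit_word (Gam i y # Gam (r - i) y' # w))"
      by (cases "r = 0") (auto intro!: sum.neutral)
  qed auto
  then have "annihilates L counit_word"
    by (simp add: annihilates_def counit_word_append head_rels_scale)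
  then show ?thesis by (simp add: word_cochain_def)
qed

lemma conv_counit_right [simp]: "conv \<phi> counit_word w = \<phi> w"
proof (induction w arbitrary: \<phi>)
  case (Cons g w)
  show ?case
  proof (cases g)
    case (Gam r y)
    have "conv \<phi> counit_word (g # w) = (\<Sum>i\<le>r. if i = r then \<phi> (g # w) else 0)"
      unfolding Gam conv.simps by (rule sum.cong) (auto simp: conv_scale_right Cons.IH)
    also have "\<dots> = \<phi> (g # w)" by simp
    finally show ?thesis .
  qed (simp_all add: conv_scale_right Cons.IH)
qed simp

text \<open>
  The involution \<open>i \<mapsto> r - i\<close> pairs off all terms but the middle one.
\<close>

lemma sum_symmetric_char2:
  fixes T :: "nat \<Rightarrow> 'k :: field"
  assumes "CHAR('k) = 2" and sym: "\<And>i. i \<le> r \<Longrightarrow> T (r - i) = T i"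
  shows "(\<Sum>i\<le>r. T i) = (if even r then T (r div 2) else 0)"
proof -
  let ?A = "{i. i \<le> r \<and> i < r - i}" and ?B = "{i. i \<le> r \<and> r - i < i}" and ?C = "{i. i \<le> r \<and> i = r - i}"
  have split: "{..r} = ?A \<union> ?B \<union> ?C" by auto
  have "(\<Sum>i\<le>r. T i) = sum T ?A + sum T ?B + sum T ?C"
    unfolding split by (subst sum.union_disjoint; auto)+
  also have "sum T ?B = sum T ?A"
    by (rule sum.reindex_bij_witness[where i = "\<lambda>i. r - i" and j = "\<lambda>i. r - i"]) (auto simp: sym)
  also have "?C = (if even r then {r div 2} else {})"
  proof -
    have "i \<le> r \<and> i = r - i \<longleftrightarrow> even r \<and> i = r div 2" for i by presburger
    then show ?thesis by auto
  qed
  finally show ?thesis by (simp add: char2_double[OF assms(1)])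
qed

text \<open>
  The swap of the two tensor factors fixes only the middle term of the coproduct of a divided power;
  the other terms cancel in pairs by commutativity.
\<close>

lemma conv_square_Gam:
  assumes "CHAR('k :: field) = 2"
  shows "conv \<phi> \<phi> (Gam r y # w) = (if even r then
    conv (\<lambda>v. \<phi> (Gam (r div 2) y # v)) (\<lambda>v. \<phi> (Gam (r div 2) y # v)) w else (0 :: 'k))"
proof -
  have "conv \<phi> \<phi> (Gam r y # w) = (if even r then
    conv (\<lambda>v. \<phi> (Gam (r div 2) y # v)) (\<lambda>v. \<phi> (Gam (r - r div 2) y # v)) w else 0)"
    unfolding conv.simps by (rule sum_symmetric_char2[OF assms]) (simp add: conv_comm)
  moreover have "even r \<Longrightarrow> r - r div 2 = r div 2" by (auto elim!: evenE)
  ultimately show ?thesis by (cases "even r") simp_all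
qed

text \<open>
  A letter other than a divided power is primitive. Its coproduct has no term that is fixed by the
  swap, so squares vanish on all words that contain such a letter.
\<close>

lemma conv_square_cong:
  assumes "CHAR('k :: field) = 2"
    and "\<And>w. set w \<subseteq> {Gam r y | r y. True} \<Longrightarrow> \<phi> w = (\<psi> w :: 'k)"
  shows "conv \<phi> \<phi> w = conv \<psi> \<psi> w"
  using assms(2)
proof (induction w arbitrary: \<phi> \<psi>)
  case Nil
  then show ?case by simp
next
  case (Cons g w)
  show ?case
  proof (cases g)
    case (Gam r y)
    have "conv (\<lambda>v. \<phi> (Gam s y # v)) (\<lambda>v. \<phi> (Gam s y # v)) w
      = conv (\<lambda>v. \<psi> (Gam s y # v)) (\<lambda>v. \<psi> (Gam s y # v)) w" for s
      by (rule Cons.IH) (auto intro!: Cons.prems)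
    then show ?thesis by (simp only: Gam conv_square_Gam[OF assms(1)])
  qed (simp_all add: char2_double[OF assms(1)] conv_comm[of _ "\<lambda>v. _ (_ # v)"])
qed

section \<open>Cochains of degree one\<close>

text \<open>
  The value of the linear form \<open>l\<close> on \<open>v.w\<close>, for the right action of words on the degree 1 part
  \<open>L\<close> of the coinvariants \<open>k \<otimes>\<^bsub>U(L)\<^esub> Y(L)\<close>, truncated above degree 1.
\<close>

fun coinv_act :: "('k :: field, 'a :: ab_group_add, 'b :: ab_group_add) super_data \<Rightarrow>
    ('a \<times> 'b \<Rightarrow> 'k) \<Rightarrow> 'a \<times> 'b \<Rightarrow> ('a, 'b) ygen list \<Rightarrow> 'k" where
  "coinv_act L l v [] = l v"
| "coinv_act L l v (Env u # w) = coinv_act L l (brk L v u) w"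
| "coinv_act L l v (Ang x # w) = 0"
| "coinv_act L l v (Gam r y # w) = (if r = 0 then coinv_act L l v w else 0)"

text \<open>
  The value of \<open>l\<close> on the degree 1 component of \<open>1.w\<close>, for the right action on the truncated
  coinvariants \<open>k \<oplus> L\<close>. The letters from \<open>U(L)\<close> kill \<open>1\<close>, and those of degree 1 move it into \<open>L\<close>.
\<close>

fun degree_one :: "('k :: field, 'a :: ab_group_add, 'b :: ab_group_add) super_data \<Rightarrow>
    ('a \<times> 'b \<Rightarrow> 'k) \<Rightarrow> ('a, 'b) ygen list \<Rightarrow> 'k" where
  "degree_one L l [] = 0"
| "degree_one L l (Env u # w) = 0"
| "degree_one L l (Ang x # w) = coinv_act L l (x, 0) w"
| "degree_one L l (Gam r y # w) =
     (if r = 0 then degree_one L l w else if r = 1 then coinv_act L l (0, y) w else 0)"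

lemma coinv_act_nonzeroD: "coinv_act L l v w \<noteq> 0 \<Longrightarrow> ydeg w = 0"
  by (induction L l v w rule: coinv_act.induct) (auto simp: ydeg_def split: if_splits)

lemma degree_one_nonzeroD: "degree_one L l w \<noteq> 0 \<Longrightarrow> ydeg w = 1"
  by (induction L l w rule: degree_one.induct)
    (auto simp: ydeg_def split: if_splits dest!: coinv_act_nonzeroD)

context lie_superalgebra_char2
begin

interpretation even: vector_space "escale L" by (rule vector_space_even)
interpretation odd: vector_space "oscale L" by (rule vector_space_odd)

definition linear_form :: "('a \<times> 'b \<Rightarrow> 'k) \<Rightarrow> bool" where
  "linear_form l \<longleftrightarrow> (\<forall>u v. l (u + v) = l u + l v) \<and> (\<forall>c u. l (lscale L c u) = c * l u)"

lemma coinv_act_add: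
  "linear_form l \<Longrightarrow> coinv_act L l (u + v) w = coinv_act L l u w + coinv_act L l v w"
proof (induction w arbitrary: u v)
  case (Cons g w)
  then show ?case by (cases g) (simp_all add: brk_add_left)
qed (simp add: linear_form_def del: split_paired_All)

lemma coinv_act_scale:
  "linear_form l \<Longrightarrow> coinv_act L l (lscale L c v) w = c * coinv_act L l v w"
proof (induction w arbitrary: v)
  case (Cons g w)
  then show ?case by (cases g) (simp_all add: brk_scale_left)
qed (simp add: linear_form_def del: split_paired_All)

text \<open>
  The adjoint action satisfies the relations of \<open>U(L)\<close>: the commutator relation is the Jacobi
  identity, and the square relation is the axiom \<open>[y, [y, v]] = [q(y), v]\<close>.
\<close>

lemma head_rels_coinv_act:
  assumes l: "linear_form l"
  shows "head_rels L (coinv_act L l v)"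
proof
  fix u u' w
  have "coinv_act L l (brk L v (brk L u u')) w =
    coinv_act L l (brk L (brk L v u) u') w + coinv_act L l (brk L (brk L v u') u) w"
    using brk_sym[of u "brk L v u'"] by (simp only: jacobi[of v] coinv_act_add[OF l])
  then show "coinv_act L l v (Env u # Env u' # w) =
    coinv_act L l v (Env u' # Env u # w) + coinv_act L l v (Env (brk L u u') # w)"
    by (simp add: double_scalar' add.commute)
next
  fix y w
  show "coinv_act L l v (Env (0, y) # Env (0, y) # w) = coinv_act L l v (Env (sqr L y, 0) # w)"
    by (simp add: brk_sym[of _ "(0, y)"] brk_sqr brk_sym[of v])
next
  fix r y y' w
  show "coinv_act L l v (Gam r (y + y') # w) = (\<Sum>i\<le>r. coinv_act L l v (Gam i y # Gam (r - i) y' # w))"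
    by (cases r) (auto intro!: sum.neutral[symmetric])
qed (auto simp: brk_add_right brk_scale_right coinv_act_add[OF l] coinv_act_scale[OF l])

lemma annihilates_coinv_act:
  assumes l: "linear_form l"
  shows "annihilates L (coinv_act L l v)"
  unfolding annihilates_def
proof
  fix a
  show "head_rels L (\<lambda>w. coinv_act L l v (a @ w))"
  proof (induction a arbitrary: v)
    case (Cons g a)
    show ?case
    proof (cases g)
      case (Gam r y)
      then show ?thesis by (cases "r = 0") (simp_all add: head_rels_zero Cons.IH)
    qed (simp_all add: head_rels_zero Cons.IH)
  qed (simp add: head_rels_coinv_act[OF l])
qed

lemma head_rels_degree_one:
  assumes l: "linear_form l"
  shows "head_rels L (degree_one L l)"
proof
  fix r y y' w
  show "degree_one L l (Gam r (y + y') # w) = (\<Sum>i\<le>r. degree_one L l (Gam i y # Gam (r - i) y' # w))"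
  proof (cases "r \<le> 1")
    case True
    then have "r = 0 \<or> r = 1" by linarith
    then show ?thesis using coinv_act_add[OF l, of "(0, y)" "(0, y')" w] by (auto simp: add.commute)
  next
    case False
    then have "degree_one L l (Gam i y # Gam (r - i) y' # w) = 0" if "i \<le> r" for i
      using that by auto
    then show ?thesis using False by simp
  qed
next
  fix x x' w
  show "degree_one L l (Ang (x + x') # w) = degree_one L l (Ang x # w) + degree_one L l (Ang x' # w)"
    using coinv_act_add[OF l, of "(x, 0)" "(x', 0)" w] by simp
next
  fix c x w
  show "degree_one L l (Ang (escale L c x) # w) = c * degree_one L l (Ang x # w)"
    using coinv_act_scale[OF l, of c "(x, 0)" w] by (simp add: lscale_def)
next
  fix r c y w
  show "degree_one L l (Gam r (oscale L c y) # w) = c ^ r * degree_one L l (Gam r y # w)"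
    using coinv_act_scale[OF l, of c "(0, y)" w] by (simp add: lscale_def)
next
  fix x u w
  show "degree_one L l (Ang x # Env u # w) = degree_one L l (Env u # Ang x # w)
      + degree_one L l (Ang (fst (brk L (x, 0) u)) # w)
      + degree_one L l (Gam 1 (snd (brk L (x, 0) u)) # w)"
    by (simp flip: coinv_act_add[OF l])
next
  fix r y u w
  show "degree_one L l (Gam (Suc r) y # Env u # w) = degree_one L l (Env u # Gam (Suc r) y # w)
      + degree_one L l (Gam r y # Ang (fst (brk L (0, y) u)) # w)
      + degree_one L l (Gam r y # Gam 1 (snd (brk L (0, y) u)) # w)"
    by (simp flip: coinv_act_add[OF l])
qed auto

text \<open>
  Prefixing a letter to one of the functions \<open>degree_one\<close> and \<open>coinv_act\<close> gives a function of the same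
  kind or zero, so that the relations need to be checked for the empty prefix only.
\<close>

lemma word_cochain_degree_one:
  assumes l: "linear_form l"
  shows "word_cochain L (degree_one L l)"
proof -
  have "head_rels L (\<lambda>w. degree_one L l (a @ w))" for a
  proof (induction a)
    case (Cons g a)
    have act: "head_rels L (\<lambda>w. coinv_act L l v (a @ w))" for v
      using annihilates_coinv_act[OF l] by (simp add: annihilates_def)
    show ?case
    proof (cases g)
      case (Gam r y)
      then show ?thesis
        by (cases "r = 0"; cases "r = 1") (simp_all add: head_rels_zero Cons.IH act)
    qed (simp_all add: head_rels_zero act)
  qed (simp add: head_rels_degree_one[OF l])
  then show ?thesis by (simp add: word_cochain_def annihilates_def)
qed

text \<open>
  Modulo the relations, a word of degree 1 can be rewritten by moving its letters from \<open>U(L)\<close> to the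
  left past the only letter of degree 1. There the cochain kills them, and what remains is the action
  of the word on that letter.
\<close>

lemma degree_one_unique:
  assumes coch: "word_cochain L \<phi>" and homog: "\<And>w. \<phi> w \<noteq> 0 \<Longrightarrow> ydeg w = 1"
  defines "l \<equiv> \<lambda>v. \<phi> [Ang (fst v)] + \<phi> [Gam 1 (snd v)]"
  shows "\<phi> w = degree_one L l w"
proof -
  have resp: "annihilates L \<phi>" and Env: "\<phi> (Env u # w) = 0" for u w
    using coch by (simp_all add: word_cochain_def del: split_paired_All)
  interpret H: head_rels L \<phi> using resp by (intro annihilates_head)
  interpret H1: head_rels L "\<lambda>w. \<phi> (g # w)" for g
    using resp by (intro annihilates_head annihilates_Cons)
  have big: "\<phi> w = 0" if "ydeg w \<noteq> 1" for w using homog that by blast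
  have l: "linear_form l"
    unfolding linear_form_def l_def
    by (auto simp: H.Ang_add H.Gam_add H.Gam_zero H1.Gam_zero lscale_def H.Ang_scale H.Gam_scale algebra_simps)
  have act: "\<phi> (Ang (fst v) # w) + \<phi> (Gam 1 (snd v) # w) = coinv_act L l v w" for v w
  proof (induction w arbitrary: v)
    case (Cons g w)
    show ?case
    proof (cases g)
      case (Env u)
      have "brk L v u = brk L (fst v, 0) u + brk L (0, snd v) u"
        by (simp flip: brk_add_left)
      then have "coinv_act L l v (g # w) = coinv_act L l (brk L (fst v, 0) u) w
        + coinv_act L l (brk L (0, snd v) u) w"
        by (simp add: Env coinv_act_add[OF l])
      then show ?thesis
        using Cons.IH[of "brk L (fst v, 0) u"] Cons.IH[of "brk L (0, snd v) u"]
        by (simp add: Env H.Ang_Env H.Gam_Env H.Gam_zero \<open>\<And>u w. \<phi> (Env u # w) = 0\<close>)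
    next
      case (Ang x)
      then show ?thesis by (simp add: big ydeg_def)
    next
      case (Gam r y)
      then show ?thesis using Cons.IH[of v]
        by (cases "r = 0") (simp_all add: H1.Gam_zero big ydeg_def)
    qed
  qed (simp add: l_def)
  show ?thesis
  proof (induction w)
    case Nil
    then show ?case by (simp add: big ydeg_def)
  next
    case (Cons g w)
    show ?case
    proof (cases g)
      case (Env u)
      then show ?thesis by (simp add: \<open>\<And>u w. \<phi> (Env u # w) = 0\<close>)
    next
      case (Ang x)
      then show ?thesis using act[of "(x, 0)" w] by (simp add: Gam_null[OF H.head_rels_axioms])
    next
      case (Gam r y)
      consider "r = 0" | "r = 1" | "2 \<le> r" by linarith
      then show ?thesis
        using Cons.IH act[of "(0, y)" w]
        by cases (auto simp: Gam H.Gam_zero Ang_null[OF H.head_rels_axioms] big ydeg_def)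
    qed
  qed
qed

lemma word_cochain_conv: "word_cochain L \<phi> \<Longrightarrow> word_cochain L \<psi> \<Longrightarrow> word_cochain L (conv \<phi> \<psi>)"
  by (simp add: word_cochain_def annihilates_conv[OF char2])

lemma word_cochain_codiff: "word_cochain L \<phi> \<Longrightarrow> word_cochain L (codiff L \<phi>)"
  by (simp add: word_cochain_def annihilates_codiff)

end

section \<open>Translation to the cochain algebra\<close>

definition koszul_rels :: "('k :: field, 'a :: ab_group_add, 'b :: ab_group_add) super_data \<Rightarrow>
    (('a, 'b) ygen list \<Rightarrow>\<^sub>0 'k) set" where
  "koszul_rels L = env_rels L \<union> ext_rels L \<union> dp_rels L \<union> smash_rels L"

lemma koszul_rel_mem:
  "gen (Env (u + v)) - gen (Env u) - gen (Env v) \<in> koszul_rels L"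
  "gen (Env (lscale L c u)) - scalar c * gen (Env u) \<in> koszul_rels L"
  "gen (Env u) * gen (Env v) - gen (Env v) * gen (Env u) - gen (Env (brk L u v)) \<in> koszul_rels L"
  "gen (Env (0, y)) * gen (Env (0, y)) - gen (Env (sqr L y, 0)) \<in> koszul_rels L"
  "gen (Ang (x + x')) - gen (Ang x) - gen (Ang x') \<in> koszul_rels L"
  "gen (Ang (escale L c x)) - scalar c * gen (Ang x) \<in> koszul_rels L"
  "gen (Ang x) * gen (Ang x) \<in> koszul_rels L"
  "gen (Gam 0 y) - 1 \<in> koszul_rels L"
  "gen (Gam r (oscale L c y)) - scalar (c ^ r) * gen (Gam r y) \<in> koszul_rels L"
  "gen (Gam r (y + y')) - (\<Sum>i\<le>r. gen (Gam i y) * gen (Gam (r - i) y')) \<in> koszul_rels L"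
  "gen (Gam r y) * gen (Gam s y) - scalar (of_nat ((r + s) choose r)) * gen (Gam (r + s) y)
     \<in> koszul_rels L"
  "gen (Gam r y) * gen (Gam s y') - gen (Gam s y') * gen (Gam r y) \<in> koszul_rels L"
  "gen (Ang x) * gen (Gam r y) - gen (Gam r y) * gen (Ang x) \<in> koszul_rels L"
  "gen (Ang x) * gen (Env u) - gen (Env u) * gen (Ang x) - ysusp (brk L (x, 0) u) \<in> koszul_rels L"
  "gen (Gam (Suc r) y) * gen (Env u) - gen (Env u) * gen (Gam (Suc r) y)
     - gen (Gam r y) * ysusp (brk L (0, y) u) \<in> koszul_rels L"
  by (unfold koszul_rels_def env_rels_def ext_rels_def dp_rels_def smash_rels_def, fast+)

lemma head_rels_iff:
  "head_rels L \<phi> \<longleftrightarrow> (\<forall>r\<in>koszul_rels L. \<forall>b. lin_ext (\<lambda>w. \<phi> (w @ b)) r = 0)"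
proof
  assume "head_rels L \<phi>"
  then interpret head_rels L \<phi> .
  show "\<forall>r\<in>koszul_rels L. \<forall>b. lin_ext (\<lambda>w. \<phi> (w @ b)) r = 0"
  proof (intro ballI allI)
    fix r b assume "r \<in> koszul_rels L"
    then show "lin_ext (\<lambda>w. \<phi> (w @ b)) r = 0"
      unfolding koszul_rels_def env_rels_def ext_rels_def dp_rels_def smash_rels_def
    proof (elim UnE CollectE exE conjE)
      fix u v assume "r = gen (Env u) * gen (Env v) - gen (Env v) * gen (Env u) - gen (Env (brk L u v))"
      then show ?thesis by (simp add: plus_list_def Env_Env[of u v])
    next
      fix n y m y' assume "r = gen (Gam n y) * gen (Gam m y') - gen (Gam m y') * gen (Gam n y)"
      then show ?thesis by (simp add: plus_list_def Gam_commute[of n y])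
    qed (simp_all add: plus_list_def zero_list_def ysusp_def Env_add Env_scale Env_sqr Ang_add
        Ang_scale Ang_Ang Gam_zero Gam_scale Gam_add Gam_Gam Ang_Gam Ang_Env Gam_Env)
  qed
next
  assume "\<forall>r\<in>koszul_rels L. \<forall>b. lin_ext (\<lambda>w. \<phi> (w @ b)) r = 0"
  then have rel: "lin_ext (\<lambda>w. \<phi> (w @ b)) r = 0" if "r \<in> koszul_rels L" for r b using that by blast
  note simps = plus_list_def zero_list_def ysusp_def
  show "head_rels L \<phi>"
  proof
    fix u v w
    show "\<phi> (Env (u + v) # w) = \<phi> (Env u # w) + \<phi> (Env v # w)"
      using rel[OF koszul_rel_mem(1)[where u = u and v = v], of w] by (simp add: simps algebra_simps)
    show "\<phi> (Env u # Env v # w) = \<phi> (Env v # Env u # w) + \<phi> (Env (brk L u v) # w)"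
      using rel[OF koszul_rel_mem(3)[where u = u and v = v], of w] by (simp add: simps algebra_simps)
  next
    fix c u w
    show "\<phi> (Env (lscale L c u) # w) = c * \<phi> (Env u # w)"
      using rel[OF koszul_rel_mem(2)[where c = c and u = u], of w] by (simp add: simps)
  next
    fix y w
    show "\<phi> (Env (0, y) # Env (0, y) # w) = \<phi> (Env (sqr L y, 0) # w)"
      using rel[OF koszul_rel_mem(4)[where y = y], of w] by (simp add: simps)
  next
    fix x x' w
    show "\<phi> (Ang (x + x') # w) = \<phi> (Ang x # w) + \<phi> (Ang x' # w)"
      using rel[OF koszul_rel_mem(5)[where x = x and x' = x'], of w] by (simp add: simps algebra_simps)
  next
    fix c x w
    show "\<phi> (Ang (escale L c x) # w) = c * \<phi> (Ang x # w)"
      using rel[OF koszul_rel_mem(6)[where c = c and x = x], of w] by (simp add: simps)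
  next
    fix x w
    show "\<phi> (Ang x # Ang x # w) = 0"
      using rel[OF koszul_rel_mem(7)[where x = x], of w] by (simp add: simps)
  next
    fix y w
    show "\<phi> (Gam 0 y # w) = \<phi> w"
      using rel[OF koszul_rel_mem(8)[where y = y], of w] by (simp add: simps)
  next
    fix r c y w
    show "\<phi> (Gam r (oscale L c y) # w) = c ^ r * \<phi> (Gam r y # w)"
      using rel[OF koszul_rel_mem(9)[where r = r and c = c and y = y], of w] by (simp add: simps)
  next
    fix r y y' w
    show "\<phi> (Gam r (y + y') # w) = (\<Sum>i\<le>r. \<phi> (Gam i y # Gam (r - i) y' # w))"
      using rel[OF koszul_rel_mem(10)[where r = r and y = y and y' = y'], of w] by (simp add: simps)
  next
    fix r y s w
    show "\<phi> (Gam r y # Gam s y # w) = of_nat ((r + s) choose r) * \<phi> (Gam (r + s) y # w)"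
      using rel[OF koszul_rel_mem(11)[where r = r and y = y and s = s], of w] by (simp add: simps)
  next
    fix r y s y' w
    show "\<phi> (Gam r y # Gam s y' # w) = \<phi> (Gam s y' # Gam r y # w)"
      using rel[OF koszul_rel_mem(12)[where r = r and y = y and s = s and y' = y'], of w] by (simp add: simps)
  next
    fix x r y w
    show "\<phi> (Ang x # Gam r y # w) = \<phi> (Gam r y # Ang x # w)"
      using rel[OF koszul_rel_mem(13)[where x = x and r = r and y = y], of w] by (simp add: simps)
  next
    fix x u w
    show "\<phi> (Ang x # Env u # w) = \<phi> (Env u # Ang x # w)
      + \<phi> (Ang (fst (brk L (x, 0) u)) # w) + \<phi> (Gam 1 (snd (brk L (x, 0) u)) # w)"
      using rel[OF koszul_rel_mem(14)[where x = x and u = u], of w] by (simp add: simps algebra_simps)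
  next
    fix r y u w
    show "\<phi> (Gam (Suc r) y # Env u # w) = \<phi> (Env u # Gam (Suc r) y # w)
      + \<phi> (Gam r y # Ang (fst (brk L (0, y) u)) # w)
      + \<phi> (Gam r y # Gam 1 (snd (brk L (0, y) u)) # w)"
      using rel[OF koszul_rel_mem(15)[where r = r and y = y and u = u], of w] by (simp add: simps algebra_simps)
  qed
qed

lemma annihilates_iff: "annihilates L \<phi> \<longleftrightarrow> (\<forall>P\<in>koszul_ideal L. lin_ext \<phi> P = 0)"
proof -
  have "koszul_rels L \<subseteq> carrier (free_algebra UNIV)" by simp
  from lin_ext_genideal_iff[OF this, of \<phi>] show ?thesis
    unfolding annihilates_def head_rels_iff koszul_ideal_def koszul_rels_def[symmetric] by auto
qed

lemma counit_eq_lin_ext: "counit = lin_ext counit_word"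
  by (rule ext) (simp add: counit_def free_hom_def lin_ext_def counit_word_def)

lemma cochain_lin_ext:
  fixes \<phi> :: "('a :: ab_group_add, 'b :: ab_group_add) ygen list \<Rightarrow> 'k :: field"
  shows "cochain L (lin_ext \<phi>) \<longleftrightarrow> word_cochain L \<phi>"
proof -
  have "(\<forall>a\<in>carrier (free_algebra (range Env)). \<forall>P. lin_ext \<phi> (a * P) = counit a * lin_ext \<phi> P) \<longleftrightarrow>
    (\<forall>u w. \<phi> (Env u # w) = 0)" (is "?lhs \<longleftrightarrow> ?rhs")
  proof
    assume lhs: ?lhs
    show ?rhs
    proof (intro allI)
      fix u w
      have "lin_ext \<phi> (gen (Env u) * mon w) = counit (gen (Env u)) * lin_ext \<phi> (mon w)"
        by (rule bspec[OF lhs mon_in_free_algebra, THEN spec]) simp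
      then show "\<phi> (Env u # w) = 0" by (simp add: counit_eq_lin_ext plus_list_def)
    qed
  next
    assume rhs: ?rhs
    show ?lhs
    proof (intro ballI allI)
      fix a P :: "('a, 'b) ygen list \<Rightarrow>\<^sub>0 'k"
      assume a: "a \<in> carrier (free_algebra (range Env))"
      have "lin_ext (\<lambda>v. \<phi> (w + v)) P = counit_word w * lin_ext \<phi> P" if "w \<in> Poly_Mapping.keys a" for w
      proof (cases w)
        case (Cons g w')
        then obtain u where "g = Env u" using a \<open>w \<in> Poly_Mapping.keys a\<close> by force
        then show ?thesis using rhs Cons by (simp add: plus_list_def del: split_paired_All)
      qed (simp add: plus_list_def)
      then show "lin_ext \<phi> (a * P) = counit a * lin_ext \<phi> P"
        by (simp add: lin_ext_mult counit_eq_lin_ext lin_ext_def[of counit_word] sum_distrib_right mult.assoc)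
    qed
  qed
  then show ?thesis
    by (simp add: cochain_def word_cochain_def annihilates_iff linear_iff_lin_ext)
qed

lemma cochain_iff: "cochain L f \<longleftrightarrow> (\<exists>\<phi>. word_cochain L \<phi> \<and> f = lin_ext \<phi>)"
proof
  assume f: "cochain L f"
  then have "f = lin_ext (\<lambda>w. f (mon w))" by (simp add: cochain_def linear_iff_lin_ext)
  with f show "\<exists>\<phi>. word_cochain L \<phi> \<and> f = lin_ext \<phi>" by (metis cochain_lin_ext)
qed (auto simp: cochain_lin_ext)

text \<open>
  The recursion for \<open>conv\<close> computes the coproduct, which is an algebra homomorphism.
\<close>

lemma lin_ext_prod_coprod:
  "lin_ext (\<lambda>t. \<phi> (fst t) * \<psi> (snd t)) (prod_list (map coprod_gen w)) = conv \<phi> \<psi> w"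
proof (induction w arbitrary: \<phi> \<psi>)
  case Nil
  then show ?case by (simp add: zero_list_def)
next
  case (Cons g w)
  have "lin_ext (\<lambda>t. \<phi> (p @ fst t) * \<psi> (q @ snd t)) (prod_list (map coprod_gen w)) =
    conv (\<lambda>v. \<phi> (p @ v)) (\<lambda>v. \<psi> (q @ v)) w" for p q
    by (rule Cons.IH)
  from this[of "[g]" "[]"] this[of "[]" "[g]"] this[of "[Gam _ _]" "[Gam _ _]"] show ?case
    by (cases g) (simp_all add: distrib_right sum_distrib_right plus_list_def)
qed

lemma cochain_mult_lin_ext: "cochain_mult (lin_ext \<phi>) (lin_ext \<psi>) = lin_ext (conv \<phi> \<psi>)"
proof
  fix P
  have "cochain_mult (lin_ext \<phi>) (lin_ext \<psi>) P = lin_ext (\<lambda>t. \<phi> (fst t) * \<psi> (snd t)) (coprod P)"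
    by (simp add: cochain_mult_def lin_ext_def[of _ "coprod P"])
  also have "\<dots> = (\<Sum>w\<in>Poly_Mapping.keys P. Poly_Mapping.lookup P w * conv \<phi> \<psi> w)"
    by (simp add: coprod_def free_hom_def lin_ext_prod_coprod)
  finally show "cochain_mult (lin_ext \<phi>) (lin_ext \<psi>) P = lin_ext (conv \<phi> \<psi>) P" by (simp add: lin_ext_def)
qed

lemma lin_ext_d_word: "lin_ext \<phi> (d_word L w) = codiff L \<phi> w"
proof (induction w arbitrary: \<phi>)
  case (Cons g w)
  have "lin_ext \<phi> (d_gen L g * mon w) = codiff_letter L g \<phi> w"
    by (cases "(L, g)" rule: d_gen.cases) (simp_all add: plus_list_def)
  then show ?case by (simp add: plus_list_def Cons.IH)
qed simp

lemma lin_ext_koszul_d: "lin_ext \<phi> \<circ> koszul_d L = lin_ext (codiff L \<phi>)"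
  by (rule ext) (simp add: koszul_d_def lin_ext_d_word lin_ext_def[of "codiff L \<phi>"])

lemma lin_ext_eq_iff: "lin_ext \<phi> = lin_ext \<psi> \<longleftrightarrow> \<phi> = \<psi>"
  by (metis lin_ext_mon)

definition bounded_cochain :: "('k :: field, 'a :: ab_group_add, 'b :: ab_group_add) super_data \<Rightarrow>
    (('a, 'b) ygen list \<Rightarrow> 'k) \<Rightarrow> bool" where
  "bounded_cochain L \<phi> \<longleftrightarrow> word_cochain L \<phi> \<and> (\<exists>n. \<forall>w. n < ydeg w \<longrightarrow> \<phi> w = 0)"

lemma carrier_cochain_ring: "carrier (cochain_ring L) = lin_ext ` Collect (bounded_cochain L)"
proof -
  have "f \<in> lin_ext ` Collect (bounded_cochain L)"
    if "cochain L f" "\<forall>w. n < ydeg w \<longrightarrow> f (mon w) = 0" for f n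
  proof -
    from that obtain \<phi> where "word_cochain L \<phi>" "f = lin_ext \<phi>" unfolding cochain_iff by blast
    moreover from this that have "bounded_cochain L \<phi>" by (auto simp: bounded_cochain_def)
    ultimately show ?thesis by blast
  qed
  then show ?thesis
    by (auto simp: cochain_ring_def bounded_cochain_def cochain_lin_ext)
qed

lemma lin_ext_zero_fun': "lin_ext (\<lambda>w. 0) = (\<lambda>P. 0)"
  by (rule ext) simp

lemma carrier_cocycle_ring: "carrier (cocycle_ring L) =
   lin_ext ` {\<phi>. bounded_cochain L \<phi> \<and> codiff L \<phi> = (\<lambda>w. 0)}"
  by (auto simp: cocycle_ring_def carrier_cochain_ring lin_ext_koszul_d lin_ext_eq_iff
      simp flip: lin_ext_zero_fun')

lemma cocycle_ring_simps:
  "mult (cocycle_ring L) = cochain_mult" "one (cocycle_ring L) = counit"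
  "zero (cocycle_ring L) = (\<lambda>P. 0)" "add (cocycle_ring L) = (\<lambda>f g P. f P + g P)"
  by (simp_all add: cocycle_ring_def cochain_ring_def)

lemma coboundaries_eq: "coboundaries L = (\<lambda>\<phi>. lin_ext (codiff L \<phi>)) ` Collect (bounded_cochain L)"
  by (simp add: coboundaries_def carrier_cochain_ring image_image lin_ext_koszul_d)

section \<open>Polynomials on the odd part as cochains\<close>

lemma coinv_act_add_form:
  "coinv_act L (\<lambda>v. l v + l' v) v w = coinv_act L l v w + coinv_act L l' v w"
proof (induction w arbitrary: v)
  case (Cons g w)
  then show ?case by (cases g) simp_all
qed simp

lemma coinv_act_scale_form: "coinv_act L (\<lambda>v. c * l v) v w = c * coinv_act L l v w"
proof (induction w arbitrary: v)
  case (Cons g w)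
  then show ?case by (cases g) simp_all
qed simp

lemma degree_one_add_form:
  "degree_one L (\<lambda>v. l v + l' v) = (\<lambda>w. degree_one L l w + degree_one L l' w)"
proof
  fix w show "degree_one L (\<lambda>v. l v + l' v) w = degree_one L l w + degree_one L l' w"
  proof (induction w)
    case (Cons g w)
    then show ?case by (cases g) (simp_all add: coinv_act_add_form)
  qed simp
qed

lemma degree_one_scale_form: "degree_one L (\<lambda>v. c * l v) = (\<lambda>w. c * degree_one L l w)"
proof
  fix w show "degree_one L (\<lambda>v. c * l v) w = c * degree_one L l w"
  proof (induction w)
    case (Cons g w)
    then show ?case by (cases g) (simp_all add: coinv_act_scale_form)
  qed simp
qed

abbreviation odd_one_cochain :: "('k :: field, 'a :: ab_group_add, 'b :: ab_group_add) super_data \<Rightarrow>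
    ('b \<Rightarrow> 'k) \<Rightarrow> ('a, 'b) ygen list \<Rightarrow> 'k" where
  "odd_one_cochain L \<mu> \<equiv> degree_one L (\<lambda>v. \<mu> (snd v))"

definition monomial_cochain :: "('k :: field, 'a :: ab_group_add, 'b :: ab_group_add) super_data \<Rightarrow>
    ('b \<Rightarrow> 'k) list \<Rightarrow> ('a, 'b) ygen list \<Rightarrow> 'k" where
  "monomial_cochain L w = foldr conv (map (odd_one_cochain L) w) counit_word"

lemma monomial_cochain_simps [simp]:
  "monomial_cochain L [] = counit_word" "monomial_cochain L (\<mu> # w) = conv (odd_one_cochain L \<mu>) (monomial_cochain L w)"
  by (simp_all add: monomial_cochain_def)

definition polynomial_cochain :: "('k :: field, 'a :: ab_group_add, 'b :: ab_group_add) super_data \<Rightarrow>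
    (('b \<Rightarrow> 'k) list \<Rightarrow>\<^sub>0 'k) \<Rightarrow> ('a, 'b) ygen list \<Rightarrow> 'k" where
  "polynomial_cochain L P z = lin_ext (\<lambda>w. monomial_cochain L w z) P"

lemma counit_word_nonzeroD: "counit_word w \<noteq> 0 \<Longrightarrow> ydeg w = 0"
proof (induction w)
  case (Cons g w)
  then show ?case by (cases g) (auto simp: ydeg_def split: if_splits)
qed (simp add: ydeg_def)

lemma monomial_cochain_nonzeroD: "monomial_cochain L w z \<noteq> 0 \<Longrightarrow> ydeg z = length w"
  by (induction w arbitrary: z)
    (auto dest!: conv_nonzeroD degree_one_nonzeroD counit_word_nonzeroD)

text \<open>
  The iterated coproduct of \<open>\<gamma>\<^sub>n(y)\<close> has at most one term in which each factor has degree 1, namely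
  \<open>\<gamma>\<^sub>1(y)\<close> for each linear form.
\<close>

lemma monomial_cochain_Gam:
  "monomial_cochain L w [Gam n y] = (if length w = n then prod_list (map (\<lambda>\<mu>. \<mu> y) w) else 0)"
proof (induction w arbitrary: n)
  case (Cons \<mu> w)
  have odd: "odd_one_cochain L \<mu> [Gam i y] = (if i = 1 then \<mu> y else 0)" for i by auto
  have "monomial_cochain L (\<mu> # w) [Gam n y] =
    (\<Sum>i\<le>n. if i = 1 then \<mu> y * monomial_cochain L w [Gam (n - 1) y] else 0)"
    unfolding monomial_cochain_simps conv.simps odd by (rule sum.cong) auto
  then show ?case by (cases n) (simp_all add: Cons.IH)
qed auto

lemma polynomial_cochain_Gam:
  assumes "\<And>w. w \<in> Poly_Mapping.keys P \<Longrightarrow> length w = n"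
  shows "polynomial_cochain L P [Gam n y] = lin_ext (\<lambda>w. prod_list (map (\<lambda>\<mu>. \<mu> y) w)) P"
  by (simp add: polynomial_cochain_def lin_ext_def monomial_cochain_Gam assms)

lemma lin_ext_conv_right: "lin_ext (\<lambda>w. conv \<chi> (F w) z) P = conv \<chi> (\<lambda>z. lin_ext (\<lambda>w. F w z) P) z"
  by (simp add: lin_ext_def conv_sum_right conv_scale_right)

lemma vector_space_mult: "vector_space ((*) :: 'k :: field \<Rightarrow> 'k \<Rightarrow> 'k)"
  by unfold_locales (simp_all add: algebra_simps)

lemma odd_dual_iff:
  assumes "vector_space (oscale L)"
  shows "\<mu> \<in> odd_dual L \<longleftrightarrow> (\<forall>y y'. \<mu> (y + y') = \<mu> y + \<mu> y') \<and> (\<forall>c y. \<mu> (oscale L c y) = c * \<mu> y)"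
  using assms vector_space_mult
  by (auto simp: odd_dual_def Vector_Spaces.linear_iff)

context lie_superalgebra_char2
begin

interpretation even: vector_space "escale L" by (rule vector_space_even)
interpretation odd: vector_space "oscale L" by (rule vector_space_odd)

lemmas odd_dual = odd_dual_iff[OF vector_space_odd]

lemma odd_dual_zero: "\<mu> \<in> odd_dual L \<Longrightarrow> \<mu> 0 = 0"
  unfolding odd_dual by (metis odd.scale_zero_left mult_zero_left)

lemma linear_form_odd: "\<mu> \<in> odd_dual L \<Longrightarrow> linear_form (\<lambda>v. \<mu> (snd v))"
  by (simp add: odd_dual linear_form_def lscale_def del: split_paired_All)

text \<open>
  The definite description that defines the cochain of a linear form is resolved by the existence
  and the uniqueness of cochains of degree 1.
\<close>

lemma odd_cochain_eq:
  assumes \<mu>: "\<mu> \<in> odd_dual L"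
  shows "odd_cochain L \<mu> = lin_ext (odd_one_cochain L \<mu>)"
  unfolding odd_cochain_def
proof (rule the_equality)
  show "homogeneous_cochain L 1 (lin_ext (odd_one_cochain L \<mu>)) \<and>
    (\<forall>v. lin_ext (odd_one_cochain L \<mu>) (ysusp v) = \<mu> (snd v))"
    using word_cochain_degree_one[OF linear_form_odd[OF \<mu>]] degree_one_nonzeroD \<mu>
    by (auto simp: homogeneous_cochain_def cochain_lin_ext ysusp_def odd_dual_zero)
next
  fix f assume f: "homogeneous_cochain L 1 f \<and> (\<forall>v. f (ysusp v) = \<mu> (snd v))"
  then obtain \<phi> where \<phi>: "word_cochain L \<phi>" "f = lin_ext \<phi>"
    by (auto simp: homogeneous_cochain_def cochain_iff)
  have form: "(\<lambda>v. \<phi> [Ang (fst v)] + \<phi> [Gam 1 (snd v)]) = (\<lambda>v. \<mu> (snd v))"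
  proof
    fix v
    have "f (ysusp v) = \<mu> (snd v)" using f by blast
    then show "\<phi> [Ang (fst v)] + \<phi> [Gam 1 (snd v)] = \<mu> (snd v)" by (simp add: \<phi>(2) ysusp_def)
  qed
  have "\<phi> w = degree_one L (\<lambda>v. \<phi> [Ang (fst v)] + \<phi> [Gam 1 (snd v)]) w" for w
    using f \<phi> by (intro degree_one_unique) (auto simp: homogeneous_cochain_def)
  then have "\<phi> = odd_one_cochain L \<mu>" unfolding form by (rule ext)
  then show "f = lin_ext (odd_one_cochain L \<mu>)" using \<phi>(2) by simp
qed

lemma free_to_cochain_eq:
  assumes P: "P \<in> carrier (free_algebra (odd_dual L))"
  shows "free_to_cochain L P = lin_ext (polynomial_cochain L P)"
proof
  fix Z
  have "foldr cochain_mult (map (odd_cochain L) w) counit = lin_ext (monomial_cochain L w)"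
    if "set w \<subseteq> odd_dual L" for w
    using that by (induction w) (simp_all add: counit_eq_lin_ext odd_cochain_eq cochain_mult_lin_ext)
  then have "free_to_cochain L P Z =
    (\<Sum>w\<in>Poly_Mapping.keys P. Poly_Mapping.lookup P w * lin_ext (monomial_cochain L w) Z)"
    using P by (simp add: free_to_cochain_def)
  then show "free_to_cochain L P Z = lin_ext (polynomial_cochain L P) Z"
    unfolding polynomial_cochain_def lin_ext_def sum_distrib_left
    by (subst sum.swap) (simp add: mult.left_commute)
qed

lemma sym_rels_subset: "sym_rels L \<subseteq> carrier (free_algebra (odd_dual L))"
proof -
  have minus: "P - Q \<in> carrier (free_algebra (odd_dual L))"
    if "P \<in> carrier (free_algebra (odd_dual L))" "Q \<in> carrier (free_algebra (odd_dual L))"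
    for P Q :: "('b \<Rightarrow> 'k) list \<Rightarrow>\<^sub>0 'k"
    using that keys_diff[of P Q] by auto
  have "(\<lambda>y. \<mu> y + \<nu> y) \<in> odd_dual L" if "\<mu> \<in> odd_dual L" "\<nu> \<in> odd_dual L" for \<mu> \<nu>
    using that by (simp add: odd_dual algebra_simps)
  moreover have "(\<lambda>y. c * \<mu> y) \<in> odd_dual L" if "\<mu> \<in> odd_dual L" for c \<mu>
    using that by (simp add: odd_dual algebra_simps)
  ultimately show ?thesis
    unfolding sym_rels_def
    by (intro subsetI, elim UnE CollectE exE conjE)
      (simp only:, intro minus mult_in_free_algebra mon_in_free_algebra; simp add: zero_list_def)+
qed

lemma lin_ext_sym_ideal_zero:
  assumes "P \<in> genideal (free_algebra (odd_dual L)) (sym_rels L)"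
    and "\<And>r a b. r \<in> sym_rels L \<Longrightarrow> lin_ext (\<lambda>w. \<chi> (a @ w @ b)) r = 0"
  shows "lin_ext \<chi> P = 0"
  using lin_ext_genideal_iff[OF sym_rels_subset, of \<chi>] assms by blast

text \<open>
  The map from the free algebra to cochains factors through the symmetric algebra because the
  convolution product is commutative and bilinear.
\<close>

lemma polynomial_cochain_ideal:
  assumes "P \<in> genideal (free_algebra (odd_dual L)) (sym_rels L)"
  shows "polynomial_cochain L P z = 0"
  unfolding polynomial_cochain_def
proof (rule lin_ext_sym_ideal_zero[OF assms])
  fix r a b assume r: "r \<in> sym_rels L"
  show "lin_ext (\<lambda>w. monomial_cochain L (a @ w @ b) z) r = 0"
  proof (induction a arbitrary: z)
    case Nil
    have swap: "conv \<phi> (conv \<psi> \<chi>) z = conv \<psi> (conv \<phi> \<chi>) z" for \<phi> \<psi> \<chi>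
      by (simp only: conv_left_commute)
    from r show ?case
      unfolding sym_rels_def
    proof (elim UnE CollectE exE conjE)
      fix \<mu> \<nu> assume "r = gen \<mu> * gen \<nu> - gen \<nu> * gen \<mu>"
      then show ?thesis by (simp add: plus_list_def swap[of "odd_one_cochain L \<mu>"])
    qed (simp_all add: plus_list_def zero_list_def degree_one_add_form degree_one_scale_form
        conv_add_left conv_scale_left)
  next
    case (Cons \<mu> a)
    then show ?case by (simp add: lin_ext_conv_right)
  qed
qed

lemma sym_eval_ideal:
  assumes "P \<in> genideal (free_algebra (odd_dual L)) (sym_rels L)"
  shows "lin_ext (\<lambda>w. prod_list (map (\<lambda>\<mu>. \<mu> y) w)) P = 0"
proof (rule lin_ext_sym_ideal_zero[OF assms])
  fix r a b assume "r \<in> sym_rels L"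
  then show "lin_ext (\<lambda>w. prod_list (map (\<lambda>\<mu>. \<mu> y) (a @ w @ b))) r = (0 :: 'k)"
    unfolding sym_rels_def
    by (elim UnE CollectE exE conjE; hypsubst)
      (simp_all add: plus_list_def zero_list_def algebra_simps)
qed

lemma the_elem_constant: "X \<noteq> {} \<Longrightarrow> (\<And>x. x \<in> X \<Longrightarrow> f x = c) \<Longrightarrow> the_elem (f ` X) = c"
  by (metis (no_types, lifting) image_constant_conv the_elem_eq image_cong)

text \<open>
  Evaluation and the passage to cochains are constant on cosets, so they may be computed on a
  representative.
\<close>

lemma sym_coset:
  assumes P: "P \<in> carrier (free_algebra (odd_dual L))"
  defines "I \<equiv> genideal (free_algebra (odd_dual L)) (sym_rels L)"
  shows "sym_eval (I +>\<^bsub>free_algebra (odd_dual L)\<^esub> P) y =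
      lin_ext (\<lambda>w. prod_list (map (\<lambda>\<mu>. \<mu> y) w)) P"
    and "sym_to_cochain L (I +>\<^bsub>free_algebra (odd_dual L)\<^esub> P) = lin_ext (polynomial_cochain L P)"
proof -
  interpret FA: ring "free_algebra (odd_dual L) :: (('b \<Rightarrow> 'k) list \<Rightarrow>\<^sub>0 'k) ring"
    by (rule ring_free_algebra)
  interpret I: ideal I "free_algebra (odd_dual L)"
    unfolding I_def by (rule FA.genideal_ideal[OF sym_rels_subset])
  have coset: "I +>\<^bsub>free_algebra (odd_dual L)\<^esub> P = {h + P | h. h \<in> I}"
    by (auto simp: a_r_coset_def r_coset_def)
  have ne: "{h + P | h. h \<in> I} \<noteq> {}" using I.zero_closed by auto
  show "sym_eval (I +>\<^bsub>free_algebra (odd_dual L)\<^esub> P) y =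
      lin_ext (\<lambda>w. prod_list (map (\<lambda>\<mu>. \<mu> y) w)) P"
    unfolding sym_eval_def coset
  proof (rule the_elem_constant[OF ne])
    fix Q assume "Q \<in> {h + P | h. h \<in> I}"
    then obtain h where "h \<in> I" "Q = h + P" by blast
    moreover have "free_hom (\<lambda>c. c) (\<lambda>\<mu>. \<mu> y) Q = lin_ext (\<lambda>w. prod_list (map (\<lambda>\<mu>. \<mu> y) w)) Q"
      by (simp add: free_hom_def lin_ext_def)
    ultimately show "free_hom (\<lambda>c. c) (\<lambda>\<mu>. \<mu> y) Q = lin_ext (\<lambda>w. prod_list (map (\<lambda>\<mu>. \<mu> y) w)) P"
      using sym_eval_ideal[of h y] by (simp add: I_def)
  qed
  show "sym_to_cochain L (I +>\<^bsub>free_algebra (odd_dual L)\<^esub> P) = lin_ext (polynomial_cochain L P)"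
    unfolding sym_to_cochain_def coset
  proof (rule the_elem_constant[OF ne])
    fix Q assume "Q \<in> {h + P | h. h \<in> I}"
    then obtain h where h: "h \<in> I" "Q = h + P" by blast
    then have "Q \<in> carrier (free_algebra (odd_dual L))"
      using add_in_free_algebra[OF _ P] I.a_Hcarr by blast
    moreover have "polynomial_cochain L Q = polynomial_cochain L P"
      using h polynomial_cochain_ideal by (simp add: polynomial_cochain_def I_def fun_eq_iff)
    ultimately show "free_to_cochain L Q = lin_ext (polynomial_cochain L P)" by (simp add: free_to_cochain_eq)
  qed
qed

lemma word_cochain_monomial: "set w \<subseteq> odd_dual L \<Longrightarrow> word_cochain L (monomial_cochain L w)"
  by (induction w)
    (simp_all add: word_cochain_counit word_cochain_conv word_cochain_degree_one linear_form_odd)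

lemma bounded_polynomial_cochain:
  assumes "P \<in> carrier (free_algebra (odd_dual L))"
  shows "bounded_cochain L (polynomial_cochain L P)"
proof -
  have "word_cochain L (\<lambda>z. \<Sum>w\<in>Poly_Mapping.keys P. Poly_Mapping.lookup P w * monomial_cochain L w z)"
    using assms by (intro word_cochain_sum word_cochain_scale word_cochain_monomial) auto
  moreover have "(\<lambda>z. \<Sum>w\<in>Poly_Mapping.keys P. Poly_Mapping.lookup P w * monomial_cochain L w z) = polynomial_cochain L P"
    by (rule ext) (simp add: polynomial_cochain_def lin_ext_def)
  ultimately have "word_cochain L (polynomial_cochain L P)" by simp
  moreover have "polynomial_cochain L P z = 0" if big: "(\<Sum>w\<in>Poly_Mapping.keys P. length w) < ydeg z" for z
  proof -
    have "monomial_cochain L w z = 0" if w: "w \<in> Poly_Mapping.keys P" for w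
    proof -
      have "length w \<le> (\<Sum>w\<in>Poly_Mapping.keys P. length w)"
        by (rule member_le_sum[OF w]) simp_all
      with big have "ydeg z \<noteq> length w" by linarith
      then show ?thesis using monomial_cochain_nonzeroD by metis
    qed
    then show ?thesis by (simp add: polynomial_cochain_def lin_ext_def)
  qed
  ultimately show ?thesis unfolding bounded_cochain_def by blast
qed

end

section \<open>Classes that annihilate the cohomology ring\<close>

lemma bounded_cochain_zero: "bounded_cochain L (\<lambda>w. 0)"
  by (simp add: bounded_cochain_def word_cochain_zero)

lemma bounded_cochain_add:
  assumes "bounded_cochain L \<phi>" "bounded_cochain L \<psi>"
  shows "bounded_cochain L (\<lambda>w. \<phi> w + \<psi> w)"
proof -
  obtain m n where "\<forall>w. m < ydeg w \<longrightarrow> \<phi> w = 0" "\<forall>w. n < ydeg w \<longrightarrow> \<psi> w = 0"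
    using assms by (auto simp: bounded_cochain_def)
  then have "\<forall>w. max m n < ydeg w \<longrightarrow> \<phi> w + \<psi> w = 0" by simp
  then show ?thesis using assms word_cochain_add unfolding bounded_cochain_def by blast
qed

lemma bounded_cochain_scale: "bounded_cochain L \<phi> \<Longrightarrow> bounded_cochain L (\<lambda>w. c * \<phi> w)"
  by (auto simp: bounded_cochain_def word_cochain_scale)

lemma coset_cocycle_ring: "I +>\<^bsub>cocycle_ring L\<^esub> f = {\<lambda>P. h P + f P | h. h \<in> I}"
  by (auto simp: a_r_coset_def r_coset_def cocycle_ring_simps)

lemma coboundaries_add:
  assumes "f \<in> coboundaries L" "g \<in> coboundaries L"
  shows "(\<lambda>P. f P + g P) \<in> coboundaries L"
proof -
  obtain \<phi> \<psi> where \<phi>: "bounded_cochain L \<phi>" "f = lin_ext (codiff L \<phi>)"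
    and \<psi>: "bounded_cochain L \<psi>" "g = lin_ext (codiff L \<psi>)"
    using assms by (auto simp: coboundaries_eq)
  have "(\<lambda>P. f P + g P) = lin_ext (codiff L (\<lambda>w. \<phi> w + \<psi> w))"
    by (rule ext) (simp add: \<phi> \<psi> codiff_add[abs_def] lin_ext_add_fun)
  then show ?thesis using bounded_cochain_add[OF \<phi>(1) \<psi>(1)] by (auto simp: coboundaries_eq)
qed

lemma coboundaries_uminus:
  assumes "f \<in> coboundaries L"
  shows "(\<lambda>P. - f P) \<in> coboundaries L"
proof -
  obtain \<phi> where \<phi>: "bounded_cochain L \<phi>" "f = lin_ext (codiff L \<phi>)"
    using assms by (auto simp: coboundaries_eq)
  have "(\<lambda>P. - f P) = lin_ext (codiff L (\<lambda>w. (-1) * \<phi> w))"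
    unfolding codiff_scale[abs_def] by (rule ext) (simp add: \<phi> lin_ext_def sum_negf)
  then show ?thesis using bounded_cochain_scale[OF \<phi>(1), of "-1"] unfolding coboundaries_eq by blast
qed

lemma zero_in_coboundaries: "(\<lambda>P. 0) \<in> coboundaries L"
proof -
  have "(\<lambda>P. 0) = lin_ext (codiff L (\<lambda>w. 0))" by (rule ext) (simp add: lin_ext_def)
  then show ?thesis using bounded_cochain_zero[of L] unfolding coboundaries_eq by blast
qed

lemma coset_coboundary:
  assumes "f \<in> coboundaries L"
  shows "coboundaries L +>\<^bsub>cocycle_ring L\<^esub> f = coboundaries L"
proof
  show "coboundaries L +>\<^bsub>cocycle_ring L\<^esub> f \<subseteq> coboundaries L"
    using coboundaries_add assms by (auto simp: coset_cocycle_ring)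
  show "coboundaries L \<subseteq> coboundaries L +>\<^bsub>cocycle_ring L\<^esub> f"
  proof
    fix g assume "g \<in> coboundaries L"
    then have "(\<lambda>P. g P + - f P) \<in> coboundaries L"
      by (intro coboundaries_add coboundaries_uminus assms)
    then show "g \<in> coboundaries L +>\<^bsub>cocycle_ring L\<^esub> f"
      unfolding coset_cocycle_ring by (intro CollectI exI[of _ "\<lambda>P. g P + - f P"]) simp
  qed
qed

lemma carrier_cohomology_ring: "carrier (cohomology_ring L) =
  {coboundaries L +>\<^bsub>cocycle_ring L\<^esub> f | f. f \<in> carrier (cocycle_ring L)}"
  by (auto simp: cohomology_ring_def FactRing_def A_RCOSETS_def' )

lemma cohomology_ring_mult: "A \<otimes>\<^bsub>cohomology_ring L\<^esub> B =
  (\<Union>a\<in>A. \<Union>b\<in>B. coboundaries L +>\<^bsub>cocycle_ring L\<^esub> cochain_mult a b)"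
  by (simp add: cohomology_ring_def FactRing_def rcoset_mult_def cocycle_ring_simps)

lemma cohomology_ring_zero: "\<zero>\<^bsub>cohomology_ring L\<^esub> = coboundaries L"
  by (simp add: cohomology_ring_def FactRing_def)

lemma codiff_counit:
  fixes L :: "('k :: field, 'a :: ab_group_add, 'b :: ab_group_add) super_data"
  shows "codiff L counit_word w = 0"
proof (induction w)
  case (Cons g w)
  have "codiff_letter L g counit_word w = 0"
    by (cases "(L, g, counit_word :: ('a, 'b) ygen list \<Rightarrow> 'k, w)" rule: codiff_letter.cases) auto
  then show ?case using Cons.IH by (simp add: codiff_scale)
qed simp

lemma bounded_cochain_counit: "bounded_cochain L counit_word"
  unfolding bounded_cochain_def
  using word_cochain_counit counit_word_nonzeroD by (metis less_numeral_extra(3))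

context lie_superalgebra_char2
begin

interpretation even: vector_space "escale L" by (rule vector_space_even)
interpretation odd: vector_space "oscale L" by (rule vector_space_odd)

lemma bounded_cochain_conv:
  assumes "bounded_cochain L \<phi>" "bounded_cochain L \<psi>"
  shows "bounded_cochain L (conv \<phi> \<psi>)"
proof -
  obtain m n where mn: "\<forall>w. m < ydeg w \<longrightarrow> \<phi> w = 0" "\<forall>w. n < ydeg w \<longrightarrow> \<psi> w = 0"
    using assms by (auto simp: bounded_cochain_def)
  have "conv \<phi> \<psi> w = 0" if big: "m + n < ydeg w" for w
  proof (rule ccontr)
    assume "conv \<phi> \<psi> w \<noteq> 0"
    then obtain a b where ab: "\<phi> a \<noteq> 0" "\<psi> b \<noteq> 0" "ydeg w = ydeg a + ydeg b"
      using conv_nonzeroD by blast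
    with mn have "\<not> m < ydeg a" "\<not> n < ydeg b" by auto
    with big ab(3) show False by linarith
  qed
  then show ?thesis using assms word_cochain_conv unfolding bounded_cochain_def by blast
qed

lemma bounded_cochain_codiff:
  assumes "bounded_cochain L \<phi>"
  shows "bounded_cochain L (codiff L \<phi>)"
proof -
  obtain n where n: "\<forall>w. n < ydeg w \<longrightarrow> \<phi> w = 0" using assms by (auto simp: bounded_cochain_def)
  have "codiff L \<phi> w = 0" if big: "Suc n < ydeg w" for w
  proof (rule ccontr)
    assume "codiff L \<phi> w \<noteq> 0"
    then obtain a where "\<phi> a \<noteq> 0" "ydeg w = Suc (ydeg a)" using codiff_nonzeroD by blast
    with n big show False by auto
  qed
  then show ?thesis using assms word_cochain_codiff unfolding bounded_cochain_def by blast
qed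

lemma bounded_codiff_codiff: "bounded_cochain L \<phi> \<Longrightarrow> codiff L (codiff L \<phi>) = (\<lambda>w. 0)"
  by (rule ext) (simp add: bounded_cochain_def word_cochain_def codiff_codiff)

text \<open>
  Multiplying with the class of the counit shows that an annihilating class is zero. Conversely, the
  zero class annihilates, as coboundaries are an ideal of the cocycles: \<open>(d\<alpha>) \<tau> = d(\<alpha> \<tau>)\<close> if
  \<open>d\<tau> = 0\<close>.
\<close>

lemma phi_annihilates_iff:
  assumes \<sigma>: "sym_to_cochain L X = lin_ext \<sigma>" "bounded_cochain L \<sigma>"
  shows "phi L X \<in> trivial_annihilator L \<longleftrightarrow> (\<exists>\<psi>. bounded_cochain L \<psi> \<and> conv \<sigma> \<sigma> = codiff L \<psi>)"
proof -
  let ?I = "coboundaries L"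
  let ?s = "lin_ext (conv \<sigma> \<sigma>)"
  have phi: "phi L X = ?I +>\<^bsub>cocycle_ring L\<^esub> ?s"
    by (simp add: phi_def \<sigma>(1) cocycle_ring_simps cochain_mult_lin_ext)
  have "phi L X \<in> trivial_annihilator L \<longleftrightarrow> ?s \<in> ?I"
  proof
    assume "phi L X \<in> trivial_annihilator L"
    moreover have "?I +>\<^bsub>cocycle_ring L\<^esub> counit \<in> carrier (cohomology_ring L)"
      using bounded_cochain_counit codiff_counit
      by (fastforce simp: carrier_cohomology_ring carrier_cocycle_ring counit_eq_lin_ext fun_eq_iff)
    ultimately have I: "phi L X \<otimes>\<^bsub>cohomology_ring L\<^esub> (?I +>\<^bsub>cocycle_ring L\<^esub> counit) = ?I"
      by (simp add: trivial_annihilator_def cohomology_ring_zero)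
    have mem: "f \<in> ?I +>\<^bsub>cocycle_ring L\<^esub> f" for f
      using zero_in_coboundaries[of L] by (force simp: coset_cocycle_ring)
    have "cochain_mult ?s counit = ?s"
      unfolding counit_eq_lin_ext cochain_mult_lin_ext lin_ext_eq_iff by (rule ext) simp
    then have "?s \<in> phi L X \<otimes>\<^bsub>cohomology_ring L\<^esub> (?I +>\<^bsub>cocycle_ring L\<^esub> counit)"
      unfolding cohomology_ring_mult phi using mem by (metis (no_types, lifting) UN_I)
    then show "?s \<in> ?I" unfolding I .
  next
    assume s: "?s \<in> ?I"
    then obtain \<psi> where \<psi>: "bounded_cochain L \<psi>" "conv \<sigma> \<sigma> = codiff L \<psi>"
      by (auto simp: coboundaries_eq lin_ext_eq_iff)
    have phi_I: "phi L X = ?I" unfolding phi using s by (rule coset_coboundary)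
    have "?s \<in> carrier (cocycle_ring L)"
      using bounded_cochain_conv[OF \<sigma>(2) \<sigma>(2)] bounded_codiff_codiff[OF \<psi>(1)] \<psi>(2)
      by (auto simp: carrier_cocycle_ring)
    then have "phi L X \<in> carrier (cohomology_ring L)"
      unfolding phi carrier_cohomology_ring by blast
    moreover have "phi L X \<otimes>\<^bsub>cohomology_ring L\<^esub> e = \<zero>\<^bsub>cohomology_ring L\<^esub>"
      if "e \<in> carrier (cohomology_ring L)" for e
    proof -
      obtain \<beta> where \<beta>: "bounded_cochain L \<beta>" "codiff L \<beta> = (\<lambda>w. 0)"
        and e: "e = ?I +>\<^bsub>cocycle_ring L\<^esub> lin_ext \<beta>"
        using \<open>e \<in> _\<close> by (auto simp: carrier_cohomology_ring carrier_cocycle_ring)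
      have "?I +>\<^bsub>cocycle_ring L\<^esub> cochain_mult a b = ?I" if "a \<in> ?I" "b \<in> e" for a b
      proof (rule coset_coboundary)
        obtain \<alpha> \<eta> where \<alpha>: "bounded_cochain L \<alpha>" "a = lin_ext (codiff L \<alpha>)"
          and \<eta>: "bounded_cochain L \<eta>" "b = (\<lambda>P. lin_ext (codiff L \<eta>) P + lin_ext \<beta> P)"
          using \<open>a \<in> ?I\<close> \<open>b \<in> e\<close> unfolding e coset_cocycle_ring by (auto simp: coboundaries_eq)
        define \<tau> where "\<tau> = (\<lambda>w. codiff L \<eta> w + \<beta> w)"
        have b: "b = lin_ext \<tau>" by (simp add: \<eta>(2) \<tau>_def lin_ext_add_fun fun_eq_iff)
        have \<tau>: "bounded_cochain L \<tau>"
          unfolding \<tau>_def by (intro bounded_cochain_add bounded_cochain_codiff \<eta> \<beta>)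
        have cocycle: "codiff L \<tau> = (\<lambda>w. 0)"
          unfolding \<tau>_def codiff_add[abs_def] by (simp add: bounded_codiff_codiff[OF \<eta>(1)] \<beta>(2))
        have "codiff L (conv \<alpha> \<tau>) = conv (codiff L \<alpha>) \<tau>"
          by (rule ext) (simp add: codiff_conv cocycle)
        then have "cochain_mult a b = lin_ext (codiff L (conv \<alpha> \<tau>))"
          by (simp add: \<alpha>(2) b cochain_mult_lin_ext)
        then show "cochain_mult a b \<in> ?I"
          using bounded_cochain_conv[OF \<alpha>(1) \<tau>] by (auto simp: coboundaries_eq)
      qed
      moreover have "lin_ext \<beta> \<in> e" using zero_in_coboundaries[of L] by (force simp: e coset_cocycle_ring)
      ultimately show ?thesis
        unfolding cohomology_ring_mult phi_I cohomology_ring_zero using zero_in_coboundaries[of L] by auto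
    qed
    ultimately show "phi L X \<in> trivial_annihilator L" by (simp add: trivial_annihilator_def)
  qed
  also have "\<dots> \<longleftrightarrow> (\<exists>\<psi>. bounded_cochain L \<psi> \<and> conv \<sigma> \<sigma> = codiff L \<psi>)"
    by (auto simp: coboundaries_eq lin_ext_eq_iff)
  finally show ?thesis .
qed

section \<open>The two inclusions\<close>

lemma carrier_sym_odd_dual: "carrier (sym_odd_dual L) =
  {genideal (free_algebra (odd_dual L)) (sym_rels L) +>\<^bsub>free_algebra (odd_dual L)\<^esub> P | P.
    P \<in> carrier (free_algebra (odd_dual L))}"
  by (auto simp: sym_odd_dual_def FactRing_def A_RCOSETS_def')

text \<open>
  If \<open>q(y) = 0\<close>, the subspace spanned by \<open>y\<close> is a Lie superalgebra on which all operations are zero,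
  and its cohomology is a polynomial ring in one variable. The values on the divided powers of \<open>y\<close> are
  the restriction of a cochain to this subalgebra.
\<close>

lemma N_odd_subset: "N_odd L \<subseteq> support_variety_trivial L"
proof
  fix y assume "y \<in> N_odd L"
  then have y: "sqr L y = 0" by (simp add: N_odd_def)
  have "sym_eval X y = 0" if X: "X \<in> carrier (sym_odd_dual L)" "phi L X \<in> trivial_annihilator L" for X
  proof -
    obtain P where P: "P \<in> carrier (free_algebra (odd_dual L))"
      "X = genideal (free_algebra (odd_dual L)) (sym_rels L) +>\<^bsub>free_algebra (odd_dual L)\<^esub> P"
      using X(1) by (auto simp: carrier_sym_odd_dual)
    define \<sigma> where "\<sigma> = polynomial_cochain L P"
    have \<sigma>: "sym_to_cochain L X = lin_ext \<sigma>" "bounded_cochain L \<sigma>"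
      using sym_coset(2)[OF P(1)] bounded_polynomial_cochain[OF P(1)] by (simp_all add: P(2) \<sigma>_def)
    obtain \<psi> where \<psi>: "bounded_cochain L \<psi>" "conv \<sigma> \<sigma> = codiff L \<psi>"
      using X(2) phi_annihilates_iff[OF \<sigma>] by blast
    have resp: "annihilates L \<psi>" and Env: "\<psi> (Env u # w) = 0" for u w
      using \<psi>(1) by (auto simp: bounded_cochain_def word_cochain_def simp del: split_paired_All)
    have "\<sigma> [Gam n y] = 0" for n
    proof -
      have "(\<sigma> [Gam n y])\<^sup>2 = conv \<sigma> \<sigma> [Gam (2 * n) y]"
        by (simp add: conv_square_Gam[OF char2] power2_eq_square del: conv.simps(4))
      also have "\<dots> = codiff_letter L (Gam (2 * n) y) \<psi> []" by (simp add: \<psi>(2))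
      also have "\<dots> = 0"
        by (simp add: codiff_letter_Gam y Env Ang_null[OF annihilates_head[OF resp]])
      finally show ?thesis by simp
    qed
    moreover have "sym_eval X y = (\<Sum>n\<in>length ` Poly_Mapping.keys P. \<sigma> [Gam n y])"
    proof -
      have "(\<Sum>n\<in>length ` Poly_Mapping.keys P. \<sigma> [Gam n y]) = (\<Sum>w\<in>Poly_Mapping.keys P.
        Poly_Mapping.lookup P w * (\<Sum>n\<in>length ` Poly_Mapping.keys P. monomial_cochain L w [Gam n y]))"
        unfolding \<sigma>_def polynomial_cochain_def lin_ext_def sum_distrib_left by (rule sum.swap)
      also have "\<dots> = sym_eval X y"
        by (simp add: P(2) sym_coset(1)[OF P(1)] monomial_cochain_Gam lin_ext_def)
      finally show ?thesis by simp
    qed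
    ultimately show ?thesis by simp
  qed
  then show "y \<in> support_variety_trivial L" by (simp add: support_variety_trivial_def)
qed

lemma Gam_word_degree_zero:
  assumes "annihilates L \<phi>" "set w \<subseteq> {Gam r y | r y. True}" "ydeg w = 0"
  shows "\<phi> w = \<phi> []"
  using assms
proof (induction w arbitrary: \<phi>)
  case (Cons g w)
  then obtain y where "g = Gam 0 y" by (auto simp: ydeg_def)
  then show ?case
    using Cons head_rels.Gam_zero[OF annihilates_head[OF Cons.prems(1)]] by (simp add: ydeg_def)
qed simp

lemma Gam_word_degree_one:
  assumes "annihilates L \<phi>" "set w \<subseteq> {Gam r y | r y. True}" "ydeg w = 1"
  shows "\<exists>y. \<phi> w = \<phi> [Gam 1 y]"
  using assms
proof (induction w arbitrary: \<phi>)
  case (Cons g w)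
  then obtain r y where g: "g = Gam r y" by auto
  then have "r + ydeg w = 1" using Cons.prems(3) by (simp add: ydeg_def)
  then consider "r = 0" | "r = 1" "ydeg w = 0" by linarith
  then show ?case
  proof cases
    case 1
    then show ?thesis
      using Cons g head_rels.Gam_zero[OF annihilates_head[OF Cons.prems(1)]] by (simp add: ydeg_def)
  next
    case 2
    then have "\<phi> (g # w) = \<phi> [g]"
      using Gam_word_degree_zero[OF annihilates_Cons[OF Cons.prems(1)]] Cons.prems(2) by auto
    then show ?thesis using 2 g by auto
  qed
qed (simp add: ydeg_def)

text \<open>
  By the addition formula, \<open>\<gamma>\<^sub>1(y) \<gamma>\<^sub>1(y')\<close> is the polarization of \<open>\<gamma>\<^sub>2\<close>, so that the values on the
  second divided powers determine all values on words in divided powers of degree 2.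
\<close>

lemma Gam_word_degree_two:
  assumes "annihilates L \<phi>" "set w \<subseteq> {Gam r y | r y. True}" "ydeg w = 2"
    and zero: "\<And>y. \<phi> [Gam 2 y] = 0"
  shows "\<phi> w = 0"
  using assms(1-3)
proof (induction w)
  case (Cons g w)
  interpret head_rels L \<phi> by (rule annihilates_head[OF assms(1)])
  interpret H1: head_rels L "\<lambda>w. \<phi> (h # w)" for h
    by (intro annihilates_head annihilates_Cons assms(1))
  from Cons.prems(2) obtain r y where g: "g = Gam r y" by auto
  then have "r + ydeg w = 2" using Cons.prems(3) by (simp add: ydeg_def)
  then consider "r = 0" | "r = 1" "ydeg w = 1" | "r = 2" "ydeg w = 0" by linarith
  then show ?case
  proof cases
    case 1
    then show ?thesis using Cons g Gam_zero by (simp add: ydeg_def)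
  next
    case 2
    then obtain y' where y': "\<phi> (g # w) = \<phi> [Gam 1 y, Gam 1 y']"
      using Gam_word_degree_one[OF annihilates_Cons[OF assms(1)], of w g] Cons.prems(2) g by auto
    have "\<phi> [Gam 2 (y + y')] = \<phi> [Gam 2 y'] + \<phi> [Gam 1 y, Gam 1 y'] + \<phi> [Gam 2 y]"
      by (simp add: Gam_add Gam_zero H1.Gam_zero numeral_2_eq_2)
    then show ?thesis by (simp add: zero y')
  next
    case 3
    then have "\<phi> (g # w) = \<phi> [g]"
      using Gam_word_degree_zero[OF annihilates_Cons[OF Cons.prems(1)]] Cons.prems(2) by auto
    then show ?thesis using 3 g by (simp add: zero)
  qed
qed (simp add: ydeg_def)

text \<open>
  A quadratic form in finitely many coordinates is a quadratic polynomial in them. The coordinates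
  are added one at a time: the polar form of the vector added last with the part obtained so far is a
  linear form \<open>\<nu>\<close>, and contributes a product of two linear forms.
\<close>

lemma quadratic_form_sqr:
  fixes \<xi> :: "'a \<Rightarrow> 'k"
  assumes fin: "finite_dim L"
    and add: "\<And>x x'. \<xi> (x + x') = \<xi> x + \<xi> x'" and scale: "\<And>c x. \<xi> (escale L c x) = c * \<xi> x"
  shows "\<exists>P\<in>carrier (free_algebra (odd_dual L)). (\<forall>w\<in>Poly_Mapping.keys P. length w = 2) \<and>
    (\<forall>y. lin_ext (\<lambda>w. prod_list (map (\<lambda>\<mu>. \<mu> y) w)) P = \<xi> (sqr L y))"
proof -
  obtain B0 where "finite B0" "odd.span B0 = UNIV" using fin by (auto simp: finite_dim_def)
  then obtain B where B: "finite B" "odd.independent B" "odd.span B = UNIV"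
    using odd.maximal_independent_subset[of B0]
    by (metis finite_subset odd.span_minimal odd.subspace_span top.extremum_uniqueI)
  define r where "r = (\<lambda>e y. odd.representation B y e)"
  have r: "r e \<in> odd_dual L" for e
    by (simp add: odd_dual r_def odd.representation_add odd.representation_scale B)
  define s where "s = (\<lambda>S y. \<Sum>e\<in>S. oscale L (r e y) e)"
  define b where "b = (\<lambda>y y'. \<xi> (fst (brk L (0, y) (0, y'))))"
  have b_add: "b (y + y') z = b y z + b y' z" for y y' z
    using brk_add_left[of "(0, y)" "(0, y')" "(0, z)"] by (simp add: b_def add)
  have b_scale: "b (oscale L c y) z = c * b y z" "b z (oscale L c y) = c * b z y" for c y z
    using brk_scale_left[of c "(0, y)" "(0, z)"] brk_scale_right[of "(0, z)" c "(0, y)"]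
    by (simp_all add: b_def lscale_def scale)
  have polar: "\<xi> (sqr L (y + y')) = \<xi> (sqr L y) + \<xi> (sqr L y') + b y y'" for y y'
    by (simp add: sqr_add add b_def)
  have s_add: "s S (y + y') = s S y + s S y'" for S y y'
    using r by (simp add: s_def odd_dual odd.scale_left_distrib sum.distrib)
  have s_scale: "s S (oscale L c y) = oscale L c (s S y)" for S c y
    using r by (simp add: s_def odd_dual odd.scale_sum_right)
  have "\<exists>P\<in>carrier (free_algebra (odd_dual L)). (\<forall>w\<in>Poly_Mapping.keys P. length w = 2) \<and>
    (\<forall>y. lin_ext (\<lambda>w. prod_list (map (\<lambda>\<mu>. \<mu> y) w)) P = \<xi> (sqr L (s S y)))" if "finite S" for S
    using that
  proof (induction S rule: finite_induct)
    case empty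
    have "\<xi> 0 = 0" using scale[of 0 0] by simp
    then show ?case by (intro bexI[of _ 0]) (simp_all add: s_def)
  next
    case (insert e S)
    then obtain P where P: "P \<in> carrier (free_algebra (odd_dual L))"
      "\<And>w. w \<in> Poly_Mapping.keys P \<Longrightarrow> length w = 2"
      "\<And>y. lin_ext (\<lambda>w. prod_list (map (\<lambda>\<mu>. \<mu> y) w)) P = \<xi> (sqr L (s S y))"
      by blast
    define \<nu> where "\<nu> = (\<lambda>y. b (s S y) e)"
    have \<nu>: "\<nu> \<in> odd_dual L" by (simp add: odd_dual \<nu>_def s_add s_scale b_add b_scale)
    define P' where "P' = P + Poly_Mapping.single [r e, r e] (\<xi> (sqr L e)) + mon [r e, \<nu>]"
    have "Poly_Mapping.keys P' \<subseteq> insert [r e, r e] (insert [r e, \<nu>] (Poly_Mapping.keys P))"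
      unfolding P'_def by (auto dest!: keys_add[THEN subsetD] split: if_splits)
    then have len: "length w = 2" if "w \<in> Poly_Mapping.keys P'" for w using that P(2) by auto
    have "P' \<in> carrier (free_algebra (odd_dual L))"
      unfolding P'_def using r \<nu> by (intro add_in_free_algebra P mon_in_free_algebra) auto
    moreover have "lin_ext (\<lambda>w. prod_list (map (\<lambda>\<mu>. \<mu> y) w)) P' = \<xi> (sqr L (s (insert e S) y))" for y
    proof -
      have "s (insert e S) y = s S y + oscale L (r e y) e"
        using insert by (simp add: s_def add.commute)
      then show ?thesis
        by (simp add: P'_def P(3) polar sqr_scale scale b_scale \<nu>_def power2_eq_square algebra_simps)
    qed
    ultimately show ?case using len by blast
  qed
  from this[OF B(1)] show ?thesis
    using B by (simp add: s_def r_def odd.sum_representation_eq)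
qed

lemma separating_form:
  assumes "x \<noteq> (0 :: 'a)"
  obtains \<xi> :: "'a \<Rightarrow> 'k" where "\<And>x x'. \<xi> (x + x') = \<xi> x + \<xi> x'" "\<And>c x. \<xi> (escale L c x) = c * \<xi> x"
    "\<xi> x \<noteq> 0"
proof -
  have ind: "even.independent {x}" using assms by simp
  obtain B where B: "{x} \<subseteq> B" "B \<subseteq> UNIV" "even.independent B" "UNIV \<subseteq> even.span B"
    by (rule even.maximal_independent_subset_extend[OF subset_UNIV ind])
  have span: "v \<in> even.span B" for v using B(4) by blast
  show ?thesis
  proof (rule that[of "\<lambda>v. even.representation B v x"])
    show "even.representation B x x \<noteq> 0"
      using B by (simp add: even.representation_basis)
  qed (simp_all add: even.representation_add[OF B(3) span span]
      even.representation_scale[OF B(3) span])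
qed

text \<open>
  The quadratic form \<open>\<xi> \<circ> q\<close> is a polynomial on the odd part whose square is the coboundary of
  \<open>\<xi> d\<xi>\<close>.
\<close>

lemma support_subset:
  assumes fin: "finite_dim L"
  shows "support_variety_trivial L \<subseteq> N_odd L"
proof
  fix y assume y: "y \<in> support_variety_trivial L"
  show "y \<in> N_odd L"
  proof (rule ccontr)
    assume "y \<notin> N_odd L"
    then have "sqr L y \<noteq> 0" by (simp add: N_odd_def)
    then obtain \<xi> :: "'a \<Rightarrow> 'k" where add: "\<And>x x'. \<xi> (x + x') = \<xi> x + \<xi> x'"
      and scale: "\<And>c x. \<xi> (escale L c x) = c * \<xi> x" and nz: "\<xi> (sqr L y) \<noteq> 0"
      using separating_form by blast
    obtain P where P: "P \<in> carrier (free_algebra (odd_dual L))"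
      "\<And>w. w \<in> Poly_Mapping.keys P \<Longrightarrow> length w = 2"
      "\<And>y. lin_ext (\<lambda>w. prod_list (map (\<lambda>\<mu>. \<mu> y) w)) P = \<xi> (sqr L y)"
      using quadratic_form_sqr[OF fin add scale] by blast
    define X where
      "X = genideal (free_algebra (odd_dual L)) (sym_rels L) +>\<^bsub>free_algebra (odd_dual L)\<^esub> P"
    define \<sigma> where "\<sigma> = polynomial_cochain L P"
    have \<sigma>: "sym_to_cochain L X = lin_ext \<sigma>" "bounded_cochain L \<sigma>"
      using sym_coset(2)[OF P(1)] bounded_polynomial_cochain[OF P(1)] by (simp_all add: X_def \<sigma>_def)
    \<comment> \<open>While \<open>\<sigma>\<close> is the cochain of \<open>\<xi> \<circ> q\<close>, \<open>\<theta>\<close> is that of \<open>\<xi>\<close> and \<open>\<omega>\<close> is \<open>d\<xi>\<close>.\<close>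
    define \<theta> where "\<theta> = degree_one L (\<lambda>v. \<xi> (fst v))"
    have "linear_form (\<lambda>v. \<xi> (fst v))"
      by (simp add: linear_form_def add scale lscale_def del: split_paired_All)
    then have "word_cochain L \<theta>" unfolding \<theta>_def by (rule word_cochain_degree_one)
    moreover have "\<theta> w = 0" if "1 < ydeg w" for w
      using that degree_one_nonzeroD[of L "\<lambda>v. \<xi> (fst v)" w] unfolding \<theta>_def by force
    ultimately have \<theta>: "bounded_cochain L \<theta>" unfolding bounded_cochain_def by blast
    define \<omega> where "\<omega> = codiff L \<theta>"
    have \<omega>: "bounded_cochain L \<omega>" unfolding \<omega>_def using \<theta> by (rule bounded_cochain_codiff)
    \<comment> \<open>The exterior part of \<open>d\<xi>\<close> vanishes on words in divided powers.\<close>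
    have same: "\<sigma> w = \<omega> w" if w: "set w \<subseteq> {Gam r y | r y. True}" for w
    proof (cases "ydeg w = 2")
      case True
      have "annihilates L (\<lambda>w. \<sigma> w - \<omega> w)"
        using \<sigma>(2) \<omega> by (simp add: annihilates_diff bounded_cochain_def word_cochain_def)
      moreover have "\<sigma> [Gam 2 y] - \<omega> [Gam 2 y] = 0" for y
      proof -
        have "\<sigma> [Gam 2 y] = \<xi> (sqr L y)" unfolding \<sigma>_def by (subst polynomial_cochain_Gam) (simp_all add: P)
        moreover have "\<omega> [Gam 2 y] = - \<xi> (sqr L y)"
          by (simp add: \<omega>_def \<theta>_def numeral_2_eq_2)
        ultimately show ?thesis by (simp add: double_scalar)
      qed
      ultimately have "\<sigma> w - \<omega> w = 0"
        using Gam_word_degree_two[of "\<lambda>w. \<sigma> w - \<omega> w" w] w True by simp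
      then show ?thesis by simp
    next
      case False
      have "\<sigma> w = 0"
      proof -
        have "monomial_cochain L v w = 0" if "v \<in> Poly_Mapping.keys P" for v
          using P(2)[OF that] False monomial_cochain_nonzeroD[of L v w] by auto
        then show ?thesis by (simp add: \<sigma>_def polynomial_cochain_def lin_ext_def)
      qed
      moreover have "\<omega> w = 0"
      proof (rule ccontr)
        assume "\<omega> w \<noteq> 0"
        then obtain a where "\<theta> a \<noteq> 0" "ydeg w = Suc (ydeg a)"
          unfolding \<omega>_def using codiff_nonzeroD by blast
        then show False using False degree_one_nonzeroD unfolding \<theta>_def by fastforce
      qed
      ultimately show ?thesis by simp
    qed
    have "conv \<sigma> \<sigma> = conv \<omega> \<omega>"
      by (rule ext, rule conv_square_cong[OF char2 same])
    also have "\<dots> = codiff L (conv \<theta> \<omega>)"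
      by (rule ext) (simp add: codiff_conv \<omega>_def bounded_codiff_codiff[OF \<theta>])
    finally have "phi L X \<in> trivial_annihilator L"
      using phi_annihilates_iff[OF \<sigma>] bounded_cochain_conv[OF \<theta> \<omega>] by blast
    moreover have "X \<in> carrier (sym_odd_dual L)"
      using P(1) unfolding X_def carrier_sym_odd_dual by blast
    ultimately have "sym_eval X y = 0" using y by (simp add: support_variety_trivial_def)
    moreover have "sym_eval X y = \<xi> (sqr L y)" unfolding X_def sym_coset(1)[OF P(1)] P(3) ..
    ultimately show False using nz by simp
  qed
qed

end

theorem theorem4p5:
  fixes L :: "('k :: alg_closed_field, 'a :: ab_group_add, 'b :: ab_group_add) super_data"
  assumes "lie_superalgebra_char2 L"
    and "finite_dim L"
  shows "support_variety_trivial L = N_odd L"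
  using lie_superalgebra_char2.N_odd_subset[OF assms(1)]
    lie_superalgebra_char2.support_subset[OF assms] by blast

end
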